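(* Let $\omega:\mathbb{R}_{\geq 0}\to\mathbb{R}^3$ be continuous and bounded, let $g=[g_1,g_2,g_3]^\top\in\mathbb{R}^3$ be a constant vector, and let $\hat R:\mathbb{R}_{\geq0}\to SO(3)$ be a continuous signal. Let $N\in\mathbb{N}_{>0}$ and let $C:\mathbb{R}_{\geq0}\to\mathbb{R}^{3N\times 15}$ be continuous and bounded. Define $$A(t)=\begin{bmatrix} -\omega^\times & 0_3 & 0_3 & 0_3 & I_3\\ 0_3 & -\omega^\times & 0_3 & 0_3 & 0_3\\ 0_3&0_3&-\omega^\times&0_3&0_3\\ 0_3&0_3&0_3&-\omega^\times&0_3\\ 0_3& g_1I_3& g_2 I_3& g_3 I_3& -\omega^\times\end{bmatrix}\in\mathbb{R}^{15\times15},$$ and suppose the pair $(A(t),C(t))$ is uniformly observable. Pick $k_R>0$ and three distinct scalars $\rho_1,\rho_2,\rho_3>0$, and set $M=\mathrm{diag}(\rho_1,\rho_2,\rho_3)$ and $$\Gamma(t)=\tfrac{k_R}{2}\,[\,0_3,\ \rho_1 e_1^\times\hat R(t),\ \rho_2 e_2^\times \hat R(t),\ \rho_3 e_3^\times\hat R(t),\ 0_3\,]\in\mathbb{R}^{3\times 15}.$$ Let $Q:\mathbb{R}_{\geq0}\to\mathbb{R}^{3N\times 3N}$ and $V:\mathbb{R}_{\geq0}\to\mathbb{R}^{15\times15}$ be continuous, bounded and uniformly positive definite, let $P$ be the solution of the continuous Riccati equation $\dot P=A(t)P+PA(t)^\top-PC(t)^\top Q(t)C(t)P+V(t)$ with $P(0)$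 symmetric positive definite, and let $K(t)=P(t)C(t)^\top Q(t)$. Consider the closed-loop system on $SO(3)\times\mathbb{R}^{15}$ $$\dot{\tilde R}=\tilde R\big(-k_R\psi_a(M\tilde R)-\Gamma(t)\tilde x\big)^\times,\qquad \dot{\tilde x}=A(t)\tilde x-K(t)\sigma_y,\qquad \sigma_y=C(t)\tilde x.$$ Then: (i) all solutions converge to the set $\{(I_3,0_{15\times1})\}\cup\Psi_M$, where $\Psi_M:=\{(\tilde R,\tilde x)\in SO(3)\times\mathbb{R}^{15}:\ \tilde R=\mathcal{R}_\alpha(\pi,v),\ v\in\mathcal{E}(M),\ \tilde x=0_{15\times1}\}$; (ii) the equilibrium $(I_3,0_{15\times1})$ is locally exponentially stable; (iii) all equilibria in $\Psi_M$ are unstable, and $(I_3,0_{15\times1})$ is almost globally asymptotically stable.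
   Context: For $x\in\mathbb{R}^3$, $x^\times$ is the skew-symmetric matrix with $x^\times y=x\times y$; $\mathrm{vec}$ is its inverse. For $A\in\mathbb{R}^{3\times3}$, $\psi_a(A)=\mathrm{vec}\big((A-A^\top)/2\big)$. $e_i$ denotes the $i$-th standard basis vector of $\mathbb{R}^3$. $\mathcal{E}(M)$ is the set of unit eigenvectors of $M$, and $\mathcal{R}_\alpha(\pi,v)$ is the rotation by angle $\pi$ about the unit axis $v$. A pair $(A(t),C(t))$ of continuous bounded matrix functions is uniformly observable if there exist $\delta,\mu>0$ such that $\frac1\delta\int_t^{t+\delta}\Phi(\tau,t)^\top C(\tau)^\top C(\tau)\Phi(\tau,t)\,d\tau\geq\mu I$ for all $t\geq0$, where $\Phi$ is the state transition matrix of $A(t)$. Almost global asymptotic stability means the equilibrium is stable and attracts all solutions starting outside a set of Lebesgue measure zero. *)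

theory Defs
  imports "HOL-Analysis.Analysis"
begin

definition hat :: "real^3 \<Rightarrow> real^3^3" where
  "hat x = matrix (\<lambda>y. cross3 x y)"

text \<open>vec: inverse of hat on skew-symmetric matrices.\<close>
definition vee :: "real^3^3 \<Rightarrow> real^3" where
  "vee S = vector [S$3$2, S$1$3, S$2$1]"

definition psi_a :: "real^3^3 \<Rightarrow> real^3" where
  "psi_a A = vee ((1/2) *\<^sub>R (A - transpose A))"

definition SO3 :: "(real^3^3) set" where
  "SO3 = {R. transpose R ** R = mat 1 \<and> det R = 1}"

text \<open>Rotation by angle theta about the unit axis v (Rodrigues formula).\<close>
definition rot_axis :: "real \<Rightarrow> real^3 \<Rightarrow> real^3^3" where
  "rot_axis \<theta> v = mat 1 + sin \<theta> *\<^sub>R hat v + (1 - cos \<theta>) *\<^sub>R (hat v ** hat v)"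

text \<open>Exponential coordinates of SO(3) (used only to define null sets of SO(3)).\<close>
definition expSO3 :: "real^3 \<Rightarrow> real^3^3" where
  "expSO3 w = rot_axis (norm w) (inverse (norm w) *\<^sub>R w)"

definition unit_eigvecs :: "real^3^3 \<Rightarrow> (real^3) set" where
  "unit_eigvecs M = {v. norm v = 1 \<and> (\<exists>c. M *v v = c *\<^sub>R v)}"

datatype blk = B1 | B2 | B3 | B4 | B5

instance blk :: finite
proof
  have "(UNIV :: blk set) = {B1, B2, B3, B4, B5}"
    by (auto intro: blk.exhaust)
  then show "finite (UNIV :: blk set)" by (metis finite.emptyI finite_insert)
qed

text \<open>R^15 is represented as real^(blk \<times> 3): component (b,i) is the i-th entry of block b.\<close>
type_synonym st15 = "real^(blk \<times> 3)"

definition blockmat :: "(blk \<Rightarrow> blk \<Rightarrow> real^3^3) \<Rightarrow> real^(blk \<times> 3)^(blk \<times> 3)" where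
  "blockmat F = (\<chi> bi cj. (F (fst bi) (fst cj)) $ (snd bi) $ (snd cj))"

definition blockrow :: "(blk \<Rightarrow> real^3^3) \<Rightarrow> real^(blk \<times> 3)^3" where
  "blockrow F = (\<chi> i cj. (F (fst cj)) $ i $ (snd cj))"

definition Amat :: "(real \<Rightarrow> real^3) \<Rightarrow> real^3 \<Rightarrow> real \<Rightarrow> real^(blk \<times> 3)^(blk \<times> 3)" where
  "Amat \<omega> g t = blockmat (\<lambda>b c.
     if b = c then - hat (\<omega> t)
     else if b = B1 \<and> c = B5 then mat 1
     else if b = B5 \<and> c = B2 then (g$1) *\<^sub>R mat 1
     else if b = B5 \<and> c = B3 then (g$2) *\<^sub>R mat 1
     else if b = B5 \<and> c = B4 then (g$3) *\<^sub>R mat 1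
     else 0)"

definition Gamma :: "real \<Rightarrow> real^3 \<Rightarrow> (real \<Rightarrow> real^3^3) \<Rightarrow> real \<Rightarrow> real^(blk \<times> 3)^3" where
  "Gamma kR \<rho> Rh t = (kR / 2) *\<^sub>R blockrow (\<lambda>b.
     if b = B2 then (\<rho>$1) *\<^sub>R (hat (axis 1 1) ** Rh t)
     else if b = B3 then (\<rho>$2) *\<^sub>R (hat (axis 2 1) ** Rh t)
     else if b = B4 then (\<rho>$3) *\<^sub>R (hat (axis 3 1) ** Rh t)
     else 0)"

definition diag3 :: "real^3 \<Rightarrow> real^3^3" where
  "diag3 \<rho> = (\<chi> i j. if i = j then \<rho>$i else 0)"

definition unif_pos_def :: "(real \<Rightarrow> real^'n^'n) \<Rightarrow> bool" where
  "unif_pos_def Q \<longleftrightarrow> (\<forall>t\<ge>0. transpose (Q t) = Q t) \<and>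
     (\<exists>\<epsilon>>0. \<forall>t\<ge>0. \<forall>x. x \<bullet> (Q t *v x) \<ge> \<epsilon> * (x \<bullet> x))"

definition pos_def_mat :: "real^'n^'n \<Rightarrow> bool" where
  "pos_def_mat S \<longleftrightarrow> transpose S = S \<and> (\<forall>x. x \<noteq> 0 \<longrightarrow> x \<bullet> (S *v x) > 0)"

definition transition_matrix ::
  "(real \<Rightarrow> real^'n^'n) \<Rightarrow> (real \<Rightarrow> real \<Rightarrow> real^'n^'n) \<Rightarrow> bool" where
  "transition_matrix A \<Phi> \<longleftrightarrow> (\<forall>t\<ge>0. \<Phi> t t = mat 1 \<and>
     (\<forall>\<tau>\<ge>t. ((\<lambda>s. \<Phi> s t) has_vector_derivative (A \<tau> ** \<Phi> \<tau> t)) (at \<tau> within {t..})))"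

definition unif_observable ::
  "(real \<Rightarrow> real^'n^'n) \<Rightarrow> (real \<Rightarrow> real^'n^'m) \<Rightarrow> bool" where
  "unif_observable A C \<longleftrightarrow> (\<exists>\<Phi>. transition_matrix A \<Phi> \<and>
     (\<exists>\<delta>>0. \<exists>\<mu>>0. \<forall>t\<ge>0. \<forall>x.
        x \<bullet> ((inverse \<delta> *\<^sub>R integral {t..t+\<delta>}
              (\<lambda>\<tau>. transpose (\<Phi> \<tau> t) ** transpose (C \<tau>) ** C \<tau> ** \<Phi> \<tau> t)) *v x)
        \<ge> \<mu> * (x \<bullet> x)))"

type_synonym clstate = "(real^3^3) \<times> (real^(blk \<times> 3))"

definition cl_field ::
  "real \<Rightarrow> real^3 \<Rightarrow> (real \<Rightarrow> real^3^3) \<Rightarrow> (real \<Rightarrow> real^3) \<Rightarrow> real^3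
   \<Rightarrow> (real \<Rightarrow> real^(blk \<times> 3)^'m) \<Rightarrow> (real \<Rightarrow> real^'m^'m)
   \<Rightarrow> (real \<Rightarrow> real^(blk \<times> 3)^(blk \<times> 3)) \<Rightarrow> real \<Rightarrow> clstate \<Rightarrow> clstate" where
  "cl_field kR \<rho> Rh \<omega> g C Q P t z =
     (let R = fst z; x = snd z;
          K = P t ** transpose (C t) ** Q t
      in (R ** hat (- kR *\<^sub>R psi_a (diag3 \<rho> ** R) - Gamma kR \<rho> Rh t *v x),
          Amat \<omega> g t *v x - K *v (C t *v x)))"

definition is_solution :: "(real \<Rightarrow> clstate \<Rightarrow> clstate) \<Rightarrow> real \<Rightarrow> (real \<Rightarrow> clstate) \<Rightarrow> bool" where
  "is_solution F t0 z \<longleftrightarrow> t0 \<ge> 0 \<and> fst (z t0) \<in> SO3 \<and>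
     (\<forall>t\<ge>t0. (z has_vector_derivative F t (z t)) (at t within {t0..}))"

definition equilibrium :: "(real \<Rightarrow> clstate \<Rightarrow> clstate) \<Rightarrow> clstate \<Rightarrow> bool" where
  "equilibrium F p \<longleftrightarrow> (\<forall>t\<ge>0. F t p = 0)"

definition lyap_stable :: "(real \<Rightarrow> clstate \<Rightarrow> clstate) \<Rightarrow> clstate \<Rightarrow> bool" where
  "lyap_stable F p \<longleftrightarrow> (\<forall>t0\<ge>0. \<forall>\<epsilon>>0. \<exists>\<delta>>0. \<forall>z.
     is_solution F t0 z \<and> dist (z t0) p < \<delta> \<longrightarrow> (\<forall>t\<ge>t0. dist (z t) p < \<epsilon>))"

definition loc_exp_stable :: "(real \<Rightarrow> clstate \<Rightarrow> clstate) \<Rightarrow> clstate \<Rightarrow> bool" where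
  "loc_exp_stable F p \<longleftrightarrow> (\<exists>\<delta>>0. \<exists>c>0. \<exists>lam>0. \<forall>t0 z.
     is_solution F t0 z \<and> dist (z t0) p < \<delta> \<longrightarrow>
       (\<forall>t\<ge>t0. dist (z t) p \<le> c * exp (- lam * (t - t0)) * dist (z t0) p))"

text \<open>Null subsets of SO(3) \<times> R^15 (w.r.t. the Riemannian/Haar measure class), expressed in
  exponential coordinates of SO(3).\<close>
definition SO3_R15_null :: "clstate set \<Rightarrow> bool" where
  "SO3_R15_null S \<longleftrightarrow> {(w, x). (expSO3 w, x) \<in> S} \<in> null_sets (lborel :: ((real^3) \<times> (real^(blk \<times> 3))) measure)"

definition almost_glob_asym_stable :: "(real \<Rightarrow> clstate \<Rightarrow> clstate) \<Rightarrow> clstate \<Rightarrow> bool" where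
  "almost_glob_asym_stable F p \<longleftrightarrow> lyap_stable F p \<and>
     (\<forall>t0\<ge>0. \<exists>S. S \<subseteq> SO3 \<times> UNIV \<and> SO3_R15_null S \<and>
        (\<forall>z. is_solution F t0 z \<and> z t0 \<notin> S \<longrightarrow> (z \<longlongrightarrow> p) at_top))"

definition Psi_M :: "real^3^3 \<Rightarrow> clstate set" where
  "Psi_M M = {(rot_axis pi v, 0) | v. v \<in> unit_eigvecs M}"

end

theory Submission
  imports Defs "HOL-Real_Asymp.Real_Asymp"
begin

text \<open>The observer error \<open>x\<close> decays exponentially because \<open>x \<bullet> P\<^sup>-\<^sup>1 x\<close> is a strict Lyapunov function;
  the lower bound on \<open>P\<close> comes from \<open>V\<close>, the upper one from uniform observability through the dual
  control problem. The attitude error \<open>R\<close> then follows the gradient flow of \<open>tr (M (1 - R))\<close> with an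
  integrable input \<open>u\<close>, so Barbalat's lemma gives convergence to the critical points and adding a multiple
  of \<open>x \<bullet> P\<^sup>-\<^sup>1 x\<close> gives local exponential stability.

  For almost global attraction no stable manifold theorem is needed. Let \<open>S\<close> follow the reversed gradient
  flow with the same input. On \<open>SO(3)\<close> both equations are of Riccati type, and in
  \<open>q = det (1 + R S\<^sup>T)\<close> the input cancels: \<open>q' = (k/2) (tr (M S) - tr (M R)) q\<close>. If \<open>S\<close> is started at the
  identity at a late time \<open>T\<close> and run backwards, \<open>tr (M S)\<close> stays close to its maximum, so whenever
  \<open>tr (M R)\<close> does not tend to that maximum, \<open>q\<close> grows exponentially up to time \<open>T\<close>; being bounded, it must
  vanish initially in the limit \<open>T \<rightarrow> \<infinity>\<close>. Hence for fixed \<open>x\<close> the exceptional \<open>R\<close> differ from a fixed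
  rotation by a half turn, which is a null set.\<close>

declare transpose_matrix_vector [simp del] vector_transpose_matrix [simp del]

section \<open>Matrix calculus\<close>

lemma norm_transpose: "norm (transpose A) = norm A" for A :: "real^'n^'m"
proof -
  have "(norm (transpose A))\<^sup>2 = (norm A)\<^sup>2"
    unfolding power2_norm_eq_inner inner_vec_def transpose_def
    by simp (rule sum.swap)
  then show ?thesis by (simp add: power2_eq_iff_nonneg)
qed

lemma norm_matrix_vector_le: "norm (A *v x) \<le> norm A * norm x" for A :: "real^'n^'m"
proof -
  have "norm (A *v x) = L2_set (\<lambda>i. norm (A$i \<bullet> x)) UNIV"
    by (simp add: norm_vec_def matrix_vector_mul_component)
  also have "\<dots> \<le> L2_set (\<lambda>i. norm (A$i) * norm x) UNIV"
    by (intro L2_set_mono) (auto simp: Cauchy_Schwarz_ineq2)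
  also have "\<dots> = norm A * norm x"
    by (simp add: norm_vec_def L2_set_left_distrib)
  finally show ?thesis .
qed

lemma norm_matrix_mult_le: "norm (A ** B) \<le> norm A * norm B"
  for A :: "real^'n^'m" and B :: "real^'k^'n"
proof -
  have *: "(A ** B)$i = transpose B *v (A$i)" for i
    by (simp add: vec_eq_iff matrix_matrix_mult_def matrix_vector_mult_def transpose_def mult.commute)
  have "norm (A ** B) = L2_set (\<lambda>i. norm (transpose B *v (A$i))) UNIV"
    by (subst norm_vec_def) (simp add: *)
  also have "\<dots> \<le> L2_set (\<lambda>i. norm (A$i) * norm B) UNIV"
    by (intro L2_set_mono) (auto simp: mult.commute[of _ "norm B"] intro: order_trans[OF norm_matrix_vector_le] simp: norm_transpose)
  also have "\<dots> = norm A * norm B"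
    by (simp add: norm_vec_def[of A] L2_set_left_distrib)
  finally show ?thesis .
qed

lemma matrix_diff_ldistrib: "A ** (B - C) = A ** B - A ** C" for A :: "real^'n^'m"
  using matrix_add_ldistrib[of A "B - C" C] by (simp add: algebra_simps)

lemma matrix_add_rdistrib: "(A + B) ** C = A ** C + B ** C" for A :: "real^'n^'m"
  by (simp add: matrix_matrix_mult_def vec_eq_iff sum.distrib algebra_simps)

lemma matrix_diff_rdistrib: "(A - B) ** C = A ** C - B ** C" for A :: "real^'n^'m"
  using matrix_add_rdistrib[of "A - B" B C] by (simp add: algebra_simps)

lemma matrix_scaleR_left: "(c *\<^sub>R A) ** B = c *\<^sub>R (A ** B)" for A :: "real^'n^'m"
  by (simp add: scalar_matrix_assoc)

lemma matrix_scaleR_right: "A ** (c *\<^sub>R B) = c *\<^sub>R (A ** B)" for A :: "real^'n^'m"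
  by (simp add: matrix_scalar_ac scalar_matrix_assoc)

lemma matrix_uminus_right: "A ** (- B) = - (A ** B)" for A :: "real^'n^'m"
  using matrix_diff_ldistrib[of A 0 B] by simp

lemma matrix_uminus_left: "(- A) ** B = - (A ** B)" for A :: "real^'n^'m"
  using matrix_diff_rdistrib[of 0 A B] by simp

lemma transpose_add: "transpose (A + B) = transpose A + transpose B" for A :: "real^'n^'m"
  by (simp add: transpose_def vec_eq_iff)

lemma transpose_diff: "transpose (A - B) = transpose A - transpose B" for A :: "real^'n^'m"
  by (simp add: transpose_def vec_eq_iff)

lemma transpose_uminus: "transpose (- A) = - transpose A" for A :: "real^'n^'m"
  by (simp add: transpose_def vec_eq_iff)

lemmas matrix_algebra = matrix_add_ldistrib matrix_add_rdistrib matrix_diff_ldistrib matrix_diff_rdistrib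
  matrix_scaleR_left matrix_scaleR_right matrix_uminus_left matrix_uminus_right matrix_mul_assoc
  transpose_add transpose_diff transpose_uminus transpose_scalar matrix_transpose_mul

lemma inner_matrix_transpose: "x \<bullet> (A *v y) = (transpose A *v x) \<bullet> y" for A :: "real^'n^'m"
  by (simp add: dot_lmul_matrix transpose_matrix_vector)

lemma bounded_bilinear_matrix_vector:
  "bounded_bilinear (\<lambda>A x. A *v x :: real^'m)" for dummy :: "real^'n^'m"
proof (unfold_locales, goal_cases)
  case 5
  show ?case
    by (rule exI[of _ 1]) (use norm_matrix_vector_le in auto)
qed (simp_all add: matrix_vector_mult_add_rdistrib matrix_vector_right_distrib
    scaleR_matrix_vector_assoc matrix_vector_mult_scaleR)

lemma bounded_bilinear_matrix_matrix:
  "bounded_bilinear (\<lambda>A B. A ** B :: real^'k^'m)" for dummy :: "real^'n^'m"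
proof (unfold_locales, goal_cases)
  case 5
  show ?case
    by (rule exI[of _ 1]) (use norm_matrix_mult_le in auto)
qed (simp_all add: matrix_add_rdistrib matrix_add_ldistrib matrix_scaleR_left matrix_scaleR_right)

lemma bounded_linear_transpose: "bounded_linear (transpose :: real^'n^'m \<Rightarrow> real^'m^'n)"
  by (rule bounded_linear_intro[of _ 1]) (auto simp: transpose_add transpose_scalar norm_transpose)

lemmas has_vd_matrix_vector = bounded_bilinear.has_vector_derivative[OF bounded_bilinear_matrix_vector]
lemmas has_vd_matrix_matrix = bounded_bilinear.has_vector_derivative[OF bounded_bilinear_matrix_matrix]
lemmas has_vd_inner = bounded_bilinear.has_vector_derivative[OF bounded_bilinear_inner]
lemmas has_vd_transpose = bounded_linear.has_vector_derivative[OF bounded_linear_transpose]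

lemmas continuous_on_matrix_vector [continuous_intros] =
  bounded_bilinear.continuous_on[OF bounded_bilinear_matrix_vector]
lemmas continuous_on_matrix_matrix [continuous_intros] =
  bounded_bilinear.continuous_on[OF bounded_bilinear_matrix_matrix]
lemmas continuous_on_transpose [continuous_intros] =
  bounded_linear.continuous_on[OF bounded_linear_transpose]
lemmas tendsto_matrix_matrix = bounded_bilinear.tendsto[OF bounded_bilinear_matrix_matrix]
lemmas tendsto_transpose = bounded_linear.tendsto[OF bounded_linear_transpose]

lemma continuous_on_vd:
  assumes "\<And>t. t \<in> S \<Longrightarrow> (f has_vector_derivative f' t) (at t within S)"
  shows "continuous_on S f"
  unfolding continuous_on_eq_continuous_within
  using assms has_vector_derivative_continuous by blast

lemma vd_constant:
  fixes f :: "real \<Rightarrow> 'a::real_normed_vector"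
  assumes "convex S" "\<And>t. t \<in> S \<Longrightarrow> (f has_vector_derivative 0) (at t within S)" "s \<in> S" "t \<in> S"
  shows "f t = f s"
proof -
  obtain c where "\<And>x. x \<in> S \<Longrightarrow> f x = c"
    using has_vector_derivative_zero_constant[OF assms(1,2)] by blast
  then show ?thesis using assms by simp
qed

section \<open>Differential inequalities\<close>

lemma vd_nonincreasing:
  fixes f :: "real \<Rightarrow> real"
  assumes "a \<le> b"
    and d: "\<And>t. a \<le> t \<Longrightarrow> t \<le> b \<Longrightarrow> (f has_vector_derivative f' t) (at t within {a..b})"
    and le: "\<And>t. a \<le> t \<Longrightarrow> t \<le> b \<Longrightarrow> f' t \<le> 0"
  shows "f b \<le> f a"
proof -
  have "\<exists>x\<in>{a..b}. f b - f a = (\<lambda>h. h *\<^sub>R f' x) (b - a)"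
    using d by (intro mvt_very_simple[OF assms(1)]) (auto simp: has_vector_derivative_def)
  then obtain x where "x \<in> {a..b}" "f b - f a = (b - a) * f' x" by auto
  moreover have "(b - a) * f' x \<le> 0"
    using assms(1) le[of x] \<open>x \<in> {a..b}\<close> by (intro mult_nonneg_nonpos) auto
  ultimately show ?thesis by simp
qed

lemma vd_exp_shift: "((\<lambda>t. exp (K * (t - a))) has_vector_derivative K * exp (K * (t - a))) (at t within S)"
  for K :: real
  by (auto intro!: derivative_eq_intros simp flip: has_real_derivative_iff_has_vector_derivative)

lemma gronwall:
  fixes f :: "real \<Rightarrow> real"
  assumes "a \<le> b" "0 \<le> c" "0 \<le> K"
    and d: "\<And>t. a \<le> t \<Longrightarrow> t \<le> b \<Longrightarrow> (f has_vector_derivative f' t) (at t within {a..b})"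
    and le: "\<And>t. a \<le> t \<Longrightarrow> t \<le> b \<Longrightarrow> f' t \<le> K * f t + c"
  shows "f b \<le> exp (K * (b - a)) * (f a + c * (b - a))"
proof -
  define g where "g = (\<lambda>t. exp (- K * (t - a)) * f t - c * (t - a))"
  have "g b \<le> g a"
  proof (rule vd_nonincreasing[OF assms(1)])
    fix t assume t: "a \<le> t" "t \<le> b"
    show "(g has_vector_derivative (exp (- K * (t - a)) * f' t + (- K * exp (- K * (t - a))) * f t - c))
        (at t within {a..b})"
      unfolding g_def
      by (intro has_vector_derivative_diff has_vector_derivative_mult vd_exp_shift d t)
        (auto intro!: derivative_eq_intros)
    have "exp (- K * (t - a)) \<le> 1" using mult_nonneg_nonneg[of K "t - a"] t assms(3) by simp
    from mult_right_mono[OF this assms(2)] have "exp (- K * (t - a)) * c \<le> c" by simp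
    moreover have "exp (- K * (t - a)) * f' t \<le> exp (- K * (t - a)) * (K * f t + c)"
      using le[OF t] by (intro mult_left_mono) auto
    ultimately show "exp (- K * (t - a)) * f' t + (- K * exp (- K * (t - a))) * f t - c \<le> 0"
      by (simp only: distrib_left) (simp add: mult_ac)
  qed
  then have "exp (- K * (b - a)) * f b \<le> f a + c * (b - a)" by (simp add: g_def)
  then have "exp (K * (b - a)) * (exp (- K * (b - a)) * f b) \<le> exp (K * (b - a)) * (f a + c * (b - a))"
    by (intro mult_left_mono) auto
  moreover have "exp (K * (b - a)) * exp (- K * (b - a)) = 1" by (simp flip: exp_add)
  ultimately show ?thesis by (metis mult.assoc mult_1)
qed

lemma gronwall_decay:
  fixes f :: "real \<Rightarrow> real"
  assumes "a \<le> b"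
    and d: "\<And>t. a \<le> t \<Longrightarrow> t \<le> b \<Longrightarrow> (f has_vector_derivative f' t) (at t within {a..b})"
    and le: "\<And>t. a \<le> t \<Longrightarrow> t \<le> b \<Longrightarrow> f' t \<le> K * f t"
  shows "f b \<le> exp (K * (b - a)) * f a"
proof -
  define g where "g = (\<lambda>t. exp (- K * (t - a)) * f t)"
  have "g b \<le> g a"
  proof (rule vd_nonincreasing[OF assms(1)])
    fix t assume t: "a \<le> t" "t \<le> b"
    show "(g has_vector_derivative (exp (- K * (t - a)) * f' t + (- K * exp (- K * (t - a))) * f t))
        (at t within {a..b})"
      unfolding g_def
      by (intro has_vector_derivative_mult vd_exp_shift d t)
    have "exp (- K * (t - a)) * f' t \<le> exp (- K * (t - a)) * (K * f t)"
      using le[OF t] by (intro mult_left_mono) auto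
    then show "exp (- K * (t - a)) * f' t + (- K * exp (- K * (t - a))) * f t \<le> 0"
      by (simp add: mult_ac)
  qed
  then have "exp (- K * (b - a)) * f b \<le> f a" by (simp add: g_def)
  then have "exp (K * (b - a)) * (exp (- K * (b - a)) * f b) \<le> exp (K * (b - a)) * f a"
    by (intro mult_left_mono) auto
  moreover have "exp (K * (b - a)) * exp (- K * (b - a)) = 1" by (simp flip: exp_add)
  ultimately show ?thesis by (metis mult.assoc mult_1)
qed

lemma vd_reverse:
  assumes "\<And>t. a \<le> t \<Longrightarrow> t \<le> b \<Longrightarrow> (f has_vector_derivative f' t) (at t within {a..b})"
    and "a \<le> t" "t \<le> b"
  shows "((\<lambda>t. f (a + b - t)) has_vector_derivative - f' (a + b - t)) (at t within {a..b})"
proof -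
  have 1: "((\<lambda>t. a + b - t) has_vector_derivative (- 1)) (at t within {a..b})"
    by (auto intro!: derivative_eq_intros)
  have im: "(\<lambda>t. a + b - t) ` {a..b} \<subseteq> {a..b}" by auto
  have "(f has_vector_derivative f' (a + b - t)) (at (a + b - t) within (\<lambda>t. a + b - t) ` {a..b})"
    by (rule has_vector_derivative_within_subset[OF assms(1) im]) (use assms in auto)
  from vector_diff_chain_within[OF 1 this] show ?thesis by (simp add: o_def)
qed

lemma gronwall_backward:
  fixes f :: "real \<Rightarrow> real"
  assumes "a \<le> b" "0 \<le> c" "0 \<le> K"
    and d: "\<And>t. a \<le> t \<Longrightarrow> t \<le> b \<Longrightarrow> (f has_vector_derivative f' t) (at t within {a..b})"
    and le: "\<And>t. a \<le> t \<Longrightarrow> t \<le> b \<Longrightarrow> - f' t \<le> K * f t + c"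
  shows "f a \<le> exp (K * (b - a)) * (f b + c * (b - a))"
  using gronwall[OF assms(1-3) vd_reverse[OF d]] le assms(1) by simp

lemma norm_growth:
  fixes E :: "real \<Rightarrow> 'a::real_inner"
  assumes "a \<le> b"
    and d: "\<And>t. a \<le> t \<Longrightarrow> t \<le> b \<Longrightarrow> (E has_vector_derivative E' t) (at t within {a..b})"
    and le: "\<And>t. a \<le> t \<Longrightarrow> t \<le> b \<Longrightarrow> norm (E' t) \<le> K * norm (E t)"
  shows "norm (E b) \<le> exp (K * (b - a)) * norm (E a)"
proof -
  have "E b \<bullet> E b \<le> exp (2 * K * (b - a)) * (E a \<bullet> E a)"
  proof (rule gronwall_decay[OF assms(1)])
    fix t assume t: "a \<le> t" "t \<le> b"
    show "((\<lambda>t. E t \<bullet> E t) has_vector_derivative (E t \<bullet> E' t + E' t \<bullet> E t)) (at t within {a..b})"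
      by (rule has_vd_inner[OF d[OF t] d[OF t]])
    have "E t \<bullet> E' t \<le> norm (E t) * norm (E' t)" by (rule norm_cauchy_schwarz)
    also have "\<dots> \<le> norm (E t) * (K * norm (E t))" using le[OF t] by (intro mult_left_mono) auto
    also have "\<dots> = K * (E t \<bullet> E t)" by (simp add: power2_norm_eq_inner[symmetric] power2_eq_square)
    finally show "E t \<bullet> E' t + E' t \<bullet> E t \<le> 2 * K * (E t \<bullet> E t)" by (simp add: inner_commute)
  qed
  also have "exp (2 * K * (b - a)) = (exp (K * (b - a)))\<^sup>2"
    by (simp add: exp_double[symmetric])
  finally have "(norm (E b))\<^sup>2 \<le> (exp (K * (b - a)) * norm (E a))\<^sup>2"
    by (simp only: power2_norm_eq_inner power_mult_distrib)
  then show ?thesis by (rule power2_le_imp_le) simp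
qed

lemma linear_ode_zero:
  fixes E :: "real \<Rightarrow> 'a::real_inner"
  assumes "a \<le> b"
    and d: "\<And>t. a \<le> t \<Longrightarrow> t \<le> b \<Longrightarrow> (E has_vector_derivative E' t) (at t within {a..b})"
    and le: "\<And>t. a \<le> t \<Longrightarrow> t \<le> b \<Longrightarrow> norm (E' t) \<le> K * norm (E t)"
    and "E a = 0"
  shows "E b = 0"
  using norm_growth[OF assms(1) d le] assms(4) by simp

section \<open>Global solutions for Lipschitz fields\<close>

text \<open>The Picard operator is a contraction after weighting the unknown by \<open>exp (- K * (t - a))\<close>
  with \<open>K\<close> twice the Lipschitz constant; hence no restriction on the length of the interval.\<close>

lemma picard:
  fixes f :: "real \<Rightarrow> 'a::euclidean_space \<Rightarrow> 'a"
  assumes "a \<le> b" "0 < L"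
    and lip: "\<And>t x y. a \<le> t \<Longrightarrow> t \<le> b \<Longrightarrow> norm (f t x - f t y) \<le> L * norm (x - y)"
    and cont: "\<And>y. continuous_on {a..b} y \<Longrightarrow> continuous_on {a..b} (\<lambda>t. f t (y t))"
  shows "\<exists>y. y a = y0 \<and> (\<forall>t\<in>{a..b}. (y has_vector_derivative f t (y t)) (at t within {a..b}))"
proof -
  define K where "K = 2 * L"
  have K: "0 < K" using assms by (simp add: K_def)
  define J where "J = (\<lambda>z t. exp (- K * (t - a)) *\<^sub>R
    (y0 + integral {a..t} (\<lambda>s. f s (exp (K * (s - a)) *\<^sub>R z s))))"
  have cf: "continuous_on {a..b} (\<lambda>s. f s (exp (K * (s - a)) *\<^sub>R z s))"
    if "continuous_on {a..b} z" for z
    by (intro cont continuous_intros that)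
  have cJ: "continuous_on {a..b} (J z)" if "continuous_on {a..b} z" for z
    unfolding J_def
    by (intro continuous_intros indefinite_integral_continuous_1 integrable_continuous_real cf that)
  have "\<exists>h::real \<Rightarrow>\<^sub>C 'a. \<forall>t. h t = J (apply_bcontfun z) (clamp a b t)" for z
  proof -
    have "continuous_on (cbox a b) (J (apply_bcontfun z))"
      by (simp add: cbox_interval) (intro cJ continuous_intros continuous_on_apply_bcontfun)
    then show ?thesis by (elim continuous_on_cbox_bcontfunE) blast
  qed
  then obtain T where T: "\<And>z t. apply_bcontfun (T z) t = J (apply_bcontfun z) (clamp a b t)" by metis
  have contr: "dist (T z) (T w) \<le> (1/2) * dist z w" for z w
  proof (rule dist_bound)
    fix t0
    define t where "t = clamp a b t0"
    have t: "a \<le> t" "t \<le> b" using clamp_in_interval[of a b t0] assms(1) by (auto simp: t_def)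
    have sub: "{a..t} \<subseteq> {a..b}" using t by auto
    define D where "D = dist z w"
    have int: "(\<lambda>s. f s (exp (K * (s - a)) *\<^sub>R apply_bcontfun z s)) integrable_on {a..t}" for z
      by (intro integrable_continuous_real continuous_on_subset[OF cf sub]) (intro continuous_on_apply_bcontfun continuous_on_id)
    have hi: "((\<lambda>s. L * D * exp (K * (s - a))) has_integral
        (L * D * exp (K * (t - a)) / K - L * D * exp (K * (a - a)) / K)) {a..t}"
      using K t by (intro fundamental_theorem_of_calculus)
        (auto intro!: derivative_eq_intros simp flip: has_real_derivative_iff_has_vector_derivative)
    have "norm (integral {a..t} (\<lambda>s. f s (exp (K * (s - a)) *\<^sub>R z s)) -
        integral {a..t} (\<lambda>s. f s (exp (K * (s - a)) *\<^sub>R w s))) =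
        norm (integral {a..t} (\<lambda>s. f s (exp (K * (s - a)) *\<^sub>R z s) - f s (exp (K * (s - a)) *\<^sub>R w s)))"
      by (simp add: integral_diff int)
    also have "\<dots> \<le> integral {a..t} (\<lambda>s. L * D * exp (K * (s - a)))"
    proof (rule integral_norm_bound_integral)
      show "(\<lambda>s. f s (exp (K * (s - a)) *\<^sub>R z s) - f s (exp (K * (s - a)) *\<^sub>R w s)) integrable_on {a..t}"
        by (intro integrable_diff int)
      show "(\<lambda>s. L * D * exp (K * (s - a))) integrable_on {a..t}" using hi by blast
      fix s assume s: "s \<in> {a..t}"
      have "norm (f s (exp (K * (s - a)) *\<^sub>R z s) - f s (exp (K * (s - a)) *\<^sub>R w s))
        \<le> L * norm (exp (K * (s - a)) *\<^sub>R z s - exp (K * (s - a)) *\<^sub>R w s)"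
        using s t by (intro lip) auto
      also have "\<dots> = L * (exp (K * (s - a)) * dist (z s) (w s))"
        by (simp add: scaleR_diff_right[symmetric] dist_norm)
      also have "\<dots> \<le> L * (exp (K * (s - a)) * D)"
        unfolding D_def using assms(2) by (intro mult_left_mono dist_bounded) auto
      finally show "norm (f s (exp (K * (s - a)) *\<^sub>R z s) - f s (exp (K * (s - a)) *\<^sub>R w s))
        \<le> L * D * exp (K * (s - a))" by (simp add: mult_ac)
    qed
    also have "\<dots> = L * D * exp (K * (t - a)) / K - L * D / K"
      using integral_unique[OF hi] by simp
    also have "\<dots> \<le> L * D * exp (K * (t - a)) / K"
      using K assms(2) by (simp add: D_def)
    also have "\<dots> = D / 2 * exp (K * (t - a))"
      using assms(2) by (simp add: K_def)
    finally have *: "norm (integral {a..t} (\<lambda>s. f s (exp (K * (s - a)) *\<^sub>R z s)) -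
        integral {a..t} (\<lambda>s. f s (exp (K * (s - a)) *\<^sub>R w s))) \<le> D / 2 * exp (K * (t - a))" .
    have "dist (T z t0) (T w t0) = exp (- K * (t - a)) *
      norm (integral {a..t} (\<lambda>s. f s (exp (K * (s - a)) *\<^sub>R z s)) -
        integral {a..t} (\<lambda>s. f s (exp (K * (s - a)) *\<^sub>R w s)))"
      by (simp add: T t_def[symmetric] J_def dist_norm scaleR_diff_right[symmetric])
    also have "\<dots> \<le> exp (- K * (t - a)) * (D / 2 * exp (K * (t - a)))"
      by (intro mult_left_mono *) auto
    also have "\<dots> = 1/2 * D" by (simp add: exp_minus)
    finally show "dist (T z t0) (T w t0) \<le> 1 / 2 * dist z w" by (simp add: D_def)
  qed
  obtain z where z: "T z = z"
    using banach_fix_type[of "1/2" T] contr by auto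
  define y where "y = (\<lambda>t. y0 + integral {a..t} (\<lambda>s. f s (exp (K * (s - a)) *\<^sub>R apply_bcontfun z s)))"
  have zy: "exp (K * (t - a)) *\<^sub>R apply_bcontfun z t = y t" if "t \<in> {a..b}" for t
  proof -
    have "apply_bcontfun z t = J (apply_bcontfun z) t"
      using T[of z t] that by (simp add: z cbox_interval clamp_cancel_cbox)
    then show ?thesis by (simp add: J_def y_def exp_minus)
  qed
  have "(y has_vector_derivative f t (y t)) (at t within {a..b})" if "t \<in> {a..b}" for t
  proof -
    have "(y has_vector_derivative (0 + f t (exp (K * (t - a)) *\<^sub>R apply_bcontfun z t))) (at t within {a..b})"
      unfolding y_def
      by (intro has_vector_derivative_add has_vector_derivative_const
          integral_has_vector_derivative[OF cf that]) (intro continuous_on_apply_bcontfun continuous_on_id)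
    then show ?thesis using zy[OF that] by simp
  qed
  moreover have "y a = y0" by (simp add: y_def)
  ultimately show ?thesis by blast
qed

lemma picard_backward:
  fixes f :: "real \<Rightarrow> 'a::euclidean_space \<Rightarrow> 'a"
  assumes "a \<le> b" "0 < L"
    and lip: "\<And>t x y. a \<le> t \<Longrightarrow> t \<le> b \<Longrightarrow> norm (f t x - f t y) \<le> L * norm (x - y)"
    and cont: "\<And>y. continuous_on {a..b} y \<Longrightarrow> continuous_on {a..b} (\<lambda>t. f t (y t))"
  shows "\<exists>y. y b = y0 \<and> (\<forall>t\<in>{a..b}. (y has_vector_derivative f t (y t)) (at t within {a..b}))"
proof -
  have rev: "continuous_on {a..b} (\<lambda>t. h (a + b - t))" if "continuous_on {a..b} h" for h :: "real \<Rightarrow> 'a"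
    by (rule continuous_on_compose2[OF that]) (auto intro!: continuous_intros)
  have "continuous_on {a..b} (\<lambda>t. - f (a + b - t) (y t))" if "continuous_on {a..b} y" for y
    using rev[OF cont[OF rev[OF that]]] by (auto intro!: continuous_intros)
  then obtain y where y: "y a = y0"
    "\<And>t. t \<in> {a..b} \<Longrightarrow> (y has_vector_derivative - f (a + b - t) (y t)) (at t within {a..b})"
    using picard[of a b L "\<lambda>t x. - f (a + b - t) x" y0] assms(1,2) lip
    by (auto simp: norm_minus_commute)
  have "((\<lambda>t. y (a + b - t)) has_vector_derivative f t (y (a + b - t))) (at t within {a..b})"
    if "t \<in> {a..b}" for t
    using vd_reverse[of a b y "\<lambda>t. - f (a + b - t) (y t)" t] y(2) that by auto
  then show ?thesis using y(1) by (intro exI[of _ "\<lambda>t. y (a + b - t)"]) auto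
qed

lemma linear_ode_exists:
  fixes A :: "real \<Rightarrow> 'a \<Rightarrow> 'a::euclidean_space"
  assumes "a \<le> b" "0 < L"
    and lin: "\<And>t. a \<le> t \<Longrightarrow> t \<le> b \<Longrightarrow> linear (A t)"
    and lip: "\<And>t x. a \<le> t \<Longrightarrow> t \<le> b \<Longrightarrow> norm (A t x) \<le> L * norm x"
    and cont: "\<And>y. continuous_on {a..b} y \<Longrightarrow> continuous_on {a..b} (\<lambda>t. A t (y t))"
  shows "\<exists>y. y a = y0 \<and> (\<forall>t\<in>{a..b}. (y has_vector_derivative A t (y t)) (at t within {a..b}))"
  using lip by (intro picard[OF assms(1,2) _ cont]) (auto simp flip: linear_diff[OF lin])

section \<open>The Riccati equation\<close>

lemma quadratic_form_scale:
  fixes S :: "real^'n^'n"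
  assumes "\<And>u. norm u = 1 \<Longrightarrow> e \<le> u \<bullet> (S *v u)"
  shows "e * (x \<bullet> x) \<le> x \<bullet> (S *v x)"
proof (cases "x = 0")
  case False
  have "e \<le> (inverse (norm x) *\<^sub>R x) \<bullet> (S *v (inverse (norm x) *\<^sub>R x))"
    using False by (intro assms) simp
  also have "\<dots> = (x \<bullet> (S *v x)) / (norm x)\<^sup>2"
    by (simp add: matrix_vector_mult_scaleR power2_eq_square field_simps)
  finally show ?thesis using False by (simp add: field_simps power2_norm_eq_inner)
qed simp

lemma quadratic_form_le: "\<bar>x \<bullet> (A *v x)\<bar> \<le> norm A * (x \<bullet> x)" for A :: "real^'n^'n"
proof -
  have "\<bar>x \<bullet> (A *v x)\<bar> \<le> norm x * (norm A * norm x)"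
    by (intro order_trans[OF Cauchy_Schwarz_ineq2] mult_left_mono norm_matrix_vector_le) auto
  then show ?thesis by (simp add: power2_norm_eq_inner[symmetric] power2_eq_square mult_ac)
qed

lemma pos_def_lower_bound:
  assumes "pos_def_mat S"
  obtains e where "0 < e" "\<And>x. e * (x \<bullet> x) \<le> x \<bullet> (S *v x)"
proof -
  have "continuous_on (sphere 0 1) (\<lambda>x. x \<bullet> (S *v x))"
    by (intro continuous_intros)
  then obtain u where u: "norm u = 1" and min: "\<And>x. norm x = 1 \<Longrightarrow> u \<bullet> (S *v u) \<le> x \<bullet> (S *v x)"
    using continuous_attains_inf[of "sphere 0 1" "\<lambda>x. x \<bullet> (S *v x)"] by auto
  have "u \<noteq> 0" using u by auto
  then have "0 < u \<bullet> (S *v u)" using assms unfolding pos_def_mat_def by blast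
  moreover have "(u \<bullet> (S *v u)) * (x \<bullet> x) \<le> x \<bullet> (S *v x)" for x
    by (rule quadratic_form_scale[OF min])
  ultimately show ?thesis by (rule that)
qed

lemma psd_null:
  fixes S :: "real^'n^'n"
  assumes "transpose S = S" "\<And>x. 0 \<le> x \<bullet> (S *v x)" "x \<bullet> (S *v x) = 0"
  shows "S *v x = 0"
proof -
  define y where "y = S *v x"
  define N where "N = y \<bullet> y"
  define c where "c = y \<bullet> (S *v y)"
  define s where "s = - N / (c + 1)"
  have c: "0 \<le> c" using assms(2) by (simp add: c_def)
  have sym: "x \<bullet> (S *v y) = N"
    by (simp add: inner_matrix_transpose assms(1)) (simp add: N_def y_def)
  have "0 \<le> (x + s *\<^sub>R y) \<bullet> (S *v (x + s *\<^sub>R y))" by (rule assms(2))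
  also have "\<dots> = 2 * s * N + s\<^sup>2 * c"
    using assms(3) sym
    by (simp add: algebra_simps matrix_vector_right_distrib matrix_vector_mult_scaleR inner_simps
        c_def power2_eq_square y_def[symmetric] N_def[symmetric])
  also have "\<dots> = - (N\<^sup>2 * (c + 2)) / (c + 1)\<^sup>2"
    using c unfolding s_def by (simp add: divide_simps power2_eq_square) (simp add: algebra_simps)
  finally have "N\<^sup>2 * (c + 2) \<le> 0"
    using c by (simp add: divide_le_0_iff)
  then have "N = 0" using c by (simp add: mult_le_0_iff)
  then show ?thesis by (simp add: N_def y_def)
qed

lemma vd_solve:
  fixes P :: "real \<Rightarrow> real^'n^'n"
  assumes P: "(P has_vector_derivative P') (at t within S)"
    and x: "(x has_vector_derivative x') (at t within S)"
    and eq: "\<And>s. s \<in> S \<Longrightarrow> P s *v y s = x s" and "t \<in> S" "0 < e"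
    and low: "\<And>s v. s \<in> S \<Longrightarrow> e * norm v \<le> norm (P s *v v)"
  obtains y' where "(y has_vector_derivative y') (at t within S)" "P t *v y' = x' - P' *v y t"
proof -
  have "inj ((*v) (P t))"
  proof (rule injI)
    fix v w assume "P t *v v = P t *v w"
    then have "e * norm (v - w) \<le> 0"
      using low[OF \<open>t \<in> S\<close>, of "v - w"] by (simp add: matrix_vector_mult_diff_distrib)
    then show "v = w" using \<open>0 < e\<close> by (simp add: mult_le_0_iff)
  qed
  then have "surj ((*v) (P t))"
    by (intro linear_injective_imp_surjective) auto
  then obtain y' where y': "P t *v y' = x' - P' *v y t" by (metis surjD)
  define r where "r = (\<lambda>s. x s - x t - (P s - P t) *v y t - (s - t) *\<^sub>R (x' - P' *v y t)
      - (s - t) *\<^sub>R ((P s - P t) *v y'))"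
  have "(r has_vector_derivative (x' - 0 - ((P t - P t) *v 0 + (P' - 0) *v y t) - (1 *\<^sub>R (x' - P' *v y t))
      - ((t - t) *\<^sub>R ((P t - P t) *v 0 + (P' - 0) *v y') + 1 *\<^sub>R ((P t - P t) *v y')))) (at t within S)"
    unfolding r_def
    by (intro has_vector_derivative_diff has_vd_matrix_vector has_vector_derivative_const
        has_vector_derivative_scaleR P x)
      (auto intro!: derivative_eq_intros)
  then have "(r has_vector_derivative 0) (at t within S)" by simp
  moreover have "r t = 0" by (simp add: r_def)
  ultimately have r0: "((\<lambda>s. (1 / norm (s - t)) *\<^sub>R r s) \<longlongrightarrow> 0) (at t within S)"
    by (simp add: has_vector_derivative_def has_derivative_within)
  have r: "P s *v (y s - (y t + (s - t) *\<^sub>R y')) = r s" if "s \<in> S" for s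
  proof -
    have "P s *v y t = x t + (P s - P t) *v y t"
      using eq[OF \<open>t \<in> S\<close>] by (simp add: matrix_vector_mult_diff_rdistrib)
    moreover have "P s *v y' = (x' - P' *v y t) + (P s - P t) *v y'"
      using y' by (simp add: matrix_vector_mult_diff_rdistrib)
    ultimately show ?thesis
      by (simp add: r_def eq[OF that] matrix_vector_mult_diff_distrib matrix_vector_right_distrib
          matrix_vector_mult_scaleR scaleR_add_right)
  qed
  have "((\<lambda>s. (1 / norm (s - t)) *\<^sub>R (y s - (y t + (s - t) *\<^sub>R y'))) \<longlongrightarrow> 0) (at t within S)"
  proof (rule Lim_null_comparison)
    show "((\<lambda>s. norm ((1 / norm (s - t)) *\<^sub>R r s) / e) \<longlongrightarrow> 0) (at t within S)"
      using tendsto_divide[OF tendsto_norm[OF r0] tendsto_const, of e] \<open>0 < e\<close> by simp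
    have "norm (y s - (y t + (s - t) *\<^sub>R y')) \<le> norm (r s) / e" if "s \<in> S" for s
      using low[OF that, of "y s - (y t + (s - t) *\<^sub>R y')"] r[OF that] \<open>0 < e\<close>
      by (simp add: field_simps)
    then have "norm ((1 / norm (s - t)) *\<^sub>R (y s - (y t + (s - t) *\<^sub>R y')))
      \<le> norm ((1 / norm (s - t)) *\<^sub>R r s) / e" if "s \<in> S" for s
      using mult_left_mono[of "norm (y s - (y t + (s - t) *\<^sub>R y'))" "norm (r s) / e" "1 / \<bar>s - t\<bar>"] that
      by simp
    then show "\<forall>\<^sub>F s in at t within S. norm ((1 / norm (s - t)) *\<^sub>R (y s - (y t + (s - t) *\<^sub>R y')))
      \<le> norm ((1 / norm (s - t)) *\<^sub>R r s) / e"
      by (auto simp: eventually_at_filter)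
  qed
  then have "(y has_vector_derivative y') (at t within S)"
    by (simp add: has_vector_derivative_def has_derivative_within bounded_linear_scaleR_left)
  then show ?thesis using y' by (rule that)
qed

locale riccati =
  fixes A :: "real \<Rightarrow> real^'n^'n" and C :: "real \<Rightarrow> real^'n^'m" and Q :: "real \<Rightarrow> real^'m^'m"
    and V P :: "real \<Rightarrow> real^'n^'n"
  assumes A_cont: "continuous_on {0..} A" and A_bdd: "bounded (A ` {0..})"
    and C_cont: "continuous_on {0..} C" and C_bdd: "bounded (C ` {0..})"
    and obs: "unif_observable A C"
    and Q_cont: "continuous_on {0..} Q" and Q_bdd: "bounded (Q ` {0..})" and Q_pd: "unif_pos_def Q"
    and V_bdd: "bounded (V ` {0..})" and V_pd: "unif_pos_def V"
    and P_ric: "\<forall>t\<ge>0. (P has_vector_derivative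
        (A t ** P t + P t ** transpose (A t)
         - P t ** transpose (C t) ** Q t ** C t ** P t + V t)) (at t within {0..})"
    and P0: "pos_def_mat (P 0)"
begin

definition B :: "real \<Rightarrow> real^'n^'n" where "B t = transpose (C t) ** Q t ** C t"

definition P' :: "real \<Rightarrow> real^'n^'n" where
  "P' t = A t ** P t + P t ** transpose (A t) - P t ** B t ** P t + V t"

lemma P_deriv: "0 \<le> t \<Longrightarrow> S \<subseteq> {0..} \<Longrightarrow> (P has_vector_derivative P' t) (at t within S)"
  using P_ric by (auto simp: P'_def B_def matrix_mul_assoc intro: has_vector_derivative_within_subset)

lemma P_cont: "continuous_on {0..} P"
  by (rule continuous_on_vd[of _ _ P']) (auto intro: P_deriv)

lemma B_cont: "continuous_on {0..} B"
  unfolding B_def by (intro continuous_intros C_cont Q_cont)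

lemma A_bound: obtains a where "0 < a" "\<And>t. 0 \<le> t \<Longrightarrow> norm (A t) \<le> a"
  using A_bdd unfolding bounded_pos by auto

lemma V_bound: obtains v where "0 < v" "\<And>t. 0 \<le> t \<Longrightarrow> norm (V t) \<le> v"
  using V_bdd unfolding bounded_pos by auto

lemma B_bound: obtains b where "0 < b" "\<And>t. 0 \<le> t \<Longrightarrow> norm (B t) \<le> b"
proof -
  obtain c where c: "0 < c" "\<And>t. 0 \<le> t \<Longrightarrow> norm (C t) \<le> c"
    using C_bdd unfolding bounded_pos by auto
  obtain q where q: "0 < q" "\<And>t. 0 \<le> t \<Longrightarrow> norm (Q t) \<le> q"
    using Q_bdd unfolding bounded_pos by auto
  have "norm (B t) \<le> c * q * c" if "0 \<le> t" for t
  proof -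
    have "norm (B t) \<le> norm (transpose (C t) ** Q t) * norm (C t)"
      unfolding B_def by (rule norm_matrix_mult_le)
    also have "\<dots> \<le> (norm (transpose (C t)) * norm (Q t)) * norm (C t)"
      by (intro mult_right_mono norm_matrix_mult_le) auto
    also have "\<dots> \<le> c * q * c"
      using c q that by (intro mult_mono) (auto simp: norm_transpose)
    finally show ?thesis .
  qed
  with c q that[of "c * q * c"] show ?thesis by simp
qed

lemma Q_sym: "0 \<le> t \<Longrightarrow> transpose (Q t) = Q t" and V_sym: "0 \<le> t \<Longrightarrow> transpose (V t) = V t"
  using Q_pd V_pd by (auto simp: unif_pos_def_def)

lemma B_sym: "0 \<le> t \<Longrightarrow> transpose (B t) = B t"
  by (simp add: B_def matrix_transpose_mul Q_sym matrix_mul_assoc)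

lemma B_inner: "x \<bullet> (B t *v x) = (C t *v x) \<bullet> (Q t *v (C t *v x))"
  by (simp add: B_def matrix_vector_mul_assoc[symmetric] inner_matrix_transpose[of x])

lemma B_psd: "0 \<le> t \<Longrightarrow> 0 \<le> x \<bullet> (B t *v x)"
proof -
  assume t: "0 \<le> t"
  obtain e where "0 < e" "\<And>y. y \<bullet> (Q t *v y) \<ge> e * (y \<bullet> y)"
    using Q_pd t unfolding unif_pos_def_def by blast
  moreover from this(1) have "0 \<le> e * (y \<bullet> y)" for y :: "real^'m" by simp
  ultimately show ?thesis unfolding B_inner by (meson order_trans)
qed

lemma P_sym:
  assumes "0 \<le> T"
  shows "transpose (P T) = P T"
proof -
  define E where "E = (\<lambda>t. P t - transpose (P t))"
  obtain a where a: "0 < a" "\<And>t. 0 \<le> t \<Longrightarrow> norm (A t) \<le> a" by (rule A_bound) blast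
  obtain b where b: "0 < b" "\<And>t. 0 \<le> t \<Longrightarrow> norm (B t) \<le> b" by (rule B_bound) blast
  have "bounded (P ` {0..T})"
    by (intro compact_imp_bounded compact_continuous_image continuous_on_subset[OF P_cont]) auto
  then obtain p where p: "0 < p" "\<And>t. 0 \<le> t \<Longrightarrow> t \<le> T \<Longrightarrow> norm (P t) \<le> p"
    unfolding bounded_pos by auto
  have "E T = 0"
  proof (rule linear_ode_zero[OF assms])
    show "E 0 = 0" using P0 by (simp add: E_def pos_def_mat_def)
    fix t assume t: "0 \<le> t" "t \<le> T"
    show "(E has_vector_derivative (P' t - transpose (P' t))) (at t within {0..T})"
      unfolding E_def using t
      by (intro has_vector_derivative_diff has_vd_transpose P_deriv) auto
    have eq: "P' t - transpose (P' t) = A t ** E t + E t ** transpose (A t)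
        - (E t ** B t ** P t + transpose (P t) ** B t ** E t)"
      using t by (simp add: P'_def E_def matrix_algebra B_sym V_sym)
    have n1: "norm (X ** Y ** Z) \<le> norm X * norm Y * norm Z" for X Y Z :: "real^'n^'n"
      by (rule order_trans[OF norm_matrix_mult_le]) (intro mult_right_mono norm_matrix_mult_le, auto)
    have "norm (E t ** B t ** P t) \<le> norm (E t) * b * p"
      using a b p t by (intro order_trans[OF n1] mult_mono) auto
    moreover have "norm (transpose (P t) ** B t ** E t) \<le> p * b * norm (E t)"
      using a b p t by (intro order_trans[OF n1] mult_mono) (auto simp: norm_transpose)
    moreover have "norm (A t ** E t) \<le> a * norm (E t)"
      using a t by (intro order_trans[OF norm_matrix_mult_le] mult_right_mono) auto
    moreover have "norm (E t ** transpose (A t)) \<le> norm (E t) * a"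
      using a t by (intro order_trans[OF norm_matrix_mult_le] mult_left_mono) (auto simp: norm_transpose)
    moreover have "norm (P' t - transpose (P' t)) \<le> norm (A t ** E t) + norm (E t ** transpose (A t))
        + (norm (E t ** B t ** P t) + norm (transpose (P t) ** B t ** E t))"
      unfolding eq
      by (intro norm_triangle_le_diff add_mono norm_triangle_ineq)
    ultimately show "norm (P' t - transpose (P' t)) \<le> (2 * a + 2 * p * b) * norm (E t)"
      by (simp add: algebra_simps)
  qed
  then show ?thesis by (simp add: E_def)
qed

lemma P'_inner:
  assumes "0 \<le> t"
  shows "x \<bullet> (P' t *v x) = 2 * (x \<bullet> (A t *v (P t *v x))) - (P t *v x) \<bullet> (B t *v (P t *v x)) + x \<bullet> (V t *v x)"
proof -
  have "x \<bullet> (P t *v (transpose (A t) *v x)) = x \<bullet> (A t *v (P t *v x))"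
    using assms inner_matrix_transpose[of x "P t" "transpose (A t) *v x"]
      inner_matrix_transpose[of "P t *v x" "transpose (A t)" x]
    by (simp add: P_sym inner_commute)
  moreover have "x \<bullet> (P t *v (B t *v (P t *v x))) = (P t *v x) \<bullet> (B t *v (P t *v x))"
    using assms by (simp add: inner_matrix_transpose[of x] P_sym)
  ultimately show ?thesis
    by (simp add: P'_def matrix_vector_mult_add_rdistrib matrix_vector_mult_diff_rdistrib
        inner_add_right inner_diff_right matrix_vector_mul_assoc[symmetric])
qed

text \<open>At the first time where the smallest eigenvalue of \<open>P\<close> drops to \<open>\<epsilon>\<close>, with unit eigenvector \<open>x\<close>,
  one has \<open>(x \<bullet> P x)' = 2 \<epsilon> x \<bullet> A x - \<epsilon>\<^sup>2 x \<bullet> B x + x \<bullet> V x\<close>, which is positive for small \<open>\<epsilon>\<close>.\<close>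

lemma P_lower_bound: obtains e where "0 < e" "\<And>t x. 0 \<le> t \<Longrightarrow> e * (x \<bullet> x) \<le> x \<bullet> (P t *v x)"
proof -
  obtain a where a: "0 < a" "\<And>t. 0 \<le> t \<Longrightarrow> norm (A t) \<le> a" by (rule A_bound) blast
  obtain b where b: "0 < b" "\<And>t. 0 \<le> t \<Longrightarrow> norm (B t) \<le> b" by (rule B_bound) blast
  obtain v where v: "0 < v" "\<And>t y. 0 \<le> t \<Longrightarrow> y \<bullet> (V t *v y) \<ge> v * (y \<bullet> y)"
    using V_pd unfolding unif_pos_def_def by auto
  obtain e0 where e0: "0 < e0" "\<And>x. e0 * (x \<bullet> x) \<le> x \<bullet> (P 0 *v x)"
    by (rule pos_def_lower_bound[OF P0]) blast
  define x0 where "x0 = v / (2 * (2 * a + b))"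
  have x0: "0 < x0" "x0 * (2 * (2 * a + b)) = v" using a b v by (auto simp: x0_def)
  define e where "e = min 1 (min (e0 / 2) x0)"
  have e: "0 < e" "e \<le> 1" "e < e0" "e \<le> x0"
    using x0 e0(1) by (auto simp: e_def min_def)
  have "e * (2 * (2 * a + b)) \<le> x0 * (2 * (2 * a + b))"
    using a b e by (intro mult_right_mono) auto
  then have "2 * (2 * e * a + e * b) \<le> v" using x0 by (simp add: algebra_simps)
  then have ev: "2 * e * a + e * b < v" using v(1) by simp
  have unit: "e \<le> x \<bullet> (P T *v x)" if "0 \<le> T" "norm x = 1" for T x
  proof (rule ccontr)
    assume "\<not> e \<le> x \<bullet> (P T *v x)"
    then have lt: "x \<bullet> (P T *v x) \<le> e" by simp
    define D where "D = {z \<in> {0..T} \<times> sphere (0::real^'n) 1. snd z \<bullet> (P (fst z) *v snd z) \<le> e}"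
    have cf: "continuous_on ({0..T} \<times> sphere (0::real^'n) 1) (\<lambda>z. snd z \<bullet> (P (fst z) *v snd z))"
      by (intro continuous_intros continuous_on_compose2[OF P_cont]) auto
    have "closed D"
      unfolding D_def
      using continuous_closed_preimage[OF cf _ closed_atMost[of e]]
      by (simp add: closed_Times vimage_def Int_def)
    then have "compact D"
      using compact_Int_closed[of "{0..T} \<times> sphere (0::real^'n) 1" D]
      by (simp add: compact_Times D_def Int_def)
    moreover have "D \<noteq> {}" using lt that by (auto simp: D_def)
    ultimately obtain z where z: "z \<in> D" "\<And>w. w \<in> D \<Longrightarrow> fst z \<le> fst w"
      using continuous_attains_inf[of D fst] continuous_on_fst[OF continuous_on_id] by blast
    define s u where "s = fst z" and "u = snd z"
    have s: "0 \<le> s" "s \<le> T" "norm u = 1" "u \<bullet> (P s *v u) \<le> e"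
      using z(1) by (auto simp: D_def s_def u_def)
    have before: "e < w \<bullet> (P r *v w)" if "0 \<le> r" "r < s" "norm w = 1" for r w
      using z(2)[of "(r, w)"] that s by (force simp: D_def s_def)
    have "e0 \<le> u \<bullet> (P 0 *v u)" using e0(2)[of u] s(3) by (simp add: norm_eq_1)
    then have "s \<noteq> 0" using e s(4) by auto
    then have s0: "0 < s" using s(1) by simp
    have at: "e \<le> w \<bullet> (P s *v w)" if w: "norm w = 1" for w
    proof (rule ccontr)
      assume "\<not> e \<le> w \<bullet> (P s *v w)"
      then have "w \<bullet> (P s *v w) < e" by simp
      moreover have "continuous_on {0..s} (\<lambda>t. w \<bullet> (P t *v w))"
        by (intro continuous_intros continuous_on_subset[OF P_cont]) auto
      ultimately obtain r where "0 \<le> r" "r \<le> s" "w \<bullet> (P r *v w) = e"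
        using IVT2'[of "\<lambda>t. w \<bullet> (P t *v w)" s e 0] before[of 0 w] w s0 by auto
      then show False using before[of r w] w \<open>w \<bullet> (P s *v w) < e\<close> by (cases "r = s") auto
    qed
    have ue: "u \<bullet> (P s *v u) = e" using at[OF s(3)] s(4) by simp
    have "(P s - e *\<^sub>R mat 1) *v u = 0"
    proof (rule psd_null)
      show "transpose (P s - e *\<^sub>R mat 1) = P s - e *\<^sub>R mat 1"
        using s by (simp add: transpose_diff transpose_scalar P_sym)
      show "u \<bullet> ((P s - e *\<^sub>R mat 1) *v u) = 0"
        using ue s(3) by (simp add: matrix_vector_mult_diff_rdistrib inner_diff_right
            scaleR_matrix_vector_assoc[symmetric] norm_eq_1)
      fix w :: "real^'n"
      show "0 \<le> w \<bullet> ((P s - e *\<^sub>R mat 1) *v w)"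
        using quadratic_form_scale[of e "P s" w] at
        by (simp add: matrix_vector_mult_diff_rdistrib inner_diff_right scaleR_matrix_vector_assoc[symmetric])
    qed
    then have Pu: "P s *v u = e *\<^sub>R u"
      by (simp add: matrix_vector_mult_diff_rdistrib scaleR_matrix_vector_assoc[symmetric])
    have "((\<lambda>t. u \<bullet> (P t *v u)) has_vector_derivative (u \<bullet> (P s *v 0 + P' s *v u) + 0 \<bullet> (P s *v u)))
        (at s within {0..})"
      using s by (intro has_vd_inner has_vd_matrix_vector P_deriv has_vector_derivative_const) auto
    then have du: "((\<lambda>t. u \<bullet> (P t *v u)) has_real_derivative (u \<bullet> (P' s *v u))) (at s within {0..})"
      by (simp add: has_real_derivative_iff_has_vector_derivative)
    have "u \<bullet> (P' s *v u) = 2 * e * (u \<bullet> (A s *v u)) - e\<^sup>2 * (u \<bullet> (B s *v u)) + u \<bullet> (V s *v u)"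
      using s by (simp add: P'_inner Pu matrix_vector_mult_scaleR power2_eq_square)
    moreover have "\<bar>u \<bullet> (A s *v u)\<bar> \<le> a" "\<bar>u \<bullet> (B s *v u)\<bar> \<le> b"
      using quadratic_form_le[of u "A s"] quadratic_form_le[of u "B s"] a(2)[of s] b(2)[of s] s
      by (auto simp: norm_eq_1)
    moreover have "v \<le> u \<bullet> (V s *v u)" using v(2)[of s u] s by (simp add: norm_eq_1)
    moreover have "e * (u \<bullet> (A s *v u)) \<ge> - (e * a)"
      using \<open>\<bar>u \<bullet> (A s *v u)\<bar> \<le> a\<close> e(1) mult_left_mono[of "-a" "u \<bullet> (A s *v u)" e] by auto
    moreover have "e\<^sup>2 * (u \<bullet> (B s *v u)) \<le> e * b"
    proof -
      have "e\<^sup>2 * (u \<bullet> (B s *v u)) \<le> e\<^sup>2 * b"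
        using \<open>\<bar>u \<bullet> (B s *v u)\<bar> \<le> b\<close> by (intro mult_left_mono) auto
      also have "\<dots> \<le> e * b"
        using e b(1) by (intro mult_right_mono) (auto simp: power2_eq_square mult_left_le)
      finally show ?thesis .
    qed
    ultimately have "0 < u \<bullet> (P' s *v u)" using ev by linarith
    from has_real_derivative_pos_inc_left[OF du this] obtain d where "0 < d"
      and d: "\<And>h. 0 < h \<Longrightarrow> s - h \<in> {0..} \<Longrightarrow> h < d \<Longrightarrow> u \<bullet> (P (s - h) *v u) < u \<bullet> (P s *v u)"
      by blast
    define h where "h = min (d / 2) s"
    have "0 < h" "h < d" "s - h \<in> {0..}" using \<open>0 < d\<close> s0 by (auto simp: h_def min_def)
    from d[OF this(1,3,2)] before[of "s - h" u] \<open>0 < h\<close> \<open>s - h \<in> {0..}\<close> s(3) ue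
    show False by simp
  qed
  have "e * (x \<bullet> x) \<le> x \<bullet> (P t *v x)" if "0 \<le> t" for t x
    using unit[OF that] by (rule quadratic_form_scale)
  with e(1) show ?thesis by (rule that)
qed

lemma inner_vd_symmetric:
  assumes "(P has_vector_derivative P'') (at t within S)" "transpose (P t) = P t"
    and "(l has_vector_derivative l') (at t within S)"
  shows "((\<lambda>t. l t \<bullet> (P t *v l t)) has_vector_derivative
    (2 * (l' \<bullet> (P t *v l t)) + l t \<bullet> (P'' *v l t))) (at t within S)"
proof -
  have "((\<lambda>t. l t \<bullet> (P t *v l t)) has_vector_derivative
    (l t \<bullet> (P t *v l' + P'' *v l t) + l' \<bullet> (P t *v l t))) (at t within S)"
    by (intro has_vd_inner has_vd_matrix_vector assms)
  moreover have "l t \<bullet> (P t *v l') = l' \<bullet> (P t *v l t)"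
    using assms(2) inner_matrix_transpose[of "l t" "P t" l'] by (simp add: inner_commute)
  ultimately show ?thesis by (simp add: inner_add_right algebra_simps)
qed

text \<open>\<open>x \<bullet> P(T) x\<close> is the value of the dual optimal control problem; it is bounded by the cost of
  the control that steers \<open>0\<close> at time \<open>T - \<delta>\<close> to \<open>x\<close> at time \<open>T\<close> through the observability Gramian.\<close>

lemma P_upper_bound_late:
  obtains \<delta> p where "0 < \<delta>" "0 < p" "\<And>T z. \<delta> \<le> T \<Longrightarrow> z \<bullet> (P T *v z) \<le> p * (z \<bullet> z)"
proof -
  obtain a where a: "0 < a" "\<And>t. 0 \<le> t \<Longrightarrow> norm (A t) \<le> a" by (rule A_bound) blast
  obtain b where b: "0 < b" "\<And>t. 0 \<le> t \<Longrightarrow> norm (B t) \<le> b" by (rule B_bound) blast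
  obtain v where v: "0 < v" "\<And>t. 0 \<le> t \<Longrightarrow> norm (V t) \<le> v" by (rule V_bound) blast
  obtain q where q: "0 < q" "\<And>t y. 0 \<le> t \<Longrightarrow> y \<bullet> (Q t *v y) \<ge> q * (y \<bullet> y)"
    using Q_pd unfolding unif_pos_def_def by auto
  obtain \<Phi> \<delta> \<mu> where tm: "transition_matrix A \<Phi>" and pos: "0 < \<delta>" "0 < \<mu>"
    and gram: "\<And>t x. 0 \<le> t \<Longrightarrow> x \<bullet> ((inverse \<delta> *\<^sub>R integral {t..t+\<delta>}
              (\<lambda>\<tau>. transpose (\<Phi> \<tau> t) ** transpose (C \<tau>) ** C \<tau> ** \<Phi> \<tau> t)) *v x) \<ge> \<mu> * (x \<bullet> x)"
    using obs unfolding unif_observable_def by auto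
  define I where "I = (mat 1 :: real^'n^'n)"
  define f where "f = exp (a * \<delta>) * norm I"
  have "0 < norm I" 
    unfolding I_def by (metis matrix_vector_mul_lid matrix_vector_mult_0 zero_less_norm_iff zero_neq_one)
  then have f: "0 < f" by (simp add: f_def)
  define k where "k = f / (q * \<mu> * \<delta>)"
  have k: "0 < k" using f q pos by (simp add: k_def)
  define lb where "lb = f * (f * b * f * \<delta>) * k"
  have lb: "0 < lb" using f b pos k by (simp add: lb_def)
  define c where "c = b * (f * k)\<^sup>2 + v * lb\<^sup>2"
  have c: "0 < c" using b v f k by (simp add: c_def add_pos_nonneg)
  have "z \<bullet> (P T *v z) \<le> (c * \<delta>) * (z \<bullet> z)" if T: "\<delta> \<le> T" for T z
  proof -
    define s where "s = T - \<delta>"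
    have s: "0 \<le> s" "s \<le> T" "T = s + \<delta>" using T pos by (auto simp: s_def)
    define F where "F = (\<lambda>\<tau>. \<Phi> \<tau> s)"
    have F0: "F s = I" using tm s by (simp add: transition_matrix_def F_def I_def)
    have dF: "(F has_vector_derivative (A \<tau> ** F \<tau>)) (at \<tau> within {s..b})" if "s \<le> \<tau>" for \<tau> b
      using tm s that unfolding transition_matrix_def F_def
      by (intro has_vector_derivative_within_subset[where S = "{s..}" and T = "{s..b}"]) auto
    have At: "continuous_on {s..T} A" using s by (intro continuous_on_subset[OF A_cont]) auto
    have "\<exists>y. y s = I \<and> (\<forall>t\<in>{s..T}. (y has_vector_derivative - (transpose (A t) ** y t)) (at t within {s..T}))"
    proof (rule linear_ode_exists[OF s(2) a(1), where A = "\<lambda>t X. - (transpose (A t) ** X)"])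
      fix t assume t: "s \<le> t" "t \<le> T"
      show "linear (\<lambda>X::real^'n^'n. - (transpose (A t) ** X))"
        by (rule linearI) (simp_all add: matrix_algebra)
      fix X :: "real^'n^'n"
      show "norm (- (transpose (A t) ** X)) \<le> a * norm X"
        using a(2)[of t] t s
        by (auto simp: norm_transpose intro!: order_trans[OF norm_matrix_mult_le] mult_right_mono)
    next
      fix y :: "real \<Rightarrow> real^'n^'n"
      assume "continuous_on {s..T} y"
      then show "continuous_on {s..T} (\<lambda>t. - (transpose (A t) ** y t))"
        by (intro continuous_intros At)
    qed
    then obtain \<Theta> where Th0: "\<Theta> s = I"
      and dTh: "\<And>t. s \<le> t \<Longrightarrow> t \<le> T \<Longrightarrow> (\<Theta> has_vector_derivative - (transpose (A t) ** \<Theta> t)) (at t within {s..T})"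
      by auto
    have ThF: "transpose (\<Theta> t) ** F t = I" if "s \<le> t" "t \<le> T" for t
    proof -
      have "transpose (\<Theta> t) ** F t = transpose (\<Theta> s) ** F s"
      proof (rule vd_constant[of "{s..T}"])
        fix r assume r: "r \<in> {s..T}"
        have "((\<lambda>t. transpose (\<Theta> t) ** F t) has_vector_derivative
          (transpose (\<Theta> r) ** (A r ** F r) + transpose (- (transpose (A r) ** \<Theta> r)) ** F r)) (at r within {s..T})"
          using r by (intro has_vd_matrix_matrix has_vd_transpose dTh dF) auto
        then show "((\<lambda>t. transpose (\<Theta> t) ** F t) has_vector_derivative 0) (at r within {s..T})"
          by (simp add: matrix_algebra)
      qed (use that in auto)
      then show ?thesis by (simp add: Th0 F0) (simp add: I_def)
    qed
    have FTh: "\<Theta> t ** transpose (F t) = I" if "s \<le> t" "t \<le> T" for t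
    proof -
      have "F t ** transpose (\<Theta> t) = I"
        using ThF[OF that] matrix_left_right_inverse unfolding I_def by blast
      then have "transpose (F t ** transpose (\<Theta> t)) = transpose I" by simp
      then show ?thesis by (simp add: matrix_transpose_mul I_def)
    qed
    have ex: "exp (a * (t - s)) \<le> exp (a * \<delta>)" if "t \<le> T" for t
      using a that s by simp
    have nF: "norm (F t) \<le> f" if t: "s \<le> t" "t \<le> T" for t
    proof -
      have "norm (F t) \<le> exp (a * (t - s)) * norm (F s)"
        using s a dF by (intro norm_growth[OF t(1), where E' = "\<lambda>\<tau>. A \<tau> ** F \<tau>"])
          (auto intro!: order_trans[OF norm_matrix_mult_le] mult_right_mono)
      also have "\<dots> \<le> f" unfolding f_def F0 using ex[OF t(2)] by (intro mult_right_mono) auto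
      finally show ?thesis .
    qed
    have nTh: "norm (\<Theta> t) \<le> f" if t: "s \<le> t" "t \<le> T" for t
    proof -
      have "norm (\<Theta> t) \<le> exp (a * (t - s)) * norm (\<Theta> s)"
      proof (rule norm_growth[OF t(1), where E' = "\<lambda>t. - (transpose (A t) ** \<Theta> t)"])
        fix r assume r: "s \<le> r" "r \<le> t"
        show "(\<Theta> has_vector_derivative - (transpose (A r) ** \<Theta> r)) (at r within {s..t})"
          using r t by (intro has_vector_derivative_within_subset[OF dTh]) auto
        show "norm (- (transpose (A r) ** \<Theta> r)) \<le> a * norm (\<Theta> r)"
          using a(2)[of r] r s
          by (auto simp: norm_transpose intro!: order_trans[OF norm_matrix_mult_le] mult_right_mono)
      qed
      also have "\<dots> \<le> f" unfolding f_def Th0 using ex[OF t(2)] by (intro mult_right_mono) auto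
      finally show ?thesis .
    qed
    define H where "H = (\<lambda>r. transpose (F r) ** B r ** F r)"
    have cF: "continuous_on {s..T} F" by (rule continuous_on_vd[OF dF]) auto
    have cH: "continuous_on {s..T} H"
      unfolding H_def using s by (intro continuous_intros cF continuous_on_subset[OF B_cont]) auto
    define G where "G = (\<lambda>t. integral {s..t} H)"
    have dG: "(G has_vector_derivative H t) (at t within {s..T})" if "s \<le> t" "t \<le> T" for t
      unfolding G_def using that by (intro integral_has_vector_derivative cH) auto
    have nG: "norm (G t) \<le> f * b * f * \<delta>" if t: "s \<le> t" "t \<le> T" for t
    proof -
      have "norm (G t) \<le> (f * b * f) * (t - s)"
        unfolding G_def
      proof (rule integral_bound[OF t(1)])
        show "continuous_on {s..t} H" using t by (intro continuous_on_subset[OF cH]) auto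
        fix r assume r: "r \<in> {s..t}"
        have "norm (H r) \<le> norm (transpose (F r)) * norm (B r) * norm (F r)"
          unfolding H_def
          by (rule order_trans[OF norm_matrix_mult_le]) (intro mult_right_mono norm_matrix_mult_le, auto)
        also have "\<dots> \<le> f * b * f"
          using nF[of r] b(2)[of r] r t s f b by (intro mult_mono) (auto simp: norm_transpose)
        finally show "norm (H r) \<le> f * b * f" .
      qed
      also have "\<dots> \<le> (f * b * f) * \<delta>" using t s f b by (intro mult_left_mono) auto
      finally show ?thesis .
    qed
    have low: "q * \<mu> * \<delta> * (x \<bullet> x) \<le> x \<bullet> (G T *v x)" for x
    proof -
      define W where "W = (\<lambda>\<tau>. transpose (F \<tau>) ** transpose (C \<tau>) ** C \<tau> ** F \<tau>)"
      have bl: "bounded_linear (\<lambda>H::real^'n^'n. x \<bullet> (H *v x))"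
        by (intro bounded_linear_intros bounded_bilinear.bounded_linear_left[OF bounded_bilinear_matrix_vector]
            bounded_linear_inner_right_comp)
      have cW: "continuous_on {s..T} W"
        unfolding W_def using s by (intro continuous_intros cF continuous_on_subset[OF C_cont]) auto
      have iW: "W integrable_on {s..T}" and iH: "H integrable_on {s..T}"
        by (intro integrable_continuous_real cW cH)+
      have "\<mu> * (x \<bullet> x) \<le> x \<bullet> ((inverse \<delta> *\<^sub>R integral {s..T} W) *v x)"
        using gram[OF s(1), of x] by (simp add: W_def F_def s(3))
      then have "\<mu> * \<delta> * (x \<bullet> x) \<le> x \<bullet> (integral {s..T} W *v x)"
        using pos by (simp add: scaleR_matrix_vector_assoc[symmetric] field_simps)
      also have "\<dots> = integral {s..T} (\<lambda>\<tau>. x \<bullet> (W \<tau> *v x))"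
        using integral_linear[OF iW bl] by (simp add: o_def)
      finally have "q * (\<mu> * \<delta> * (x \<bullet> x)) \<le> q * integral {s..T} (\<lambda>\<tau>. x \<bullet> (W \<tau> *v x))"
        using q(1) by (intro mult_left_mono) auto
      also have "\<dots> = integral {s..T} (\<lambda>\<tau>. q * (x \<bullet> (W \<tau> *v x)))" by simp
      also have "\<dots> \<le> integral {s..T} (\<lambda>\<tau>. x \<bullet> (H \<tau> *v x))"
      proof (rule integral_le)
        show "(\<lambda>\<tau>. q * (x \<bullet> (W \<tau> *v x))) integrable_on {s..T}"
          by (intro integrable_continuous_real continuous_intros cW)
        show "(\<lambda>\<tau>. x \<bullet> (H \<tau> *v x)) integrable_on {s..T}"
          by (intro integrable_continuous_real continuous_intros cH)
        fix r assume "r \<in> {s..T}"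
        then have r: "0 \<le> r" using s by simp
        define y where "y = C r *v (F r *v x)"
        have "x \<bullet> (W r *v x) = y \<bullet> y"
          by (simp add: W_def y_def matrix_vector_mul_assoc[symmetric] inner_matrix_transpose[of _ "transpose _"])
        moreover have "x \<bullet> (H r *v x) = y \<bullet> (Q r *v y)"
          by (simp add: H_def matrix_vector_mul_assoc[symmetric] inner_matrix_transpose[of x "transpose _"]
              B_inner y_def)
        ultimately show "q * (x \<bullet> (W r *v x)) \<le> x \<bullet> (H r *v x)" using q(2)[OF r, of y] by simp
      qed
      also have "\<dots> = x \<bullet> (G T *v x)"
        using integral_linear[OF iH bl] by (simp add: o_def G_def)
      finally show ?thesis by (simp add: mult.assoc)
    qed
    have "inj ((*v) (G T))"
    proof (rule injI)
      fix x y assume "G T *v x = G T *v y"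
      then have "q * \<mu> * \<delta> * ((x - y) \<bullet> (x - y)) \<le> 0"
        using low[of "x - y"] by (simp add: matrix_vector_mult_diff_distrib)
      then have "(x - y) \<bullet> (x - y) \<le> 0" using q pos by (simp add: mult_le_0_iff)
      then have "x - y = 0" by (metis inner_gt_zero_iff not_less)
      then show "x = y" by simp
    qed
    then have "surj ((*v) (G T))" by (intro linear_injective_imp_surjective) auto
    then obtain \<xi> where xi: "G T *v \<xi> = transpose (F T) *v z" by (metis surjD)
    have nxi: "norm \<xi> \<le> k * norm z"
    proof (cases "\<xi> = 0")
      case False
      have "q * \<mu> * \<delta> * (\<xi> \<bullet> \<xi>) \<le> \<xi> \<bullet> (transpose (F T) *v z)" using low[of \<xi>] xi by simp
      also have "\<dots> \<le> norm \<xi> * (norm (F T) * norm z)"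
        by (rule order_trans[OF norm_cauchy_schwarz])
          (intro mult_left_mono order_trans[OF norm_matrix_vector_le], auto simp: norm_transpose)
      also have "\<dots> \<le> norm \<xi> * (f * norm z)"
        using nF[of T] s by (intro mult_left_mono mult_right_mono) auto
      finally have "norm \<xi> * (q * \<mu> * \<delta> * norm \<xi>) \<le> norm \<xi> * (f * norm z)"
        by (simp add: power2_norm_eq_inner[symmetric] power2_eq_square mult_ac)
      then have "q * \<mu> * \<delta> * norm \<xi> \<le> f * norm z" using False by simp
      then show ?thesis using q pos by (simp add: k_def field_simps)
    qed (use k in auto)
    define l where "l = (\<lambda>t. \<Theta> t *v (G t *v \<xi>))"
    define w where "w = (\<lambda>t. F t *v \<xi>)"
    have ls: "l s = 0" by (simp add: l_def G_def)
    have "l T = (\<Theta> T ** transpose (F T)) *v z" by (simp add: l_def xi matrix_vector_mul_assoc[symmetric])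
    then have lT: "l T = z" using FTh[of T] s by (simp add: I_def)
    have nw: "norm (w t) \<le> f * k * norm z" if "s \<le> t" "t \<le> T" for t
    proof -
      have "norm (w t) \<le> norm (F t) * norm \<xi>" unfolding w_def by (rule norm_matrix_vector_le)
      also have "\<dots> \<le> f * (k * norm z)" using nF[OF that] nxi f by (intro mult_mono) auto
      finally show ?thesis by simp
    qed
    have nl: "norm (l t) \<le> lb * norm z" if "s \<le> t" "t \<le> T" for t
    proof -
      have "norm (l t) \<le> norm (\<Theta> t) * (norm (G t) * norm \<xi>)"
        unfolding l_def by (intro order_trans[OF norm_matrix_vector_le] mult_left_mono norm_matrix_vector_le) auto
      also have "\<dots> \<le> f * ((f * b * f * \<delta>) * (k * norm z))"
        using nTh[OF that] nG[OF that] nxi f b pos k by (intro mult_mono) auto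
      finally show ?thesis by (simp add: lb_def mult.assoc)
    qed
    have "l T \<bullet> (P T *v l T) \<le> exp (0 * (T - s)) * (l s \<bullet> (P s *v l s) + (c * (z \<bullet> z)) * (T - s))"
    proof (rule gronwall[OF s(2)])
      show "0 \<le> c * (z \<bullet> z)" using c by simp
      fix t assume t: "s \<le> t" "t \<le> T"
      have t0: "0 \<le> t" using t s by simp
      define l' where "l' = - (transpose (A t) *v l t) + B t *v w t"
      have "(l has_vector_derivative (\<Theta> t *v (G t *v 0 + H t *v \<xi>) + (- (transpose (A t) ** \<Theta> t)) *v (G t *v \<xi>)))
          (at t within {s..T})"
        unfolding l_def using t by (intro has_vd_matrix_vector dTh dG has_vector_derivative_const)
      moreover have "\<Theta> t *v (H t *v \<xi>) = (\<Theta> t ** transpose (F t)) *v (B t *v w t)"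
        by (simp add: H_def w_def matrix_vector_mul_assoc matrix_mul_assoc)
      moreover have "(- (transpose (A t) ** \<Theta> t)) *v (G t *v \<xi>) = - (transpose (A t) *v l t)"
        using matrix_vector_mult_diff_rdistrib[of 0 "transpose (A t) ** \<Theta> t" "G t *v \<xi>"]
        by (simp add: l_def matrix_vector_mul_assoc matrix_mul_assoc)
      ultimately have "(l has_vector_derivative l') (at t within {s..T})"
        using FTh[OF t] by (simp add: l'_def I_def)
      then show "((\<lambda>t. l t \<bullet> (P t *v l t)) has_vector_derivative
          (2 * (l' \<bullet> (P t *v l t)) + l t \<bullet> (P' t *v l t))) (at t within {s..T})"
        using t s by (intro inner_vd_symmetric P_deriv P_sym) auto
      define p where "p = P t *v l t"
      have Bsw: "w t \<bullet> (B t *v p) = p \<bullet> (B t *v w t)"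
        using t0 inner_matrix_transpose[of "w t" "B t" p] by (simp add: B_sym inner_commute)
      have "2 * (l' \<bullet> p) + l t \<bullet> (P' t *v l t)
        = 2 * (p \<bullet> (B t *v w t)) - p \<bullet> (B t *v p) + l t \<bullet> (V t *v l t)"
        using t0 inner_matrix_transpose[of "l t" "A t" p]
        by (simp add: P'_inner p_def[symmetric] l'_def inner_diff_left inner_add_left inner_commute[of p])
      also have "\<dots> = w t \<bullet> (B t *v w t) - (p - w t) \<bullet> (B t *v (p - w t)) + l t \<bullet> (V t *v l t)"
        using Bsw by (simp add: matrix_vector_mult_diff_distrib inner_diff_left inner_diff_right)
      also have "\<dots> \<le> w t \<bullet> (B t *v w t) + l t \<bullet> (V t *v l t)"
        using B_psd[OF t0] by simp
      also have "\<dots> \<le> b * (f * k * norm z)\<^sup>2 + v * (lb * norm z)\<^sup>2"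
      proof (rule add_mono)
        have quad: "y \<bullet> (X *v y) \<le> n * r\<^sup>2" if "norm X \<le> n" "norm y \<le> r" for y r n and X :: "real^'n^'n"
        proof -
          have "norm X * (norm y)\<^sup>2 \<le> n * r\<^sup>2"
            using that by (intro mult_mono power_mono) (auto intro: order_trans[OF norm_ge_zero])
          then show ?thesis using quadratic_form_le[of y X] by (simp add: power2_norm_eq_inner)
        qed
        show "w t \<bullet> (B t *v w t) \<le> b * (f * k * norm z)\<^sup>2" by (intro quad b nw t t0)
        show "l t \<bullet> (V t *v l t) \<le> v * (lb * norm z)\<^sup>2" by (intro quad v nl t t0)
      qed
      also have "\<dots> = c * (z \<bullet> z)"
        by (simp add: c_def power_mult_distrib power2_norm_eq_inner algebra_simps)
      finally show "2 * (l' \<bullet> (P t *v l t)) + l t \<bullet> (P' t *v l t) \<le> 0 * (l t \<bullet> (P t *v l t)) + c * (z \<bullet> z)"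
        by (simp add: p_def)
    qed simp
    then show ?thesis using ls lT s by (simp add: mult_ac)
  qed
  with that[OF pos(1), of "c * \<delta>"] c pos show ?thesis by simp
qed

lemma P_upper_bound: obtains p where "0 < p" "\<And>t z. 0 \<le> t \<Longrightarrow> z \<bullet> (P t *v z) \<le> p * (z \<bullet> z)"
proof -
  obtain \<delta> p where p: "0 < \<delta>" "0 < p" "\<And>T z. \<delta> \<le> T \<Longrightarrow> z \<bullet> (P T *v z) \<le> p * (z \<bullet> z)"
    by (rule P_upper_bound_late) blast
  have "bounded (P ` {0..\<delta>})"
    by (intro compact_imp_bounded compact_continuous_image continuous_on_subset[OF P_cont]) auto
  then obtain r where r: "0 < r" "\<And>t. 0 \<le> t \<Longrightarrow> t \<le> \<delta> \<Longrightarrow> norm (P t) \<le> r"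
    unfolding bounded_pos by auto
  have "z \<bullet> (P t *v z) \<le> (p + r) * (z \<bullet> z)" if "0 \<le> t" for t z
  proof (cases "t \<le> \<delta>")
    case True
    have "z \<bullet> (P t *v z) \<le> norm (P t) * (z \<bullet> z)" using quadratic_form_le[of z "P t"] by simp
    also have "\<dots> \<le> r * (z \<bullet> z)" using r(2)[OF that True] by (intro mult_right_mono) auto
    also have "\<dots> \<le> (p + r) * (z \<bullet> z)" using p by (intro mult_right_mono) auto
    finally show ?thesis .
  next
    case False
    then have "z \<bullet> (P t *v z) \<le> p * (z \<bullet> z)" by (intro p) auto
    also have "\<dots> \<le> (p + r) * (z \<bullet> z)" using r by (intro mult_right_mono) auto
    finally show ?thesis .
  qed
  with that[of "p + r"] p r show ?thesis by simp
qed

definition L :: "real \<Rightarrow> real^'n \<Rightarrow> real" where "L t x = x \<bullet> (matrix_inv (P t) *v x)"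

lemma P_inv: "0 \<le> t \<Longrightarrow> P t *v (matrix_inv (P t) *v x) = x"
proof -
  assume t: "0 \<le> t"
  obtain e where e: "0 < e" "\<And>t x. 0 \<le> t \<Longrightarrow> e * (x \<bullet> x) \<le> x \<bullet> (P t *v x)"
    by (rule P_lower_bound) blast
  have "x = 0" if "P t *v x = 0" for x
  proof -
    have "e * (x \<bullet> x) \<le> 0" using e(2)[OF t, of x] that by simp
    then have "x \<bullet> x \<le> 0" using e(1) by (simp add: mult_le_0_iff)
    then show ?thesis by (metis inner_gt_zero_iff not_less)
  qed
  then have "invertible (P t)"
    by (simp add: invertible_left_inverse matrix_left_invertible_ker)
  then show ?thesis
    unfolding invertible_def matrix_inv_def
    by (rule someI2_ex) (simp add: matrix_vector_mul_assoc)
qed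

lemma L_estimates:
  obtains p1 p2 \<nu> where "0 < p1" "0 < p2" "0 < \<nu>"
    "\<And>t x. 0 \<le> t \<Longrightarrow> p1 * (x \<bullet> x) \<le> L t x" "\<And>t x. 0 \<le> t \<Longrightarrow> L t x \<le> p2 * (x \<bullet> x)"
    "\<And>t S x. t \<in> S \<Longrightarrow> S \<subseteq> {0..} \<Longrightarrow>
      (x has_vector_derivative (A t *v x t - (P t ** transpose (C t) ** Q t) *v (C t *v x t))) (at t within S) \<Longrightarrow>
      \<exists>d. ((\<lambda>t. L t (x t)) has_vector_derivative d) (at t within S) \<and> d \<le> - \<nu> * L t (x t)"
proof -
  obtain e where e: "0 < e" "\<And>t x. 0 \<le> t \<Longrightarrow> e * (x \<bullet> x) \<le> x \<bullet> (P t *v x)"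
    by (rule P_lower_bound) blast
  obtain p where p: "0 < p" "\<And>t z. 0 \<le> t \<Longrightarrow> z \<bullet> (P t *v z) \<le> p * (z \<bullet> z)"
    by (rule P_upper_bound) blast
  obtain v where v: "0 < v" "\<And>t y. 0 \<le> t \<Longrightarrow> y \<bullet> (V t *v y) \<ge> v * (y \<bullet> y)"
    using V_pd unfolding unif_pos_def_def by auto
  have low: "e * norm y \<le> norm (P t *v y)" if "0 \<le> t" for t y
  proof (cases "y = 0")
    case False
    have "norm y * (e * norm y) \<le> norm y * norm (P t *v y)"
      using e(2)[OF that, of y] norm_cauchy_schwarz[of y "P t *v y"]
      by (simp add: power2_norm_eq_inner[symmetric] power2_eq_square mult_ac)
    then show ?thesis using False by simp
  qed simp
  define y where "y = (\<lambda>t x. matrix_inv (P t) *v x)"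
  have Py: "P t *v y t x = x" if "0 \<le> t" for t x using P_inv[OF that] by (simp add: y_def)
  have L_y: "L t x = y t x \<bullet> (P t *v y t x)" if "0 \<le> t" for t x
    using Py[OF that] by (simp add: L_def y_def inner_commute)
  have Lp: "L t x \<le> p * (y t x \<bullet> y t x)" if "0 \<le> t" for t x
    using L_y[OF that] p(2)[OF that] by simp
  show ?thesis
  proof (rule that[of "1/p" "1/e" "v / p"])
    fix t x assume t: "0 \<le> (t::real)"
    have "(x \<bullet> x)\<^sup>2 \<le> (p * (x \<bullet> x)) * L t x"
    proof -
      define Y where "Y = y t x"
      have xY: "x = P t *v Y" using Py[OF t] by (simp add: Y_def)
      text \<open>Cauchy--Schwarz for the form \<open>P\<close>, via the discriminant.\<close>
      have q: "0 \<le> (r *\<^sub>R x - s *\<^sub>R Y) \<bullet> (P t *v (r *\<^sub>R x - s *\<^sub>R Y))" for r s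
        using e(2)[OF t, of "r *\<^sub>R x - s *\<^sub>R Y"] e(1)
        by (meson inner_ge_zero mult_nonneg_nonneg less_imp_le order_trans)
      have sy: "Y \<bullet> (P t *v x) = x \<bullet> x" using t inner_matrix_transpose[of Y "P t" x] xY by (simp add: P_sym)
      have LY: "L t x = Y \<bullet> x" using L_y[OF t] xY by (simp add: Y_def)
      define N where "N = x \<bullet> x"
      define X where "X = x \<bullet> (P t *v x)"
      have "0 \<le> r\<^sup>2 * X - 2 * r * s * N + s\<^sup>2 * L t x" for r s
        using q[of r s] sy LY
        by (simp add: matrix_vector_mult_diff_distrib matrix_vector_mult_scaleR xY[symmetric]
            inner_diff_left inner_diff_right power2_eq_square N_def X_def algebra_simps)
      from this[of N X] have "0 \<le> X * (X * L t x - N\<^sup>2)"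
        by (simp add: power2_eq_square algebra_simps)
      moreover have X: "e * N \<le> X" "X \<le> p * N" using e(2)[OF t] p(2)[OF t] by (auto simp: X_def N_def)
      moreover have "0 \<le> L t x"
        using e(2)[OF t, of Y] L_y[OF t, of x] e(1) by (metis Y_def inner_ge_zero mult_nonneg_nonneg less_imp_le order_trans)
      moreover have "N \<noteq> 0 \<Longrightarrow> 0 < X" using X(1) e(1) inner_ge_zero[of x] unfolding N_def
        by (smt (verit) mult_pos_pos)
      ultimately have "N \<noteq> 0 \<Longrightarrow> N\<^sup>2 \<le> X * L t x" by (simp add: zero_le_mult_iff)
      moreover have "X * L t x \<le> p * N * L t x"
        using X(2) \<open>0 \<le> L t x\<close> by (intro mult_right_mono)
      ultimately show ?thesis using \<open>0 \<le> L t x\<close> by (cases "N = 0") (auto simp: N_def)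
    qed
    then show "1 / p * (x \<bullet> x) \<le> L t x"
      using p(1) inner_ge_zero[of x]
      by (cases "x = 0") (auto simp: power2_eq_square field_simps L_def)
    have "e * norm (y t x) \<le> norm x" using low[OF t, of "y t x"] Py[OF t] by simp
    have "e * L t x \<le> x \<bullet> x"
    proof -
      have "L t x \<le> norm x * norm (y t x)" unfolding L_def y_def by (rule norm_cauchy_schwarz)
      then have "e * L t x \<le> norm x * (e * norm (y t x))" using e(1) by (simp add: mult_ac)
      also have "\<dots> \<le> norm x * norm x"
        using \<open>e * norm (y t x) \<le> norm x\<close> by (intro mult_left_mono) auto
      finally show ?thesis by (simp add: power2_norm_eq_inner[symmetric] power2_eq_square)
    qed
    then show "L t x \<le> 1 / e * (x \<bullet> x)" using e(1) by (simp add: field_simps)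
  next
    fix t S x
    assume tS: "t \<in> S" "S \<subseteq> {0..}" and
      dx: "(x has_vector_derivative (A t *v x t - (P t ** transpose (C t) ** Q t) *v (C t *v x t))) (at t within S)"
    have t: "0 \<le> t" using tS by auto
    define Y where "Y = (\<lambda>s. y s (x s))"
    define x' where "x' = A t *v x t - (P t ** transpose (C t) ** Q t) *v (C t *v x t)"
    obtain Y' where dY: "(Y has_vector_derivative Y') (at t within S)" and Y': "P t *v Y' = x' - P' t *v Y t"
    proof (rule vd_solve[OF P_deriv[OF t tS(2)] dx[folded x'_def] _ tS(1) e(1), of Y])
      show "P s *v Y s = x s" if "s \<in> S" for s using that tS Py by (auto simp: Y_def)
      show "e * norm u \<le> norm (P s *v u)" if "s \<in> S" for s u using that tS low by auto
    qed blast
    have PY: "P t *v Y t = x t" using Py[OF t] by (simp add: Y_def)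
    have x'B: "x' = A t *v x t - P t *v (B t *v x t)"
      by (simp add: x'_def B_def matrix_vector_mul_assoc matrix_mul_assoc)
    have "((\<lambda>t. x t \<bullet> Y t) has_vector_derivative (x t \<bullet> Y' + x' \<bullet> Y t)) (at t within S)"
      by (intro has_vd_inner dY dx[folded x'_def])
    moreover have "x t \<bullet> Y' = Y t \<bullet> x' - Y t \<bullet> (P' t *v Y t)"
    proof -
      have "x t \<bullet> Y' = Y t \<bullet> (P t *v Y')" using t inner_matrix_transpose[of "Y t" "P t" Y'] by (simp add: P_sym PY)
      then show ?thesis by (simp add: Y' inner_diff_right)
    qed
    moreover have "Y t \<bullet> x' = Y t \<bullet> (A t *v x t) - x t \<bullet> (B t *v x t)"
      using t by (simp add: x'B inner_diff_right inner_matrix_transpose[of "Y t" "P t"] P_sym PY)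
    ultimately have "((\<lambda>t. x t \<bullet> Y t) has_vector_derivative
        (- (Y t \<bullet> (V t *v Y t)) - x t \<bullet> (B t *v x t))) (at t within S)"
      using t by (simp add: P'_inner PY inner_commute[of x'])
    then have "((\<lambda>t. L t (x t)) has_vector_derivative
        (- (Y t \<bullet> (V t *v Y t)) - x t \<bullet> (B t *v x t))) (at t within S)"
      by (simp add: L_def Y_def y_def)
    moreover have "v / p * L t (x t) \<le> v * (Y t \<bullet> Y t)"
      using Lp[OF t, of "x t"] p v(1) by (simp add: Y_def field_simps)
    ultimately show "\<exists>d. ((\<lambda>t. L t (x t)) has_vector_derivative d) (at t within S) \<and> d \<le> - (v / p) * L t (x t)"
      using B_psd[OF t, of "x t"] v(2)[OF t, of "Y t"] by (intro exI[of _ "- (Y t \<bullet> (V t *v Y t)) - x t \<bullet> (B t *v x t)"] conjI) simp_all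
  qed (use e p v in auto)
qed

end

section \<open>Rotations\<close>

lemma hat_explicit: "hat x = vector [vector [0, - x$3, x$2], vector [x$3, 0, - x$1], vector [- x$2, x$1, 0]]"
  by (simp add: hat_def matrix_def vec_eq_iff forall_3 cross3_def axis_def)

lemmas mat3_simps = vec_eq_iff forall_3 matrix_matrix_mult_def transpose_def sum_3 mat_def hat_explicit
  matrix_vector_mult_def inner_vec_def

lemma hat_add: "hat (x + y) = hat x + hat y"
  by (simp add: mat3_simps)

lemma hat_scaleR: "hat (c *\<^sub>R x) = c *\<^sub>R hat x"
  by (simp add: mat3_simps)

lemma hat_uminus: "hat (- x) = - hat x"
  by (simp add: mat3_simps)

lemma hat_diff: "hat (x - y) = hat x - hat y"
  by (simp add: mat3_simps)

lemma transpose_hat: "transpose (hat x) = - hat x"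
  by (simp add: mat3_simps)

lemma norm_hat_le: "norm (hat x) \<le> 2 * norm x"
proof (rule power2_le_imp_le)
  have "(norm (hat x))\<^sup>2 = 2 * (norm x)\<^sup>2"
    by (simp add: power2_norm_eq_inner mat3_simps)
  then show "(norm (hat x))\<^sup>2 \<le> (2 * norm x)\<^sup>2" by (simp add: power_mult_distrib)
qed simp

lemma bounded_linear_hat: "bounded_linear hat"
  by (rule bounded_linear_intro[of _ 2]) (use norm_hat_le in \<open>auto simp: hat_add hat_scaleR mult.commute\<close>)

lemmas continuous_on_hat [continuous_intros] = bounded_linear.continuous_on[OF bounded_linear_hat]

lemma psi_a_explicit:
  "psi_a A = vector [(A$3$2 - A$2$3) / 2, (A$1$3 - A$3$1) / 2, (A$2$1 - A$1$2) / 2]"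
  by (simp add: psi_a_def vee_def transpose_def vec_eq_iff forall_3)

lemma hat_psi_a: "hat (psi_a A) = (1/2) *\<^sub>R (A - transpose A)"
  by (simp add: psi_a_explicit mat3_simps field_simps)

lemma bounded_linear_psi_a: "bounded_linear psi_a"
proof -
  have "linear psi_a" by (rule linearI) (simp_all add: psi_a_explicit vec_eq_iff forall_3 field_simps)
  then show ?thesis by (simp add: linear_conv_bounded_linear)
qed

lemmas continuous_on_psi_a [continuous_intros] = bounded_linear.continuous_on[OF bounded_linear_psi_a]

lemma norm_psi_a_le: "norm (psi_a A) \<le> norm A"
proof (rule power2_le_imp_le)
  have *: "((x - y) / 2)\<^sup>2 \<le> (x\<^sup>2 + y\<^sup>2)" for x y :: real
  proof -
    have "0 \<le> ((x + y) / 2)\<^sup>2 + x\<^sup>2 / 2 + y\<^sup>2 / 2" by simp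
    then show ?thesis by (simp add: power2_eq_square field_simps)
  qed
  have "(norm (psi_a A))\<^sup>2 = ((A$3$2 - A$2$3) / 2)\<^sup>2 + ((A$1$3 - A$3$1) / 2)\<^sup>2 + ((A$2$1 - A$1$2) / 2)\<^sup>2"
    unfolding power2_norm_eq_inner by (simp add: psi_a_explicit inner_vec_def sum_3 power2_eq_square)
  also have "\<dots> \<le> ((A$3$2)\<^sup>2 + (A$2$3)\<^sup>2) + ((A$1$3)\<^sup>2 + (A$3$1)\<^sup>2) + ((A$2$1)\<^sup>2 + (A$1$2)\<^sup>2)"
    by (intro add_mono *)
  also have "\<dots> \<le> \<dots> + (A$1$1)\<^sup>2 + (A$2$2)\<^sup>2 + (A$3$3)\<^sup>2" by simp
  also have "\<dots> = (norm A)\<^sup>2"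
    unfolding power2_norm_eq_inner by (simp add: inner_vec_def sum_3 power2_eq_square)
  finally show "(norm (psi_a A))\<^sup>2 \<le> (norm A)\<^sup>2" .
qed simp

lemma SO3_orthogonal: "R \<in> SO3 \<Longrightarrow> transpose R ** R = mat 1" "R \<in> SO3 \<Longrightarrow> R ** transpose R = mat 1"
  using matrix_left_right_inverse by (auto simp: SO3_def)

lemma SO3_det: "R \<in> SO3 \<Longrightarrow> det R = 1"
  by (simp add: SO3_def)

lemma SO3_transpose: "R \<in> SO3 \<Longrightarrow> transpose R \<in> SO3"
  using SO3_orthogonal(2)[of R] by (simp add: SO3_def)

lemma SO3_mult:
  assumes "R \<in> SO3" "S \<in> SO3"
  shows "R ** S \<in> SO3"
proof -
  have "transpose (R ** S) ** (R ** S) = transpose S ** (transpose R ** R) ** S"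
    by (simp add: matrix_transpose_mul matrix_mul_assoc)
  then show ?thesis using assms by (simp add: SO3_def det_mul)
qed

lemma SO3_id: "mat 1 \<in> SO3"
  by (simp add: SO3_def)

lemma SO3_cofactor:
  assumes "R \<in> SO3"
  shows "R$1$1 = R$2$2 * R$3$3 - R$3$2 * R$2$3" "R$2$1 = R$3$2 * R$1$3 - R$1$2 * R$3$3"
    "R$3$1 = R$1$2 * R$2$3 - R$2$2 * R$1$3"
    "R$1$2 = R$2$3 * R$3$1 - R$3$3 * R$2$1" "R$2$2 = R$3$3 * R$1$1 - R$1$3 * R$3$1"
    "R$3$2 = R$1$3 * R$2$1 - R$2$3 * R$1$1"
    "R$1$3 = R$2$1 * R$3$2 - R$3$1 * R$2$2" "R$2$3 = R$3$1 * R$1$2 - R$1$1 * R$3$2"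
    "R$3$3 = R$1$1 * R$2$2 - R$2$1 * R$1$2"
proof -
  have "rotation_matrix R"
    using assms by (simp add: rotation_matrix_def orthogonal_matrix SO3_def)
  then have "cross3 (R *v axis 2 1) (R *v axis 3 1) = R *v axis 1 1"
    "cross3 (R *v axis 3 1) (R *v axis 1 1) = R *v axis 2 1"
    "cross3 (R *v axis 1 1) (R *v axis 2 1) = R *v axis 3 1"
    by (simp_all add: cross_rotation_matrix cross_basis)
  then show "R$1$1 = R$2$2 * R$3$3 - R$3$2 * R$2$3" "R$2$1 = R$3$2 * R$1$3 - R$1$2 * R$3$3"
    "R$3$1 = R$1$2 * R$2$3 - R$2$2 * R$1$3"
    "R$1$2 = R$2$3 * R$3$1 - R$3$3 * R$2$1" "R$2$2 = R$3$3 * R$1$1 - R$1$3 * R$3$1"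
    "R$3$2 = R$1$3 * R$2$1 - R$2$3 * R$1$1"
    "R$1$3 = R$2$1 * R$3$2 - R$3$1 * R$2$2" "R$2$3 = R$3$1 * R$1$2 - R$1$1 * R$3$2"
    "R$3$3 = R$1$1 * R$2$2 - R$2$1 * R$1$2"
    by (simp_all add: matrix_vector_mult_basis column_def cross3_def vec_eq_iff forall_3)
qed

lemma SO3_rows:
  assumes "R \<in> SO3"
  shows "(R$1$1)\<^sup>2 + (R$1$2)\<^sup>2 + (R$1$3)\<^sup>2 = 1" "(R$2$1)\<^sup>2 + (R$2$2)\<^sup>2 + (R$2$3)\<^sup>2 = 1"
    "(R$3$1)\<^sup>2 + (R$3$2)\<^sup>2 + (R$3$3)\<^sup>2 = 1"
    and SO3_columns: "(R$1$1)\<^sup>2 + (R$2$1)\<^sup>2 + (R$3$1)\<^sup>2 = 1" "(R$1$2)\<^sup>2 + (R$2$2)\<^sup>2 + (R$3$2)\<^sup>2 = 1"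
    "(R$1$3)\<^sup>2 + (R$2$3)\<^sup>2 + (R$3$3)\<^sup>2 = 1"
  using SO3_orthogonal[OF assms] by (simp_all add: mat3_simps power2_eq_square)

text \<open>The products below are those of the components of the unit quaternion of \<open>R\<close>: with
  \<open>q\<^sub>0\<close> its real part, \<open>4 q\<^sub>0\<^sup>2 = 1 + R$1$1 + R$2$2 + R$3$3\<close>, and so on.\<close>

lemma SO3_quaternion:
  assumes "R \<in> SO3"
  defines "p0 \<equiv> 1 + R$1$1 + R$2$2 + R$3$3" and "p1 \<equiv> 1 + R$1$1 - R$2$2 - R$3$3"
    and "p2 \<equiv> 1 - R$1$1 + R$2$2 - R$3$3" and "p3 \<equiv> 1 - R$1$1 - R$2$2 + R$3$3"
  shows "p0 * p1 = (R$3$2 - R$2$3)\<^sup>2" "p0 * p2 = (R$1$3 - R$3$1)\<^sup>2" "p0 * p3 = (R$2$1 - R$1$2)\<^sup>2"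
    "p1 * p2 = (R$1$2 + R$2$1)\<^sup>2" "p1 * p3 = (R$1$3 + R$3$1)\<^sup>2" "p2 * p3 = (R$2$3 + R$3$2)\<^sup>2"
proof -
  note c = SO3_cofactor(1,5,9)[OF assms(1)] and rc = SO3_rows[OF assms(1)] SO3_columns[OF assms(1)]
  have 1: "1 + (R$1$1)\<^sup>2 = (R$2$2)\<^sup>2 + (R$2$3)\<^sup>2 + (R$3$2)\<^sup>2 + (R$3$3)\<^sup>2"
    and 2: "1 + (R$2$2)\<^sup>2 = (R$1$1)\<^sup>2 + (R$1$3)\<^sup>2 + (R$3$1)\<^sup>2 + (R$3$3)\<^sup>2"
    and 3: "1 + (R$3$3)\<^sup>2 = (R$1$1)\<^sup>2 + (R$1$2)\<^sup>2 + (R$2$1)\<^sup>2 + (R$2$2)\<^sup>2"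
    using rc by linarith+
  show "p0 * p1 = (R$3$2 - R$2$3)\<^sup>2" "p2 * p3 = (R$2$3 + R$3$2)\<^sup>2"
    using c(1) 1 unfolding p0_def p1_def p2_def p3_def by algebra+
  show "p0 * p2 = (R$1$3 - R$3$1)\<^sup>2" "p1 * p3 = (R$1$3 + R$3$1)\<^sup>2"
    using c(2) 2 unfolding p0_def p1_def p2_def p3_def by algebra+
  show "p0 * p3 = (R$2$1 - R$1$2)\<^sup>2" "p1 * p2 = (R$1$2 + R$2$1)\<^sup>2"
    using c(3) 3 unfolding p0_def p1_def p2_def p3_def by algebra+
qed

lemma SO3_trace_ge: "R \<in> SO3 \<Longrightarrow> 0 \<le> 1 + trace R"
proof (rule ccontr)
  assume R: "R \<in> SO3" and neg: "\<not> 0 \<le> 1 + trace R"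
  define p0 where "p0 = 1 + R$1$1 + R$2$2 + R$3$3"
  have p0: "p0 < 0" using neg by (simp add: p0_def trace_def sum_3)
  have "0 \<le> p0 * (1 + R$1$1 - R$2$2 - R$3$3)" "0 \<le> p0 * (1 - R$1$1 + R$2$2 - R$3$3)"
    "0 \<le> p0 * (1 - R$1$1 - R$2$2 + R$3$3)"
    using SO3_quaternion(1-3)[OF R] by (simp_all only: p0_def zero_le_power2)
  then have "1 + R$1$1 - R$2$2 - R$3$3 \<le> 0" "1 - R$1$1 + R$2$2 - R$3$3 \<le> 0" "1 - R$1$1 - R$2$2 + R$3$3 \<le> 0"
    using p0 by (auto simp: zero_le_mult_iff)
  then show False using p0 by (simp add: p0_def)
qed

lemma SO3_diag_le: "R \<in> SO3 \<Longrightarrow> \<bar>R$i$i\<bar> \<le> 1"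
proof -
  assume R: "R \<in> SO3"
  have le: "a\<^sup>2 \<le> 1 \<and> b\<^sup>2 \<le> 1 \<and> c\<^sup>2 \<le> 1" if "a\<^sup>2 + b\<^sup>2 + c\<^sup>2 = 1" for a b c :: real
    using that zero_le_power2[of a] zero_le_power2[of b] zero_le_power2[of c] by linarith
  have "(R$i$i)\<^sup>2 \<le> 1"
    using exhaust_3[of i] le[OF SO3_rows(1)[OF R]] le[OF SO3_rows(2)[OF R]] le[OF SO3_rows(3)[OF R]] by auto
  then show ?thesis by (simp add: abs_square_le_1)
qed

lemma det_id_plus_SO3:
  assumes "T \<in> SO3"
  shows "det (mat 1 + T) = 2 * (1 + trace T)"
proof -
  have "det (mat 1 + T) = 1 + trace T + ((T$2$2 * T$3$3 - T$3$2 * T$2$3) + (T$3$3 * T$1$1 - T$1$3 * T$3$1)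
    + (T$1$1 * T$2$2 - T$2$1 * T$1$2)) + det T"
    by (simp add: det_3 trace_def sum_3 mat_def algebra_simps)
  also have "\<dots> = 2 * (1 + trace T)"
    by (simp only: SO3_cofactor(1,5,9)[OF assms, symmetric] SO3_det[OF assms])
      (simp add: trace_def sum_3)
  finally show ?thesis .
qed

lemma SO3_norm: "R \<in> SO3 \<Longrightarrow> norm R = sqrt 3"
  using SO3_rows[of R]
  by (simp add: norm_eq_sqrt_inner inner_vec_def sum_3 power2_eq_square)

lemma SO3_norm_le: "R \<in> SO3 \<Longrightarrow> norm R \<le> 2"
  using real_sqrt_le_mono[of 3 4] by (simp add: SO3_norm)

lemma compact_SO3: "compact SO3"
proof -
  have "continuous_on UNIV (\<lambda>R::real^3^3. det R)"
    unfolding det_3 by (intro continuous_intros)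
  then have "closed (SO3 :: (real^3^3) set)"
    unfolding SO3_def
    by (intro closed_Collect_conj closed_Collect_eq continuous_intros)
  moreover have "bounded (SO3 :: (real^3^3) set)"
    using SO3_norm_le by (auto simp: bounded_iff)
  ultimately show ?thesis by (simp add: compact_eq_bounded_closed)
qed

section \<open>The potential\<close>

definition pot :: "real^3 \<Rightarrow> real^3^3 \<Rightarrow> real" where
  "pot \<rho> R = \<rho>$1 * (1 - R$1$1) + \<rho>$2 * (1 - R$2$2) + \<rho>$3 * (1 - R$3$3)"

definition ang :: "real^3 \<Rightarrow> real^3^3 \<Rightarrow> real^3" where
  "ang \<rho> R = psi_a (diag3 \<rho> ** R)"

lemma ang_explicit: "ang \<rho> R = vector [(\<rho>$3 * R$3$2 - \<rho>$2 * R$2$3) / 2, (\<rho>$1 * R$1$3 - \<rho>$3 * R$3$1) / 2,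
    (\<rho>$2 * R$2$1 - \<rho>$1 * R$1$2) / 2]"
  by (simp add: ang_def psi_a_explicit diag3_def matrix_matrix_mult_def sum_3 vec_eq_iff forall_3)

lemma continuous_on_ang [continuous_intros]:
  "continuous_on S f \<Longrightarrow> continuous_on S (\<lambda>x. ang \<rho> (f x))"
  unfolding ang_def by (intro continuous_intros)

lemma norm_SO3_minus_id:
  assumes "R \<in> SO3"
  shows "(norm (R - mat 1))\<^sup>2 = 2 * (3 - trace R)"
proof -
  have "(norm (R - mat 1))\<^sup>2 = (R$1$1 - 1)\<^sup>2 + (R$1$2)\<^sup>2 + (R$1$3)\<^sup>2
    + ((R$2$1)\<^sup>2 + (R$2$2 - 1)\<^sup>2 + (R$2$3)\<^sup>2) + ((R$3$1)\<^sup>2 + (R$3$2)\<^sup>2 + (R$3$3 - 1)\<^sup>2)"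
    unfolding power2_norm_eq_inner by (simp add: inner_vec_def sum_3 mat_def power2_eq_square)
  also have "\<dots> = 2 * (3 - trace R)"
    using SO3_rows[OF assms] by (simp add: power2_diff trace_def sum_3)
  finally show ?thesis .
qed

lemma pot_bounds:
  assumes "R \<in> SO3" "\<And>i. r \<le> \<rho>$i" "\<And>i. \<rho>$i \<le> s"
  shows "r * (3 - trace R) \<le> pot \<rho> R" "pot \<rho> R \<le> s * (3 - trace R)"
proof -
  have d: "0 \<le> 1 - R$i$i" for i using SO3_diag_le[OF assms(1), of i] by simp
  have "r * (1 - R$i$i) \<le> \<rho>$i * (1 - R$i$i)" "\<rho>$i * (1 - R$i$i) \<le> s * (1 - R$i$i)" for i
    using d assms(2,3) by (auto intro: mult_right_mono)
  from add_mono[OF add_mono[OF this(1)[of 1] this(1)[of 2]] this(1)[of 3]]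
    add_mono[OF add_mono[OF this(2)[of 1] this(2)[of 2]] this(2)[of 3]]
  show "r * (3 - trace R) \<le> pot \<rho> R" "pot \<rho> R \<le> s * (3 - trace R)"
    by (simp_all add: pot_def trace_def sum_3 algebra_simps)
qed

lemma ang_lower_bound:
  assumes R: "R \<in> SO3" and r: "0 < r" "\<And>i. r \<le> \<rho>$i" and s: "\<And>i. \<rho>$i \<le> s"
    and small: "3 - trace R \<le> 1" "s\<^sup>2 * (3 - trace R) \<le> r\<^sup>2"
  shows "r\<^sup>2 * (3 - trace R) \<le> 8 * (ang \<rho> R \<bullet> ang \<rho> R)"
proof -
  define e where "e = 3 - trace R"
  define p0 p1 p2 p3 where "p0 = 1 + R$1$1 + R$2$2 + R$3$3" and "p1 = 1 + R$1$1 - R$2$2 - R$3$3"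
    and "p2 = 1 - R$1$1 + R$2$2 - R$3$3" and "p3 = 1 - R$1$1 - R$2$2 + R$3$3"
  note q = SO3_quaternion[OF R, folded p0_def p1_def p2_def p3_def]
  have d: "0 \<le> 1 - R$i$i" for i using SO3_diag_le[OF R, of i] by simp
  have e: "e = p1 + p2 + p3" "p0 = 4 - e" "0 \<le> e" "e \<le> 1"
    using d[of 1] d[of 2] d[of 3] small by (simp_all add: e_def p0_def p1_def p2_def p3_def trace_def sum_3)
  have p0: "3 \<le> p0" using e by simp
  have "0 \<le> p0 * p1" "0 \<le> p0 * p2" "0 \<le> p0 * p3" unfolding q by simp_all
  then have p: "0 \<le> p1" "0 \<le> p2" "0 \<le> p3" using p0 by (auto simp: zero_le_mult_iff)
  have s0: "r \<le> s" using r(2)[of 1] s[of 1] by simp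
  have key: "(r\<^sup>2 / 2) * (x - y)\<^sup>2 - s\<^sup>2 / 4 * (x + y)\<^sup>2 \<le> (m * x - n * y)\<^sup>2"
    if "r \<le> m" "r \<le> n" "m \<le> s" "n \<le> s" for m n x y
  proof -
    define K S where "K = (m + n) / 2 * (x - y)" and "S = (m - n) / 2 * (x + y)"
    have "m * x - n * y = K + S" by (simp add: K_def S_def field_simps)
    moreover have "(K + S)\<^sup>2 \<ge> K\<^sup>2 / 2 - S\<^sup>2"
      using zero_le_power2[of "K + 2 * S"] by (simp add: power2_eq_square algebra_simps)
    moreover have "r\<^sup>2 * (x - y)\<^sup>2 \<le> K\<^sup>2"
    proof -
      have "r\<^sup>2 \<le> ((m + n) / 2)\<^sup>2" using that r by (intro power_mono) auto
      then show ?thesis unfolding K_def power_mult_distrib by (intro mult_right_mono) auto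
    qed
    moreover have "S\<^sup>2 \<le> s\<^sup>2 / 4 * (x + y)\<^sup>2"
    proof -
      have "\<bar>m - n\<bar> \<le> s" using that r by linarith
      then have "(m - n)\<^sup>2 \<le> s\<^sup>2" using abs_le_square_iff[of "m - n" s] by simp
      then have "((m - n) / 2)\<^sup>2 \<le> s\<^sup>2 / 4" by (simp add: power_divide)
      then show ?thesis unfolding S_def power_mult_distrib by (intro mult_right_mono) auto
    qed
    ultimately show ?thesis by simp
  qed
  have prod: "p1 * p2 + p1 * p3 + p2 * p3 \<le> e\<^sup>2"
    using p by (simp add: e(1) power2_eq_square algebra_simps)
  have "r\<^sup>2 / 2 * (p0 * e) - s\<^sup>2 / 4 * e\<^sup>2 \<le> r\<^sup>2 / 2 * (p0 * e) - s\<^sup>2 / 4 * (p1 * p2 + p1 * p3 + p2 * p3)"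
    using prod by (simp add: mult_left_mono)
  also have "\<dots> = (r\<^sup>2 / 2) * (R$3$2 - R$2$3)\<^sup>2 - s\<^sup>2 / 4 * (R$3$2 + R$2$3)\<^sup>2
    + ((r\<^sup>2 / 2) * (R$1$3 - R$3$1)\<^sup>2 - s\<^sup>2 / 4 * (R$1$3 + R$3$1)\<^sup>2)
    + ((r\<^sup>2 / 2) * (R$2$1 - R$1$2)\<^sup>2 - s\<^sup>2 / 4 * (R$2$1 + R$1$2)\<^sup>2)"
    unfolding e(1) by (simp add: q[symmetric] add.commute[of "R$2$1" "R$1$2"] add.commute[of "R$3$2" "R$2$3"]
        del: mult_cancel_left) (simp add: field_simps)
  also have "\<dots> \<le> (\<rho>$3 * R$3$2 - \<rho>$2 * R$2$3)\<^sup>2 + (\<rho>$1 * R$1$3 - \<rho>$3 * R$3$1)\<^sup>2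
      + (\<rho>$2 * R$2$1 - \<rho>$1 * R$1$2)\<^sup>2"
    by (intro add_mono key r s)
  also have "\<dots> = 4 * (ang \<rho> R \<bullet> ang \<rho> R)"
    by (simp add: ang_explicit inner_vec_def sum_3 power2_eq_square field_simps)
  finally have 1: "r\<^sup>2 / 2 * (p0 * e) - s\<^sup>2 / 4 * e\<^sup>2 \<le> 4 * (ang \<rho> R \<bullet> ang \<rho> R)" .
  have "r\<^sup>2 / 2 * (3 * e) \<le> r\<^sup>2 / 2 * (p0 * e)"
    using p0 e by (intro mult_left_mono mult_right_mono) auto
  moreover have "s\<^sup>2 / 4 * e\<^sup>2 \<le> r\<^sup>2 / 4 * e"
    using mult_right_mono[OF small(2)[folded e_def], of e] e by (simp add: power2_eq_square algebra_simps)
  moreover have "0 \<le> r\<^sup>2 * e" using e by simp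
  ultimately show ?thesis using 1 unfolding e_def[symmetric] by linarith
qed

section \<open>The attitude error flow\<close>

definition att :: "real \<Rightarrow> real^3 \<Rightarrow> real^3 \<Rightarrow> real^3^3 \<Rightarrow> real^3^3" where
  "att k \<rho> u R = R ** hat (- k *\<^sub>R ang \<rho> R - u)"

lemma transpose_diag3: "transpose (diag3 \<rho>) = diag3 \<rho>"
  by (simp add: diag3_def transpose_def vec_eq_iff)

lemma att_riccati:
  assumes "R \<in> SO3"
  shows "att k \<rho> u R = (k / 2) *\<^sub>R (diag3 \<rho> - R ** diag3 \<rho> ** R) - R ** hat u"
proof -
  have "R ** transpose (diag3 \<rho> ** R) = R ** transpose R ** diag3 \<rho>"
    by (simp add: matrix_transpose_mul transpose_diag3 matrix_mul_assoc)
  then have "R ** transpose (diag3 \<rho> ** R) = diag3 \<rho>"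
    using assms by (simp add: SO3_orthogonal)
  then show ?thesis
    by (simp add: att_def hat_diff hat_scaleR hat_uminus ang_def hat_psi_a matrix_algebra scaleR_diff_right)
qed

lemma matrix_vd_component:
  assumes "(R has_vector_derivative R') (at t within S)"
  shows "((\<lambda>t. R t $ i $ j) has_vector_derivative R' $ i $ j) (at t within S)"
  by (intro bounded_linear.has_vector_derivative[OF bounded_linear_vec_nth] assms)

lemma att_in_SO3:
  assumes "convex I" "s \<in> I" "t \<in> I" "R s \<in> SO3"
    and d: "\<And>t. t \<in> I \<Longrightarrow> \<exists>w. (R has_vector_derivative (R t ** hat w)) (at t within I)"
  shows "R t \<in> SO3"
proof -
  have const: "R r ** transpose (R r) = mat 1" if "r \<in> I" for r
  proof -
    have "R r ** transpose (R r) = R s ** transpose (R s)"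
    proof (rule vd_constant[OF assms(1) _ assms(2) that])
      fix t assume "t \<in> I"
      then obtain w where "(R has_vector_derivative (R t ** hat w)) (at t within I)" using d by blast
      then have "((\<lambda>t. R t ** transpose (R t)) has_vector_derivative
          (R t ** transpose (R t ** hat w) + R t ** hat w ** transpose (R t))) (at t within I)"
        by (intro has_vd_matrix_matrix has_vd_transpose)
      then show "((\<lambda>t. R t ** transpose (R t)) has_vector_derivative 0) (at t within I)"
        by (simp add: matrix_algebra transpose_hat)
    qed
    then show ?thesis using assms(4) by (simp add: SO3_orthogonal)
  qed
  have cR: "continuous_on I R"
    unfolding continuous_on_eq_continuous_within using d has_vector_derivative_continuous by blast
  have cdet: "continuous_on I (\<lambda>t. det (R t))"
    unfolding det_3 by (intro continuous_intros cR)
  have sq: "det (R r) = 1 \<or> det (R r) = -1" if "r \<in> I" for r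
  proof -
    have "det (R r) * det (R r) = 1"
      using arg_cong[OF const[OF that], of det] by (simp add: det_mul)
    then show ?thesis by (simp add: square_eq_1_iff)
  qed
  have "det (R t) = 1"
  proof (rule ccontr)
    assume "det (R t) \<noteq> 1"
    then have "det (R t) = -1" using sq[OF assms(3)] by simp
    moreover have "connected ((\<lambda>t. det (R t)) ` I)"
      by (intro connected_continuous_image cdet convex_connected assms(1))
    moreover have "det (R s) = 1" using assms(4) by (rule SO3_det)
    ultimately have "0 \<in> (\<lambda>t. det (R t)) ` I"
      using assms(2,3) connectedD_interval[of "(\<lambda>t. det (R t)) ` I" "-1" 1 0] by (metis image_eqI neg_le_0_iff_le zero_le_one)
    then show False using sq by force
  qed
  then show ?thesis
    using const[OF assms(3)] matrix_left_right_inverse unfolding SO3_def by blast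
qed

lemma pot_vd:
  assumes "(R has_vector_derivative att k \<rho> u (R t)) (at t within S)"
  shows "((\<lambda>t. pot \<rho> (R t)) has_vector_derivative
    (- 2 * k * (ang \<rho> (R t) \<bullet> ang \<rho> (R t)) - 2 * (ang \<rho> (R t) \<bullet> u))) (at t within S)"
proof -
  have "((\<lambda>t. pot \<rho> (R t)) has_vector_derivative
    (\<rho>$1 * (0 - att k \<rho> u (R t) $1$1) + \<rho>$2 * (0 - att k \<rho> u (R t) $2$2) + \<rho>$3 * (0 - att k \<rho> u (R t) $3$3)))
      (at t within S)"
    unfolding pot_def
    by (intro has_vector_derivative_add has_vector_derivative_diff has_vector_derivative_const
        has_vector_derivative_mult_right matrix_vd_component assms)
  moreover have "- (\<rho>$1 * (X ** hat w)$1$1) - \<rho>$2 * (X ** hat w)$2$2 - \<rho>$3 * (X ** hat w)$3$3 = 2 * (ang \<rho> X \<bullet> w)"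
    for X w
    by (simp add: ang_explicit mat3_simps field_simps)
  from this[of "R t" "- k *\<^sub>R ang \<rho> (R t) - u"]
  have "\<rho>$1 * (0 - att k \<rho> u (R t) $1$1) + \<rho>$2 * (0 - att k \<rho> u (R t) $2$2) + \<rho>$3 * (0 - att k \<rho> u (R t) $3$3)
    = - 2 * k * (ang \<rho> (R t) \<bullet> ang \<rho> (R t)) - 2 * (ang \<rho> (R t) \<bullet> u)"
    by (simp add: att_def inner_diff_right)
  ultimately show ?thesis by (simp only:)
qed

lemma det_vd:
  assumes "(D has_vector_derivative (D t ** X + Y ** D t)) (at t within S)"
  shows "((\<lambda>t. det (D t :: real^3^3)) has_vector_derivative ((trace X + trace Y) * det (D t))) (at t within S)"
proof -
  define D' where "D' = D t ** X + Y ** D t"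
  define E where "E = D t"
  note c = matrix_vd_component[OF assms[folded D'_def]]
  have "((\<lambda>t. det (D t)) has_vector_derivative
     (E$1$1 * E$2$2 * D'$3$3 + (E$1$1 * D'$2$2 + D'$1$1 * E$2$2) * E$3$3
    + (E$1$2 * E$2$3 * D'$3$1 + (E$1$2 * D'$2$3 + D'$1$2 * E$2$3) * E$3$1)
    + (E$1$3 * E$2$1 * D'$3$2 + (E$1$3 * D'$2$1 + D'$1$3 * E$2$1) * E$3$2)
    - (E$1$1 * E$2$3 * D'$3$2 + (E$1$1 * D'$2$3 + D'$1$1 * E$2$3) * E$3$2)
    - (E$1$2 * E$2$1 * D'$3$3 + (E$1$2 * D'$2$1 + D'$1$2 * E$2$1) * E$3$3)
    - (E$1$3 * E$2$2 * D'$3$1 + (E$1$3 * D'$2$2 + D'$1$3 * E$2$2) * E$3$1))) (at t within S)" (is "(_ has_vector_derivative ?d) _")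
    unfolding det_3 E_def
    by (intro has_vector_derivative_add has_vector_derivative_diff has_vector_derivative_mult c)
  moreover have "?d = (trace X + trace Y) * det E"
    unfolding D'_def E_def[symmetric]
    by (simp add: det_3 trace_def sum_3 matrix_matrix_mult_def) (simp add: algebra_simps)
  ultimately show ?thesis by (simp add: E_def)
qed

text \<open>The input \<open>u\<close> cancels when a solution is compared with a solution of the reversed gradient flow.\<close>

lemma det_comparison_vd:
  assumes R: "(R has_vector_derivative att k \<rho> u (R t)) (at t within I)" and "R t \<in> SO3"
    and S: "(S has_vector_derivative att (- k) \<rho> u (S t)) (at t within I)" and "S t \<in> SO3"
  shows "((\<lambda>t. det (mat 1 + R t ** transpose (S t))) has_vector_derivative
    (k / 2 * (pot \<rho> (R t) - pot \<rho> (S t)) * det (mat 1 + R t ** transpose (S t)))) (at t within I)"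
proof -
  define M where "M = diag3 \<rho>"
  define D where "D = (\<lambda>t. mat 1 + R t ** transpose (S t))"
  define X where "X = (k / 2) *\<^sub>R (M ** transpose (S t))"
  define Y where "Y = - ((k / 2) *\<^sub>R (R t ** M))"
  have "(D has_vector_derivative (0 + (R t ** transpose (att (- k) \<rho> u (S t)) + att k \<rho> u (R t) ** transpose (S t))))
      (at t within I)"
    unfolding D_def
    by (intro has_vector_derivative_add has_vector_derivative_const has_vd_matrix_matrix has_vd_transpose R S)
  moreover have "0 + (R t ** transpose (att (- k) \<rho> u (S t)) + att k \<rho> u (R t) ** transpose (S t))
    = D t ** X + Y ** D t"
    using assms(2,4)
    by (simp add: att_riccati M_def D_def X_def Y_def matrix_algebra transpose_hat transpose_diag3
        scaleR_diff_right scaleR_add_right)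
  ultimately have "((\<lambda>t. det (D t)) has_vector_derivative ((trace X + trace Y) * det (D t))) (at t within I)"
    by (intro det_vd) simp
  moreover have "trace X + trace Y = k / 2 * (pot \<rho> (R t) - pot \<rho> (S t))"
    by (simp add: X_def Y_def M_def pot_def trace_def diag3_def matrix_matrix_mult_def transpose_def sum_3 algebra_simps)
  ultimately show ?thesis by (simp add: D_def)
qed

lemma att_diff_le:
  assumes "norm X \<le> 2" "norm Y \<le> 2" "norm u \<le> U" "0 \<le> k'" "\<bar>k\<bar> \<le> k'"
  shows "norm (att k \<rho> u X - att k \<rho> v Y) \<le> (8 * k' * norm (diag3 \<rho>) + 2 * U) * norm (X - Y) + 4 * norm (u - v)"
proof -
  define m where "m = norm (diag3 \<rho>)"
  have lin: "ang \<rho> A - ang \<rho> B = ang \<rho> (A - B)" for A B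
    by (simp add: ang_def linear_diff[OF bounded_linear.linear[OF bounded_linear_psi_a]] matrix_diff_ldistrib)
  have ang: "norm (ang \<rho> A) \<le> m * norm A" for A
    unfolding ang_def m_def by (rule order_trans[OF norm_psi_a_le norm_matrix_mult_le])
  have nh: "norm (A ** hat w) \<le> norm A * (2 * norm w)" for A w
    by (intro order_trans[OF norm_matrix_mult_le] mult_left_mono norm_hat_le) auto
  have kang: "norm (k *\<^sub>R ang \<rho> A) \<le> k' * (m * norm A)" for A
    using assms(4,5) ang by (auto intro!: mult_mono)
  have w: "norm (- k *\<^sub>R ang \<rho> X - u) \<le> 2 * k' * m + U"
  proof -
    have "norm (- k *\<^sub>R ang \<rho> X - u) \<le> norm (k *\<^sub>R ang \<rho> X) + norm u"
      using norm_triangle_ineq4[of "- (k *\<^sub>R ang \<rho> X)" u] by simp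
    also have "\<dots> \<le> k' * (m * 2) + U"
      using assms by (intro add_mono order_trans[OF kang] mult_left_mono) (auto simp: m_def)
    finally show ?thesis by (simp add: mult_ac)
  qed
  have eq: "att k \<rho> u X - att k \<rho> v Y = (X - Y) ** hat (- k *\<^sub>R ang \<rho> X - u)
      + Y ** hat (- (k *\<^sub>R ang \<rho> (X - Y)) - (u - v))"
    by (simp add: att_def matrix_diff_rdistrib hat_diff hat_uminus hat_scaleR matrix_algebra
        lin[symmetric] scaleR_diff_right)
  have "norm (att k \<rho> u X - att k \<rho> v Y) \<le> norm (X - Y) * (2 * norm (- k *\<^sub>R ang \<rho> X - u))
      + norm Y * (2 * norm (- (k *\<^sub>R ang \<rho> (X - Y)) - (u - v)))"
    unfolding eq by (intro order_trans[OF norm_triangle_ineq] add_mono nh)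
  also have "\<dots> \<le> norm (X - Y) * (2 * (2 * k' * m + U)) + 2 * (2 * (k' * (m * norm (X - Y)) + norm (u - v)))"
  proof (intro add_mono mult_left_mono w mult_mono assms)
    have "norm (- (k *\<^sub>R ang \<rho> (X - Y)) - (u - v)) \<le> norm (k *\<^sub>R ang \<rho> (X - Y)) + norm (u - v)"
      using norm_triangle_ineq4[of "- (k *\<^sub>R ang \<rho> (X - Y))" "u - v"] by simp
    also have "\<dots> \<le> k' * (m * norm (X - Y)) + norm (u - v)" by (intro add_mono kang) auto
    finally show "norm (- (k *\<^sub>R ang \<rho> (X - Y)) - (u - v)) \<le> k' * (m * norm (X - Y)) + norm (u - v)" .
  qed auto
  also have "\<dots> = (8 * k' * m + 2 * U) * norm (X - Y) + 4 * norm (u - v)"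
    by (simp add: algebra_simps)
  finally show ?thesis by (simp add: m_def)
qed

text \<open>Being radial, the cut-off turns \<open>att\<close> into a globally Lipschitz field of the form \<open>X hat(w)\<close>,
  so solutions starting in \<open>SO(3)\<close> stay there and the cut-off is inactive along them.\<close>

definition clip :: "real^3^3 \<Rightarrow> real^3^3" where "clip X = (2 / max 2 (norm X)) *\<^sub>R X"

lemma norm_clip_le: "norm (clip X) \<le> 2"
  by (simp add: clip_def field_simps)

lemma clip_id: "norm X \<le> 2 \<Longrightarrow> clip X = X"
  by (simp add: clip_def max_def)

lemma clip_lipschitz: "norm (clip X - clip Y) \<le> 2 * norm (X - Y)"
proof -
  define m n where "m = max 2 (norm X)" and "n = max 2 (norm Y)"
  have mn: "2 \<le> m" "2 \<le> n" "norm Y \<le> n" by (auto simp: m_def n_def)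
  have "clip X - clip Y = (2 / m) *\<^sub>R (X - Y) + (2 * (n - m) / (m * n)) *\<^sub>R Y"
    using mn by (simp add: clip_def m_def[symmetric] n_def[symmetric] scaleR_diff_right diff_divide_distrib
        right_diff_distrib scaleR_diff_left)
  then have "norm (clip X - clip Y) \<le> \<bar>2 / m\<bar> * norm (X - Y) + \<bar>2 * (n - m) / (m * n)\<bar> * norm Y"
    by (metis norm_triangle_ineq norm_scaleR)
  also have "\<dots> \<le> 1 * norm (X - Y) + 1 * norm (X - Y)"
  proof (intro add_mono mult_right_mono)
    have "\<bar>2 * (n - m) / (m * n)\<bar> * norm Y \<le> \<bar>2 * (n - m) / (m * n)\<bar> * n"
      using mn by (intro mult_left_mono) auto
    also have "\<dots> = (2 / m) * \<bar>n - m\<bar>" using mn by (simp add: abs_mult abs_divide del: right_diff_distrib_numeral)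
    also have "\<dots> \<le> 1 * \<bar>n - m\<bar>" using mn by (intro mult_right_mono) auto
    also have "\<bar>n - m\<bar> \<le> \<bar>norm X - norm Y\<bar>" by (auto simp: m_def n_def max_def)
    also have "\<dots> \<le> norm (X - Y)" by (rule norm_triangle_ineq3)
    finally show "\<bar>2 * (n - m) / (m * n)\<bar> * norm Y \<le> 1 * norm (X - Y)" by simp
  qed (use mn in auto)
  finally show ?thesis by simp
qed

lemma att_exists_backward:
  assumes "a \<le> b" and u: "continuous_on {a..b} u"
  shows "\<exists>S. S b = mat 1 \<and> (\<forall>t\<in>{a..b}. S t \<in> SO3 \<and>
    (S has_vector_derivative att k \<rho> (u t) (S t)) (at t within {a..b}))"
proof -
  have "bounded (u ` {a..b})"
    by (intro compact_imp_bounded compact_continuous_image u) auto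
  then obtain U where U: "0 < U" "\<And>t. a \<le> t \<Longrightarrow> t \<le> b \<Longrightarrow> norm (u t) \<le> U"
    unfolding bounded_pos by auto
  define K where "K = 8 * \<bar>k\<bar> * norm (diag3 \<rho>) + 2 * U"
  have K: "0 < K" using U by (simp add: K_def add_nonneg_pos)
  have cont_clip: "continuous_on UNIV clip"
    unfolding clip_def by (intro continuous_intros) (auto simp: max_def)
  have "\<exists>S. S b = mat 1 \<and> (\<forall>t\<in>{a..b}. (S has_vector_derivative att k \<rho> (u t) (clip (S t))) (at t within {a..b}))"
  proof (rule picard_backward[OF assms(1), of "2 * K"])
    fix t and X Y :: "real^3^3"
    assume t: "a \<le> t" "t \<le> b"
    have "norm (att k \<rho> (u t) (clip X) - att k \<rho> (u t) (clip Y)) \<le> K * norm (clip X - clip Y) + 4 * norm (u t - u t)"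
      unfolding K_def by (intro att_diff_le norm_clip_le U t) auto
    also have "\<dots> \<le> K * (2 * norm (X - Y))" using K clip_lipschitz by simp
    finally show "norm (att k \<rho> (u t) (clip X) - att k \<rho> (u t) (clip Y)) \<le> 2 * K * norm (X - Y)" by simp
  next
    fix y :: "real \<Rightarrow> real^3^3" assume "continuous_on {a..b} y"
    then show "continuous_on {a..b} (\<lambda>t. att k \<rho> (u t) (clip (y t)))"
      unfolding att_def
      by (intro continuous_intros u continuous_on_compose2[OF cont_clip]) auto
  qed (use K in simp)
  then obtain S where S: "S b = mat 1"
    "\<And>t. t \<in> {a..b} \<Longrightarrow> (S has_vector_derivative att k \<rho> (u t) (clip (S t))) (at t within {a..b})"
    by blast
  have "att k \<rho> (u t) (clip (S t)) = S t ** hat ((2 / max 2 (norm (S t))) *\<^sub>R (- k *\<^sub>R ang \<rho> (clip (S t)) - u t))" for t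
    by (simp add: att_def clip_def matrix_scaleR_left matrix_scaleR_right hat_scaleR)
  then have in_SO3: "S t \<in> SO3" if "t \<in> {a..b}" for t
    using S assms(1) that by (intro att_in_SO3[of "{a..b}" b t S]) (auto simp: SO3_id)
  then have "clip (S t) = S t" if "t \<in> {a..b}" for t
    using that by (simp add: clip_id SO3_norm_le)
  then show ?thesis using S in_SO3 by (intro exI[of _ S]) auto
qed

section \<open>Axis-angle coordinates\<close>

lemma hat_cube: "hat v ** hat v ** hat v = - (v \<bullet> v) *\<^sub>R hat v"
  by (simp add: mat3_simps algebra_simps)

lemma rot_axis_vd:
  assumes "norm v = 1"
  shows "((\<lambda>\<theta>. rot_axis \<theta> v) has_vector_derivative (rot_axis \<theta> v ** hat v)) (at \<theta> within S)"
proof -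
  have "((\<lambda>\<theta>. rot_axis \<theta> v) has_vector_derivative (0 + (sin \<theta> *\<^sub>R 0 + cos \<theta> *\<^sub>R hat v)
      + ((1 - cos \<theta>) *\<^sub>R 0 + sin \<theta> *\<^sub>R (hat v ** hat v)))) (at \<theta> within S)"
    unfolding rot_axis_def
    by (intro has_vector_derivative_add has_vector_derivative_const has_vector_derivative_scaleR)
      (auto intro!: derivative_eq_intros)
  moreover have "rot_axis \<theta> v ** hat v = 0 + (sin \<theta> *\<^sub>R 0 + cos \<theta> *\<^sub>R hat v)
      + ((1 - cos \<theta>) *\<^sub>R 0 + sin \<theta> *\<^sub>R (hat v ** hat v))"
    using assms by (simp add: rot_axis_def matrix_algebra hat_cube norm_eq_1 algebra_simps)
  ultimately show ?thesis by simp
qed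

lemma rot_axis_0: "rot_axis 0 v = mat 1"
  by (simp add: rot_axis_def)

lemma rot_axis_SO3:
  assumes "norm v = 1"
  shows "rot_axis \<theta> v \<in> SO3"
proof (rule att_in_SO3[of UNIV 0 \<theta> "\<lambda>\<theta>. rot_axis \<theta> v"])
  show "\<exists>w. ((\<lambda>\<theta>. rot_axis \<theta> v) has_vector_derivative rot_axis t v ** hat w) (at t within UNIV)" for t
    using rot_axis_vd[OF assms] by blast
qed (auto simp: rot_axis_0 SO3_id)

lemma expSO3_scaleR:
  assumes "norm v = 1" "0 < s"
  shows "expSO3 (s *\<^sub>R v) = rot_axis s v"
  using assms by (simp add: expSO3_def)

lemma expSO3_in_SO3: "expSO3 w \<in> SO3"
proof (cases "w = 0")
  case True
  then show ?thesis by (simp add: expSO3_def rot_axis_0 SO3_id)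
next
  case False
  then show ?thesis unfolding expSO3_def by (intro rot_axis_SO3) simp
qed

lemma continuous_on_expSO3: "0 \<notin> S \<Longrightarrow> continuous_on S expSO3"
  unfolding expSO3_def rot_axis_def by (intro continuous_intros) auto

text \<open>A nonnegative trigonometric polynomial of degree one has double zeros, so two zeros at distance
  less than \<open>2 \<pi>\<close> force it to vanish.\<close>

lemma trig_poly_nonneg_zeros:
  fixes \<alpha> \<beta> \<gamma> :: real
  assumes nn: "\<And>s. 0 \<le> \<alpha> + \<beta> * sin s + \<gamma> * cos s" and z: "\<alpha> + \<beta> * sin r + \<gamma> * cos r = 0"
  shows "\<alpha> + \<beta> * sin s + \<gamma> * cos s = \<alpha> * (1 - cos (s - r))"
proof -
  have "((\<lambda>s. \<alpha> + \<beta> * sin s + \<gamma> * cos s) has_real_derivative (\<beta> * cos r - \<gamma> * sin r)) (at r)"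
    by (auto intro!: derivative_eq_intros)
  then have d: "\<beta> * cos r - \<gamma> * sin r = 0"
    by (rule DERIV_local_min[of _ _ _ 1]) (use nn z in auto)
  have sc: "sin r * sin r + cos r * cos r = 1"
    using sin_cos_squared_add[of r] by (simp add: power2_eq_square)
  have 1: "\<gamma> = - \<alpha> * cos r" and 2: "\<beta> = - \<alpha> * sin r"
    using z d sc by algebra+
  show ?thesis by (subst 1, subst 2) (simp add: cos_diff algebra_simps)
qed

lemma trace_rot_axis:
  "1 + trace (rot_axis s v ** transpose S) = (1 + trace S + trace (hat v ** hat v ** transpose S))
    + trace (hat v ** transpose S) * sin s + (- trace (hat v ** hat v ** transpose S)) * cos s"
proof -
  have tr: "trace (c *\<^sub>R A) = c * trace A" for c and A :: "real^3^3"
    by (simp add: trace_def sum_distrib_left)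
  have "trace (transpose S) = trace S" by (simp add: trace_def transpose_def)
  then show ?thesis
    by (simp add: rot_axis_def matrix_algebra trace_add trace_sub tr algebra_simps)
qed

lemma det_id_plus_exp:
  "S \<in> SO3 \<Longrightarrow> det (mat 1 + expSO3 w ** transpose S) = 2 * (1 + trace (expSO3 w ** transpose S))"
  by (intro det_id_plus_SO3 SO3_mult expSO3_in_SO3 SO3_transpose)

lemma negligible_exp_annulus:
  assumes S: "S \<in> SO3" and a: "0 < a" and nz: "1 + trace S \<noteq> 0"
  shows "negligible {w. a \<le> norm w \<and> norm w \<le> a + 1 \<and> 1 + trace (expSO3 w ** transpose S) = 0}" (is "negligible ?K")
proof (rule starlike_negligible_strong[of _ 0])
  have "closed ({w::real^3. a \<le> norm w \<and> norm w \<le> a + 1} \<inter>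
      (\<lambda>w. 1 + trace (expSO3 w ** transpose S)) -` {0})"
  proof (rule continuous_closed_preimage)
    show "continuous_on {w. a \<le> norm w \<and> norm w \<le> a + 1} (\<lambda>w. 1 + trace (expSO3 w ** transpose S))"
      unfolding trace_def using a by (intro continuous_intros continuous_on_expSO3) auto
    show "closed {w::real^3. a \<le> norm w \<and> norm w \<le> a + 1}"
      by (intro closed_Collect_conj closed_Collect_le continuous_intros)
  qed simp
  then show "closed ?K" by (simp add: vimage_def Int_def conj_assoc)
next
  fix c :: real and x :: "real^3" assume c: "0 \<le> c" "c < 1" and x: "0 + x \<in> ?K"
  show "0 + c *\<^sub>R x \<notin> ?K"
  proof
    assume cx: "0 + c *\<^sub>R x \<in> ?K"
    define s v where "s = norm x" and "v = inverse (norm x) *\<^sub>R x"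
    have "x \<noteq> 0" using x a by auto
    then have s: "0 < s" "norm v = 1" "x = s *\<^sub>R v" by (simp_all add: s_def v_def)
    have c0: "0 < c" using cx a c by (cases "c = 0") auto
    have cs: "c *\<^sub>R x = (c * s) *\<^sub>R v" "0 < c * s" using s c0 by auto
    have f: "0 \<le> 1 + trace (rot_axis t v ** transpose S)" for t
      by (intro SO3_trace_ge SO3_mult rot_axis_SO3 SO3_transpose S s)
    have z1: "1 + trace (rot_axis s v ** transpose S) = 0"
      using x s(1,2) by (simp add: s(3) expSO3_scaleR)
    have z2: "1 + trace (rot_axis (c * s) v ** transpose S) = 0"
      using cx s(2) cs by (simp add: expSO3_scaleR)
    define \<alpha> where "\<alpha> = 1 + trace S + trace (hat v ** hat v ** transpose S)"
    note tz = trig_poly_nonneg_zeros[OF f[unfolded trace_rot_axis] z1[unfolded trace_rot_axis], folded trace_rot_axis \<alpha>_def]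
    have "\<alpha> * (1 - cos (c * s - s)) = 0" using tz[of "c * s"] z2 by simp
    moreover have "cos (c * s - s) < 1"
    proof -
      have ns: "norm x \<le> a + 1" "a \<le> norm (c *\<^sub>R x)" using x cx by auto
      have "0 < s - c * s" using mult_strict_right_mono[OF c(2) s(1)] by simp
      moreover have "norm (c *\<^sub>R x) = c * s" using c(1) by (simp add: s_def)
      then have "s - c * s \<le> 1" using ns s_def by linarith
      ultimately have "cos (s - c * s) < cos 0" using pi_gt3 by (intro cos_monotone_0_pi) auto
      then show ?thesis using cos_minus[of "s - c * s"] by simp
    qed
    ultimately have "\<alpha> = 0" by simp
    then have "1 + trace (rot_axis 0 v ** transpose S) = 0" using tz[of 0] by simp
    then show False using nz by (simp add: rot_axis_0 trace_def transpose_def)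
  qed
qed

lemma negligible_exp_SO3:
  assumes S: "S \<in> SO3"
  shows "negligible {w. det (mat 1 + expSO3 w ** transpose S) = 0}" (is "negligible ?Z")
proof (cases "1 + trace S = 0")
  case False
  have "?Z \<subseteq> (\<Union>a\<in>\<rat> \<inter> {0<..}. {w. a \<le> norm w \<and> norm w \<le> a + 1 \<and> 1 + trace (expSO3 w ** transpose S) = 0})"
  proof
    fix w assume w: "w \<in> ?Z"
    then have z: "1 + trace (expSO3 w ** transpose S) = 0" using S by (simp add: det_id_plus_exp)
    have "w \<noteq> 0"
      using z False by (auto simp: expSO3_def rot_axis_0) (auto simp: trace_def transpose_def)
    then have "max 0 (norm w - 1) < norm w" by simp
    then obtain a where "a \<in> \<rat>" "max 0 (norm w - 1) < a" "a < norm w" by (rule Rats_dense_in_real[THEN bexE]) auto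
    then show "w \<in> (\<Union>a\<in>\<rat> \<inter> {0<..}. {w. a \<le> norm w \<and> norm w \<le> a + 1 \<and> 1 + trace (expSO3 w ** transpose S) = 0})"
      using z by (intro UN_I[of a]) auto
  qed
  moreover have "negligible (\<Union>a\<in>\<rat> \<inter> {0<..}. {w. a \<le> norm w \<and> norm w \<le> a + 1 \<and> 1 + trace (expSO3 w ** transpose S) = 0})"
  proof (rule negligible_countable_Union)
    show "countable ((\<lambda>a. {w. a \<le> norm w \<and> norm w \<le> a + 1 \<and> 1 + trace (expSO3 w ** transpose S) = 0}) ` (\<rat> \<inter> {0<..}))"
      by (intro countable_image countable_Int1 countable_rat)
  qed (use negligible_exp_annulus[OF S _ False] in auto)
  ultimately show ?thesis using negligible_subset by blast
next
  case True
  define W where "W = {w. S *v w = - w}"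
  have "subspace W"
    by (auto simp: W_def subspace_def matrix_vector_right_distrib matrix_vector_mult_scaleR)
  moreover have "W \<noteq> UNIV"
  proof
    assume "W = UNIV"
    then have "S *v x = (- mat 1) *v x" for x
      using matrix_vector_mult_diff_rdistrib[of 0 "mat 1" x] by (auto simp: W_def)
    then have "S = - mat 1" by (simp add: matrix_eq)
    then show False using SO3_det[OF S] by (simp add: det_3 mat_def)
  qed
  ultimately have "dim W \<noteq> DIM(real^3)"
    by (metis dim_eq_full span_eq_iff)
  then have "dim W < DIM(real^3)" using dim_subset_UNIV[of W] by linarith
  then have "negligible W" by (rule negligible_lowdim)
  moreover have "?Z \<subseteq> W \<union> (\<Union>n::nat. sphere 0 (real n * 2 * pi))"
  proof
    fix w assume w: "w \<in> ?Z"
    show "w \<in> W \<union> (\<Union>n::nat. sphere 0 (real n * 2 * pi))"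
    proof (cases "w = 0")
      case True then show ?thesis by (simp add: W_def)
    next
      case False
      define s v where "s = norm w" and "v = inverse (norm w) *\<^sub>R w"
      have s: "0 < s" "norm v = 1" "w = s *\<^sub>R v" using False by (simp_all add: s_def v_def)
      have f: "0 \<le> 1 + trace (rot_axis t v ** transpose S)" for t
        by (intro SO3_trace_ge SO3_mult rot_axis_SO3 SO3_transpose S s)
      have z0: "1 + trace (rot_axis 0 v ** transpose S) = 0"
        using True by (simp add: rot_axis_0) (simp add: trace_def transpose_def)
      have zs: "1 + trace (rot_axis s v ** transpose S) = 0"
        using w s(1,2) S by (simp add: det_id_plus_exp) (simp add: s(3) expSO3_scaleR)
      define \<alpha> where "\<alpha> = 1 + trace S + trace (hat v ** hat v ** transpose S)"
      note tz = trig_poly_nonneg_zeros[OF f[unfolded trace_rot_axis] z0[unfolded trace_rot_axis], folded trace_rot_axis \<alpha>_def]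
      have "\<alpha> * (1 - cos s) = 0" using tz[of s] zs by simp
      then consider "cos s = 1" | "\<alpha> = 0" by auto
      then show ?thesis
      proof cases
        case 1
        moreover have "s \<noteq> - (real n * 2 * pi)" for n using s(1) by (smt (verit) mult_nonneg_nonneg of_nat_0_le_iff pi_ge_zero)
        ultimately obtain n :: nat where "s = real n * 2 * pi" unfolding cos_one_2pi by blast
        then show ?thesis by (auto simp: s_def)
      next
        case 2
        have vv: "v \<bullet> v = 1" using s(2) by (simp add: norm_eq_1)
        have "trace (hat v ** hat v ** transpose S) = v \<bullet> (S *v v) - (v \<bullet> v) * trace S"
          by (simp add: trace_def mat3_simps algebra_simps)
        then have "v \<bullet> (S *v v) = -1" using 2 True vv by (simp add: \<alpha>_def)
        moreover have "(S *v v) \<bullet> (S *v v) = v \<bullet> v"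
          using SO3_orthogonal(1)[OF S] inner_matrix_transpose[of "S *v v" S v]
          by (simp add: matrix_vector_mul_assoc)
        ultimately have "(S *v v + v) \<bullet> (S *v v + v) = 0"
          using vv by (simp add: inner_add_left inner_add_right inner_commute)
        then have "S *v v = - v" by (simp add: eq_neg_iff_add_eq_0)
        then show ?thesis by (simp add: W_def s(3) matrix_vector_mult_scaleR)
      qed
    qed
  qed
  moreover have "negligible (W \<union> (\<Union>n::nat. sphere 0 (real n * 2 * pi)))"
    by (intro negligible_Un \<open>negligible W\<close> negligible_countable_Union)
      (auto intro: negligible_sphere)
  ultimately show ?thesis using negligible_subset by blast
qed

section \<open>Critical points of the potential\<close>

lemma diag3_mult: "(diag3 \<rho> ** A)$i$j = \<rho>$i * A$i$j" "(A ** diag3 \<rho>)$i$j = A$i$j * \<rho>$j"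
proof -
  have "\<forall>i j. (diag3 \<rho> ** A)$i$j = \<rho>$i * A$i$j \<and> (A ** diag3 \<rho>)$i$j = A$i$j * \<rho>$j"
    by (simp add: forall_3 diag3_def matrix_matrix_mult_def sum_3)
  then show "(diag3 \<rho> ** A)$i$j = \<rho>$i * A$i$j" "(A ** diag3 \<rho>)$i$j = A$i$j * \<rho>$j" by auto
qed

lemma ang_zero:
  assumes R: "R \<in> SO3" and z: "ang \<rho> R = 0" and pos: "\<And>i. 0 < \<rho>$i"
    and dist: "\<And>i j. i \<noteq> j \<Longrightarrow> \<rho>$i \<noteq> \<rho>$j"
  shows "R = mat 1 \<or> (\<exists>v\<in>unit_eigvecs (diag3 \<rho>). R = rot_axis pi v)"
proof -
  define N where "N = diag3 \<rho> ** R"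
  have "psi_a N = 0" using z by (simp add: ang_def N_def)
  moreover have "hat 0 = 0" by (simp add: mat3_simps)
  ultimately have sym: "transpose N = N" using hat_psi_a[of N] by simp
  have "N ** N = N ** transpose N" by (simp add: sym)
  also have "\<dots> = diag3 \<rho> ** (R ** transpose R) ** diag3 \<rho>"
    by (simp add: N_def matrix_transpose_mul transpose_diag3 matrix_mul_assoc)
  finally have NN: "N ** N = diag3 \<rho> ** diag3 \<rho>" using R by (simp add: SO3_orthogonal)
  then have comm: "N ** (diag3 \<rho> ** diag3 \<rho>) = (diag3 \<rho> ** diag3 \<rho>) ** N"
    by (metis matrix_mul_assoc)
  have off: "R$i$j = 0" if "i \<noteq> j" for i j
  proof -
    have "(N ** (diag3 \<rho> ** diag3 \<rho>))$i$j = N$i$j * (\<rho>$j)\<^sup>2" "((diag3 \<rho> ** diag3 \<rho>) ** N)$i$j = (\<rho>$i)\<^sup>2 * N$i$j"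
      by (simp_all add: matrix_mul_assoc diag3_mult power2_eq_square)
        (simp add: matrix_mul_assoc[symmetric] diag3_mult)
    then have "N$i$j * ((\<rho>$j)\<^sup>2 - (\<rho>$i)\<^sup>2) = 0"
      unfolding comm by algebra
    moreover have "(\<rho>$j)\<^sup>2 \<noteq> (\<rho>$i)\<^sup>2"
      using dist[OF that] pos[of i] pos[of j] by (simp add: power2_eq_iff)
    ultimately have "N$i$j = 0" by simp
    moreover have "N$i$j = \<rho>$i * R$i$j"
      by (simp add: N_def diag3_mult)
    ultimately show ?thesis using pos[of i] by simp
  qed
  have o: "R$1$2 = 0" "R$1$3 = 0" "R$2$1 = 0" "R$2$3 = 0" "R$3$1 = 0" "R$3$2 = 0" by (auto intro: off)
  have sq: "R$1$1 = 1 \<or> R$1$1 = -1" "R$2$2 = 1 \<or> R$2$2 = -1" "R$3$3 = R$1$1 * R$2$2"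
    using SO3_rows(1,2)[OF R] SO3_cofactor(9)[OF R] o by (auto simp: power2_eq_1_iff)
  have "diag3 \<rho> *v axis i 1 = \<rho>$i *\<^sub>R axis i 1" for i
    unfolding matrix_vector_mult_basis by (simp add: column_def diag3_def vec_eq_iff axis_def)
  then have ax: "axis i 1 \<in> unit_eigvecs (diag3 \<rho>)" for i
    unfolding unit_eigvecs_def using norm_axis_1[of i] by blast
  have "R = mat 1 \<or> R = rot_axis pi (axis 1 1) \<or> R = rot_axis pi (axis 2 1) \<or> R = rot_axis pi (axis 3 1)"
    using sq o by (auto simp: rot_axis_def mat3_simps axis_def)
  then show ?thesis using ax by blast
qed

lemma ang_rot_axis:
  assumes "diag3 \<rho> *v v = c *\<^sub>R v"
  shows "ang \<rho> (rot_axis \<theta> v) = (sin \<theta> * (trace (diag3 \<rho>) - c) / 2) *\<^sub>R v"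
proof -
  have c: "\<rho>$1 * v$1 = c * v$1" "\<rho>$2 * v$2 = c * v$2" "\<rho>$3 * v$3 = c * v$3"
    using assms by (simp_all add: diag3_def matrix_vector_mult_def vec_eq_iff forall_3 sum_3)
  define s d where "s = sin \<theta>" and "d = 1 - cos \<theta>"
  have "\<rho>$3 * (s * v$1 + d * (v$2 * v$3)) - \<rho>$2 * (- s * v$1 + d * (v$2 * v$3)) = s * (\<rho>$1 + \<rho>$2 + \<rho>$3 - c) * v$1"
    "\<rho>$1 * (s * v$2 + d * (v$1 * v$3)) - \<rho>$3 * (- s * v$2 + d * (v$1 * v$3)) = s * (\<rho>$1 + \<rho>$2 + \<rho>$3 - c) * v$2"
    "\<rho>$2 * (s * v$3 + d * (v$1 * v$2)) - \<rho>$1 * (- s * v$3 + d * (v$1 * v$2)) = s * (\<rho>$1 + \<rho>$2 + \<rho>$3 - c) * v$3"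
    using c by algebra+
  then show ?thesis
    by (simp add: ang_explicit rot_axis_def vec_eq_iff forall_3 mat_def hat_explicit matrix_matrix_mult_def sum_3
        trace_def diag3_def s_def d_def mult_ac)
qed

lemma unit_eigvec_gap:
  assumes "v \<in> unit_eigvecs (diag3 \<rho>)" and pos: "\<And>i. 0 < \<rho>$i"
  obtains c where "diag3 \<rho> *v v = c *\<^sub>R v" "0 < trace (diag3 \<rho>) - c"
proof -
  from assms(1) obtain c where v: "norm v = 1" and c: "diag3 \<rho> *v v = c *\<^sub>R v"
    by (auto simp: unit_eigvecs_def)
  have "\<forall>i. \<rho>$i * v$i = c * v$i"
    using c by (simp add: forall_3 vec_eq_iff diag3_def matrix_vector_mult_def sum_3)
  then have comp: "\<rho>$i * v$i = c * v$i" for i by blast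
  have "v \<noteq> 0" using v by auto
  then obtain i where "v$i \<noteq> 0" by (auto simp: vec_eq_iff)
  then have "c = \<rho>$i" using comp[of i] by simp
  then have "0 < trace (diag3 \<rho>) - c"
    using pos[of 1] pos[of 2] pos[of 3] exhaust_3[of i] by (auto simp: trace_def diag3_def sum_3)
  with c show ?thesis by (rule that)
qed

text \<open>The angle \<open>\<theta> = \<pi> - 2 arctan (\<sigma> exp (b t))\<close> solves \<open>\<theta>' = - b sin \<theta>\<close>.\<close>

lemma escaping_rotation:
  assumes v: "v \<in> unit_eigvecs (diag3 \<rho>)" and pos: "\<And>i. 0 < \<rho>$i" and k: "0 < k"
  obtains b where "0 < b" "\<And>\<sigma> t S. ((\<lambda>t. rot_axis (pi - 2 * arctan (\<sigma> * exp (b * t))) v) has_vector_derivative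
    att k \<rho> 0 (rot_axis (pi - 2 * arctan (\<sigma> * exp (b * t))) v)) (at t within S)"
proof -
  obtain c where c: "diag3 \<rho> *v v = c *\<^sub>R v" "0 < trace (diag3 \<rho>) - c"
    by (rule unit_eigvec_gap[OF v pos])
  define b where "b = k * (trace (diag3 \<rho>) - c) / 2"
  have b: "0 < b" using c k by (simp add: b_def)
  have nv: "norm v = 1" using v by (simp add: unit_eigvecs_def)
  have "((\<lambda>t. rot_axis (pi - 2 * arctan (\<sigma> * exp (b * t))) v) has_vector_derivative
    att k \<rho> 0 (rot_axis (pi - 2 * arctan (\<sigma> * exp (b * t))) v)) (at t within S)" for \<sigma> t S
  proof -
    define y where "y = \<sigma> * exp (b * t)"
    define \<theta> where "\<theta> = (\<lambda>t. pi - 2 * arctan (\<sigma> * exp (b * t)))"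
    have pos: "0 < 1 + y\<^sup>2" by (simp add: add_pos_nonneg)
    have sin: "sin (\<theta> t) = 2 * y / (1 + y\<^sup>2)"
    proof -
      have "sin (\<theta> t) = 2 * (sin (arctan y) * cos (arctan y))"
        by (simp add: \<theta>_def y_def[symmetric] sin_double)
      then show ?thesis using pos by (simp add: sin_arctan cos_arctan)
    qed
    have "(\<theta> has_real_derivative (- b * sin (\<theta> t))) (at t within S)"
      unfolding sin unfolding \<theta>_def y_def
      by (auto intro!: derivative_eq_intros simp: field_simps)
    then have "(\<theta> has_vector_derivative (- b * sin (\<theta> t))) (at t within S)"
      by (simp add: has_real_derivative_iff_has_vector_derivative)
    from vector_diff_chain_within[OF this rot_axis_vd[OF nv]]
    have "((\<lambda>t. rot_axis (\<theta> t) v) has_vector_derivative (- b * sin (\<theta> t)) *\<^sub>R (rot_axis (\<theta> t) v ** hat v)) (at t within S)"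
      by (simp add: o_def)
    moreover have "(- b * sin (\<theta> t)) *\<^sub>R (rot_axis (\<theta> t) v ** hat v) = att k \<rho> 0 (rot_axis (\<theta> t) v)"
      by (simp add: att_def ang_rot_axis[OF c(1)] hat_scaleR hat_uminus matrix_scaleR_right matrix_uminus_right b_def mult_ac)
    ultimately show ?thesis by (simp add: \<theta>_def)
  qed
  with b show ?thesis by (rule that)
qed

section \<open>Asymptotics\<close>

lemma nonincreasing_tendsto:
  fixes W :: "real \<Rightarrow> real"
  assumes dec: "\<And>s t. t0 \<le> s \<Longrightarrow> s \<le> t \<Longrightarrow> W t \<le> W s" and low: "\<And>t. t0 \<le> t \<Longrightarrow> m \<le> W t"
  obtains l where "(W \<longlongrightarrow> l) at_top" "\<And>t. t0 \<le> t \<Longrightarrow> l \<le> W t"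
proof -
  define l where "l = Inf (W ` {t0..})"
  have bd: "bdd_below (W ` {t0..})" using low by (intro bdd_belowI2[of _ m]) auto
  have l: "l \<le> W t" if "t0 \<le> t" for t
    unfolding l_def using that by (intro cInf_lower bd) auto
  have "(W \<longlongrightarrow> l) at_top"
  proof (rule decreasing_tendsto)
    show "\<forall>\<^sub>F t in at_top. l \<le> W t" 
      by (rule eventually_mono[OF eventually_ge_at_top[of t0]]) (rule l)
    fix x assume "l < x"
    then obtain s where "t0 \<le> s" "W s < x"
      unfolding l_def using cInf_lessD[of "W ` {t0..}" x] by auto
    then show "\<forall>\<^sub>F t in at_top. W t < x"
      using dec by (intro eventually_mono[OF eventually_ge_at_top[of s]]) (meson order_le_less_trans)
  qed
  then show ?thesis using l by (rule that)
qed

lemma barbalat: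
  fixes W \<phi> :: "real \<Rightarrow> real"
  assumes d: "\<And>a b t. t0 \<le> a \<Longrightarrow> a \<le> t \<Longrightarrow> t \<le> b \<Longrightarrow> (W has_vector_derivative W' t) (at t within {a..b})"
    and le: "\<And>t. t0 \<le> t \<Longrightarrow> W' t \<le> - \<phi> t" and nn: "\<And>t. t0 \<le> t \<Longrightarrow> 0 \<le> \<phi> t"
    and low: "\<And>t. t0 \<le> t \<Longrightarrow> m \<le> W t"
    and lip: "\<And>s t. t0 \<le> s \<Longrightarrow> s \<le> t \<Longrightarrow> \<phi> s - \<phi> t \<le> K * (t - s)"
  shows "(\<phi> \<longlongrightarrow> 0) at_top"
proof -
  have dec: "W t \<le> W s" if "t0 \<le> s" "s \<le> t" for s t
  proof (rule vd_nonincreasing[OF that(2) d[OF that(1)]])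
    show "W' r \<le> 0" if "s \<le> r" for r
      using le[of r] nn[of r] that \<open>t0 \<le> s\<close> by simp
  qed
  obtain l where l: "(W \<longlongrightarrow> l) at_top" "\<And>t. t0 \<le> t \<Longrightarrow> l \<le> W t"
    using nonincreasing_tendsto[of t0 W m] dec low by blast
  show ?thesis
  proof (rule tendstoI)
    fix e :: real assume e: "0 < e"
    define h where "h = e / (2 * (\<bar>K\<bar> + 1))"
    have h: "0 < h" using e by (simp add: h_def)
    have Kh: "K * s \<le> e / 2" if "0 \<le> s" "s \<le> h" for s
    proof -
      have "K * s \<le> (\<bar>K\<bar> + 1) * h" using that by (intro mult_mono) auto
      also have "\<dots> = e / 2" by (simp add: h_def field_simps)
      finally show ?thesis .
    qed
    have "\<forall>\<^sub>F t in at_top. W t < l + h * (e / 2)"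
      using l(1) h e by (intro order_tendstoD(2)[OF l(1)]) simp
    then show "\<forall>\<^sub>F t in at_top. dist (\<phi> t) 0 < e"
      using eventually_ge_at_top[of t0]
    proof eventually_elim
      case (elim t)
      show ?case
      proof (rule ccontr)
        assume "\<not> dist (\<phi> t) 0 < e"
        then have ge: "e \<le> \<phi> t" using nn[of t] elim by simp
        have "W (t + h) + (e / 2) * (t + h) \<le> W t + (e / 2) * t"
        proof (rule vd_nonincreasing[of t "t + h" "\<lambda>s. W s + (e / 2) * s" "\<lambda>s. W' s + e / 2"])
          fix s assume s: "t \<le> s" "s \<le> t + h"
          show "((\<lambda>s. W s + (e / 2) * s) has_vector_derivative W' s + e / 2) (at s within {t..t + h})"
            using elim s by (intro has_vector_derivative_add d) (auto intro!: derivative_eq_intros)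
          have "\<phi> t - \<phi> s \<le> e / 2" using lip[of t s] Kh[of "s - t"] s elim by simp
          then show "W' s + e / 2 \<le> 0" using le[of s] ge elim s by simp
        qed (use h in simp)
        then show False using elim l(2)[of "t + h"] h by (simp add: algebra_simps add_divide_distrib)
      qed
    qed
  qed
qed

lemma infdist_tendsto_zero:
  fixes f :: "'a::metric_space \<Rightarrow> real"
  assumes "compact K" "continuous_on K f" and z: "\<forall>\<^sub>F t in F. z t \<in> K"
    and E: "E \<noteq> {}" "\<And>x. x \<in> K \<Longrightarrow> f x = 0 \<Longrightarrow> x \<in> E" and f: "((\<lambda>t. f (z t)) \<longlongrightarrow> 0) F"
  shows "((\<lambda>t. infdist (z t) E) \<longlongrightarrow> 0) F"
proof (rule tendstoI)
  fix e :: real assume e: "0 < e"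
  define K' where "K' = K \<inter> {x. e \<le> infdist x E}"
  have "compact K'"
    unfolding K'_def by (intro compact_Int_closed assms(1) closed_Collect_le continuous_intros)
  have pos: "0 < \<bar>f x\<bar>" if "x \<in> K'" for x
    using that E e by (auto simp: K'_def)
  have "\<exists>m>0. \<forall>x\<in>K'. m \<le> \<bar>f x\<bar>"
  proof (cases "K' = {}")
    case False
    have "continuous_on K' (\<lambda>x. \<bar>f x\<bar>)"
      by (intro continuous_intros continuous_on_subset[OF assms(2)]) (auto simp: K'_def)
    from continuous_attains_inf[OF \<open>compact K'\<close> False this] show ?thesis using pos by blast
  qed (auto intro: exI[of _ 1])
  then obtain m where m: "0 < m" "\<And>x. x \<in> K' \<Longrightarrow> m \<le> \<bar>f x\<bar>" by blast
  have "\<forall>\<^sub>F t in F. \<bar>f (z t)\<bar> < m" using tendstoD[OF f m(1)] by simp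
  then show "\<forall>\<^sub>F t in F. dist (infdist (z t) E) 0 < e"
    using z
  proof eventually_elim
    case (elim t)
    then have "z t \<notin> K'" using m(2) by force
    then show ?case using elim infdist_nonneg[of "z t" E] by (auto simp: K'_def)
  qed
qed

section \<open>The closed loop\<close>

lemma Amat_split: "Amat \<omega> g t = blockmat (\<lambda>b c. if b = c then - hat (\<omega> t) else 0) + Amat (\<lambda>_. 0) g 0"
  by (auto simp: Amat_def blockmat_def vec_eq_iff hat_explicit forall_3)

lemma bounded_linear_diag_block:
  "bounded_linear (\<lambda>w. blockmat (\<lambda>b c. if b = c then - hat w else 0))"
  unfolding linear_conv_bounded_linear[symmetric]
  by (rule linearI) (auto simp: blockmat_def vec_eq_iff hat_add hat_scaleR)

lemma bounded_linear_Gamma: "bounded_linear (\<lambda>R. Gamma k \<rho> (\<lambda>_. R) 0)"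
  unfolding linear_conv_bounded_linear[symmetric]
  by (rule linearI) (auto simp: Gamma_def blockrow_def vec_eq_iff matrix_algebra algebra_simps)

locale closed_loop =
  fixes \<omega> :: "real \<Rightarrow> real^3" and g :: "real^3" and Rh :: "real \<Rightarrow> real^3^3"
    and C :: "real \<Rightarrow> real^(blk \<times> 3)^'m"
    and kR :: real and \<rho> :: "real^3"
    and Q :: "real \<Rightarrow> real^'m^'m" and V :: "real \<Rightarrow> real^(blk \<times> 3)^(blk \<times> 3)"
    and P :: "real \<Rightarrow> real^(blk \<times> 3)^(blk \<times> 3)"
  assumes \<omega>_cont: "continuous_on {0..} \<omega>" and \<omega>_bdd: "bounded (\<omega> ` {0..})"
    and Rh_cont: "continuous_on {0..} Rh" and Rh_SO3: "\<forall>t\<ge>0. Rh t \<in> SO3"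
    and C_cont: "continuous_on {0..} C" and C_bdd: "bounded (C ` {0..})"
    and obs: "unif_observable (Amat \<omega> g) C"
    and kR_pos: "kR > 0"
    and \<rho>_pos: "\<forall>i. \<rho>$i > 0" and \<rho>_dist: "\<forall>i j. i \<noteq> j \<longrightarrow> \<rho>$i \<noteq> \<rho>$j"
    and Q_cont: "continuous_on {0..} Q" and Q_bdd: "bounded (Q ` {0..})" and Q_pd: "unif_pos_def Q"
    and V_bdd: "bounded (V ` {0..})" and V_pd: "unif_pos_def V"
    and P_ric: "\<forall>t\<ge>0. (P has_vector_derivative
        (Amat \<omega> g t ** P t + P t ** transpose (Amat \<omega> g t)
         - P t ** transpose (C t) ** Q t ** C t ** P t + V t)) (at t within {0..})"
    and P0: "pos_def_mat (P 0)"
begin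

sublocale riccati "Amat \<omega> g" C Q V P
proof
  have eq: "Amat \<omega> g = (\<lambda>t. blockmat (\<lambda>b c. if b = c then - hat (\<omega> t) else 0) + Amat (\<lambda>_. 0) g 0)"
    by (rule ext) (rule Amat_split)
  show "continuous_on {0..} (Amat \<omega> g)"
    unfolding eq by (intro continuous_intros bounded_linear.continuous_on[OF bounded_linear_diag_block] \<omega>_cont)
  have "bounded ((\<lambda>w. blockmat (\<lambda>b c. if b = c then - hat w else 0)) ` \<omega> ` {0..})"
    by (rule bounded_linear_image[OF \<omega>_bdd bounded_linear_diag_block])
  then have "bounded ((\<lambda>x. x + Amat (\<lambda>_. 0) g 0) ` (\<lambda>w. blockmat (\<lambda>b c. if b = c then - hat w else 0)) ` \<omega> ` {0..})"
    using bounded_translation[of _ "Amat (\<lambda>_. 0) g 0"] by (simp add: add.commute)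
  then show "bounded (Amat \<omega> g ` {0..})" by (simp add: eq image_image)
qed (use C_cont C_bdd obs Q_cont Q_bdd Q_pd V_bdd V_pd P_ric P0 in auto)

definition rhs :: "real \<Rightarrow> st15 \<Rightarrow> st15" where
  "rhs t x = Amat \<omega> g t *v x - (P t ** transpose (C t) ** Q t) *v (C t *v x)"

definition inp :: "real \<Rightarrow> st15 \<Rightarrow> real^3" where
  "inp t x = Gamma kR \<rho> Rh t *v x"

lemma Gamma_eq: "Gamma kR \<rho> Rh = (\<lambda>t. Gamma kR \<rho> (\<lambda>_. Rh t) 0)"
  by (rule ext) (simp add: Gamma_def)

lemma Gamma_cont: "continuous_on {0..} (Gamma kR \<rho> Rh)"
  unfolding Gamma_eq by (rule bounded_linear.continuous_on[OF bounded_linear_Gamma Rh_cont])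

lemma inp_bound: obtains \<gamma> where "0 < \<gamma>" "\<And>t x. 0 \<le> t \<Longrightarrow> norm (inp t x) \<le> \<gamma> * norm x"
proof -
  obtain K where K: "0 < K" "\<And>R. norm (Gamma kR \<rho> (\<lambda>_. R) 0) \<le> norm R * K"
    using bounded_linear.pos_bounded[OF bounded_linear_Gamma] by blast
  have "norm (inp t x) \<le> (2 * K) * norm x" if "0 \<le> t" for t x
  proof -
    have "norm (Gamma kR \<rho> Rh t) \<le> norm (Rh t) * K" using K(2)[of "Rh t"] by (simp add: Gamma_eq)
    also have "\<dots> \<le> 2 * K" using K(1) that Rh_SO3 SO3_norm_le by (intro mult_right_mono) auto
    finally show ?thesis
      unfolding inp_def by (intro order_trans[OF norm_matrix_vector_le] mult_right_mono) auto
  qed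
  with K(1) that[of "2 * K"] show ?thesis by simp
qed

lemma inp_diff: "inp t x - inp t y = inp t (x - y)"
  by (simp add: inp_def matrix_vector_mult_diff_distrib)

lemma rhs_diff: "rhs t x - rhs t y = rhs t (x - y)"
  by (simp add: rhs_def matrix_vector_mult_diff_distrib)

definition xsol :: "real \<Rightarrow> real \<Rightarrow> (real \<Rightarrow> st15) \<Rightarrow> bool" where
  "xsol a b x \<longleftrightarrow> (\<forall>t\<in>{a..b}. (x has_vector_derivative rhs t (x t)) (at t within {a..b}))"

lemma xsol_subset: "xsol a b x \<Longrightarrow> a \<le> c \<Longrightarrow> d \<le> b \<Longrightarrow> xsol c d x"
  unfolding xsol_def by (auto intro!: has_vector_derivative_within_subset[of _ _ _ "{a..b}" "{c..d}"])

lemma xsol_diff: "xsol a b x \<Longrightarrow> xsol a b y \<Longrightarrow> xsol a b (\<lambda>t. x t - y t)"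
  unfolding xsol_def by (auto simp: rhs_diff[symmetric] intro: has_vector_derivative_diff)

lemma xsol_cont: "xsol a b x \<Longrightarrow> continuous_on {a..b} x"
  unfolding xsol_def by (rule continuous_on_vd) auto

lemma inp_cont: "0 \<le> a \<Longrightarrow> continuous_on {a..b} x \<Longrightarrow> continuous_on {a..b} (\<lambda>t. inp t (x t))"
  unfolding inp_def by (intro continuous_intros continuous_on_subset[OF Gamma_cont]) auto

lemma xsol_exists:
  assumes "0 \<le> a" "a \<le> b"
  shows "\<exists>x. x a = x0 \<and> xsol a b x"
proof -
  define G where "G = (\<lambda>t. Amat \<omega> g t - P t ** transpose (C t) ** Q t ** C t)"
  have rhs: "rhs t x = G t *v x" for t x
    by (simp add: rhs_def G_def matrix_vector_mult_diff_rdistrib matrix_vector_mul_assoc)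
  have "continuous_on {0..} G"
    unfolding G_def by (intro continuous_intros A_cont P_cont C_cont Q_cont)
  then have cG: "continuous_on {a..b} G" by (rule continuous_on_subset) (use assms in auto)
  then have "bounded (G ` {a..b})"
    by (intro compact_imp_bounded compact_continuous_image) auto
  then obtain K where K: "0 < K" "\<And>t. a \<le> t \<Longrightarrow> t \<le> b \<Longrightarrow> norm (G t) \<le> K"
    unfolding bounded_pos by auto
  show ?thesis
    unfolding xsol_def rhs
  proof (rule linear_ode_exists[OF assms(2) K(1)])
    show "norm (G t *v x) \<le> K * norm x" if "a \<le> t" "t \<le> b" for t x
      using K(2)[OF that] by (intro order_trans[OF norm_matrix_vector_le] mult_right_mono) auto
  qed (auto intro!: continuous_intros cG)
qed

lemma xsol_decay:
  obtains c \<nu> where "0 < c" "0 < \<nu>"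
    "\<And>a b x. 0 \<le> a \<Longrightarrow> a \<le> b \<Longrightarrow> xsol a b x \<Longrightarrow> norm (x b) \<le> c * exp (- \<nu> * (b - a)) * norm (x a)"
proof -
  obtain p1 p2 \<nu> where p: "0 < p1" "0 < p2" "0 < \<nu>"
    "\<And>t x. 0 \<le> t \<Longrightarrow> p1 * (x \<bullet> x) \<le> L t x" "\<And>t x. 0 \<le> t \<Longrightarrow> L t x \<le> p2 * (x \<bullet> x)"
    and d: "\<And>t S x. t \<in> S \<Longrightarrow> S \<subseteq> {0..} \<Longrightarrow>
      (x has_vector_derivative rhs t (x t)) (at t within S) \<Longrightarrow>
      \<exists>d. ((\<lambda>t. L t (x t)) has_vector_derivative d) (at t within S) \<and> d \<le> - \<nu> * L t (x t)"
    unfolding rhs_def by (rule L_estimates) blast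
  have "norm (x b) \<le> sqrt (p2 / p1) * exp (- (\<nu> / 2) * (b - a)) * norm (x a)"
    if ab: "0 \<le> a" "a \<le> b" and x: "xsol a b x" for a b x
  proof -
    have "\<forall>t. t \<in> {a..b} \<longrightarrow> (\<exists>d. ((\<lambda>t. L t (x t)) has_vector_derivative d) (at t within {a..b}) \<and> d \<le> - \<nu> * L t (x t))"
      using x ab d[of _ "{a..b}" x] unfolding xsol_def by auto
    then obtain D where D: "\<And>t. t \<in> {a..b} \<Longrightarrow> ((\<lambda>t. L t (x t)) has_vector_derivative D t) (at t within {a..b}) \<and> D t \<le> - \<nu> * L t (x t)"
      by metis
    have "L b (x b) \<le> exp (- \<nu> * (b - a)) * L a (x a)"
      using D by (intro gronwall_decay[OF ab(2), where f' = D]) auto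
    also have "\<dots> \<le> exp (- \<nu> * (b - a)) * (p2 * (x a \<bullet> x a))"
      using p(5)[of a] ab by (intro mult_left_mono) auto
    finally have "p1 * (x b \<bullet> x b) \<le> exp (- \<nu> * (b - a)) * (p2 * (x a \<bullet> x a))"
      using p(4)[of b "x b"] ab by simp
    then have "(norm (x b))\<^sup>2 \<le> p2 / p1 * exp (- \<nu> * (b - a)) * (norm (x a))\<^sup>2"
      using p(1) by (simp add: power2_norm_eq_inner field_simps)
    also have "exp (- \<nu> * (b - a)) = (exp (- (\<nu> / 2) * (b - a)))\<^sup>2"
      by (simp add: exp_double[symmetric])
    also have "p2 / p1 = (sqrt (p2 / p1))\<^sup>2" using p by simp
    finally have "(norm (x b))\<^sup>2 \<le> (sqrt (p2 / p1) * exp (- (\<nu> / 2) * (b - a)) * norm (x a))\<^sup>2"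
      by (simp only: power_mult_distrib)
    then show ?thesis by (rule power2_le_imp_le) (use p in auto)
  qed
  with p that[of "sqrt (p2 / p1)" "\<nu> / 2"] show ?thesis by simp
qed

lemma xsol_unique:
  assumes "0 \<le> a" "xsol a b x" "xsol a b y" "x a = y a" "a \<le> t" "t \<le> b"
  shows "x t = y t"
proof -
  obtain c \<nu> where c: "\<And>a b x. 0 \<le> a \<Longrightarrow> a \<le> b \<Longrightarrow> xsol a b x \<Longrightarrow> norm (x b) \<le> c * exp (- \<nu> * (b - a)) * norm (x a)"
    by (rule xsol_decay) blast
  have "xsol a t (\<lambda>t. x t - y t)" by (rule xsol_subset[OF xsol_diff[OF assms(2,3)]]) (use assms in auto)
  from c[OF assms(1,5) this] show ?thesis using assms(4) by simp
qed

abbreviation fld :: "real \<Rightarrow> clstate \<Rightarrow> clstate" where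
  "fld \<equiv> cl_field kR \<rho> Rh \<omega> g C Q P"

lemma fld_eq: "fld t z = (att kR \<rho> (inp t (snd z)) (fst z), rhs t (snd z))"
  by (simp add: cl_field_def att_def inp_def rhs_def ang_def Let_def)

lemma solution_components:
  assumes "is_solution fld t0 z" "t0 \<le> t" "S \<subseteq> {t0..}"
  shows "((\<lambda>t. fst (z t)) has_vector_derivative att kR \<rho> (inp t (snd (z t))) (fst (z t))) (at t within S)"
    and "((\<lambda>t. snd (z t)) has_vector_derivative rhs t (snd (z t))) (at t within S)"
proof -
  have d: "(z has_vector_derivative fld t (z t)) (at t within S)"
    using assms by (auto simp: is_solution_def intro: has_vector_derivative_within_subset)
  from bounded_linear.has_vector_derivative[OF bounded_linear_fst d]
    bounded_linear.has_vector_derivative[OF bounded_linear_snd d]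
  show "((\<lambda>t. fst (z t)) has_vector_derivative att kR \<rho> (inp t (snd (z t))) (fst (z t))) (at t within S)"
    and "((\<lambda>t. snd (z t)) has_vector_derivative rhs t (snd (z t))) (at t within S)"
    by (simp_all add: fld_eq)
qed

lemma solution_nonneg: "is_solution fld t0 z \<Longrightarrow> 0 \<le> t0"
  by (simp add: is_solution_def)

lemma solution_xsol: "is_solution fld t0 z \<Longrightarrow> t0 \<le> a \<Longrightarrow> xsol a b (\<lambda>t. snd (z t))"
  unfolding xsol_def by (auto intro: solution_components(2))

lemma solution_SO3:
  assumes "is_solution fld t0 z" "t0 \<le> t"
  shows "fst (z t) \<in> SO3"
proof (rule att_in_SO3[of "{t0..}" t0 t "\<lambda>t. fst (z t)"])
  show "\<exists>w. ((\<lambda>t. fst (z t)) has_vector_derivative fst (z t) ** hat w) (at t within {t0..})" if "t \<in> {t0..}" for t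
    using solution_components(1)[OF assms(1), of t "{t0..}"] that unfolding att_def by auto
qed (use assms in \<open>auto simp: is_solution_def\<close>)

lemma \<rho>_bounds: obtains r s where "0 < r" "r \<le> s" "\<And>i. r \<le> \<rho>$i" "\<And>i. \<rho>$i \<le> s"
proof -
  define r s where "r = Min (range (($) \<rho>))" and "s = Max (range (($) \<rho>))"
  have "r \<in> range (($) \<rho>)" unfolding r_def by (intro Min_in) auto
  then have "0 < r" using \<rho>_pos by auto
  moreover have "r \<le> \<rho>$i" "\<rho>$i \<le> s" for i by (auto simp: r_def s_def)
  ultimately show ?thesis using that[of r s] by (meson order_trans)
qed

lemma pot_nonneg: "R \<in> SO3 \<Longrightarrow> 0 \<le> pot \<rho> R"
  using SO3_diag_le[of R] \<rho>_pos unfolding pot_def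
  by (intro add_nonneg_nonneg mult_nonneg_nonneg) (auto simp: abs_le_iff less_imp_le)

lemma young: "2 * \<bar>x \<bullet> y\<bar> \<le> kR * (x \<bullet> x) + (y \<bullet> y) / kR" for x y :: "real^3"
proof -
  have "0 \<le> (kR *\<^sub>R x + y) \<bullet> (kR *\<^sub>R x + y)" "0 \<le> (kR *\<^sub>R x - y) \<bullet> (kR *\<^sub>R x - y)" by simp_all
  then have "2 * kR * \<bar>x \<bullet> y\<bar> \<le> kR * kR * (x \<bullet> x) + y \<bullet> y"
    by (simp add: inner_add_left inner_add_right inner_diff_left inner_diff_right inner_commute abs_if)
  then show ?thesis using kR_pos by (simp add: field_simps)
qed

lemma energy_decay_rate:
  obtains e \<nu> where "0 < e" "0 < \<nu>"
    "\<And>a b t x. 0 \<le> a \<Longrightarrow> a \<le> t \<Longrightarrow> t \<le> b \<Longrightarrow> xsol a b x \<Longrightarrow>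
      (inp t (x t) \<bullet> inp t (x t)) / kR \<le> \<nu> * (e * (x a \<bullet> x a) * exp (- \<nu> * (t - a)))"
proof -
  obtain c \<nu> where c: "0 < c" "0 < \<nu>"
    "\<And>a b x. 0 \<le> a \<Longrightarrow> a \<le> b \<Longrightarrow> xsol a b x \<Longrightarrow> norm (x b) \<le> c * exp (- \<nu> * (b - a)) * norm (x a)"
    by (rule xsol_decay) blast
  obtain \<gamma> where \<gamma>: "0 < \<gamma>" "\<And>t x. 0 \<le> t \<Longrightarrow> norm (inp t x) \<le> \<gamma> * norm x" by (rule inp_bound) blast
  define e where "e = (\<gamma> * c)\<^sup>2 / (kR * (2 * \<nu>))"
  have "(inp t (x t) \<bullet> inp t (x t)) / kR \<le> 2 * \<nu> * (e * (x a \<bullet> x a) * exp (- (2 * \<nu>) * (t - a)))"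
    if "0 \<le> a" "a \<le> t" "t \<le> b" "xsol a b x" for a b t x
  proof -
    have "norm (inp t (x t)) \<le> \<gamma> * norm (x t)" using that \<gamma> by auto
    also have "\<dots> \<le> \<gamma> * (c * exp (- \<nu> * (t - a)) * norm (x a))"
      using c(3)[OF that(1,2) xsol_subset[OF that(4)]] that \<gamma> by (intro mult_left_mono) auto
    finally have "(norm (inp t (x t)))\<^sup>2 \<le> (\<gamma> * (c * exp (- \<nu> * (t - a)) * norm (x a)))\<^sup>2"
      by (intro power_mono) auto
    also have "\<dots> = (\<gamma> * c)\<^sup>2 * (x a \<bullet> x a) * (exp (- \<nu> * (t - a)))\<^sup>2"
      by (simp add: power_mult_distrib power2_norm_eq_inner mult_ac)
    also have "(exp (- \<nu> * (t - a)))\<^sup>2 = exp (- (2 * \<nu>) * (t - a))"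
      by (simp add: exp_double[symmetric])
    also have "(\<gamma> * c)\<^sup>2 = kR * (2 * \<nu>) * e" using kR_pos c by (simp add: e_def)
    finally show ?thesis using kR_pos by (simp add: power2_norm_eq_inner field_simps)
  qed
  moreover have "0 < e" using \<gamma> c kR_pos by (simp add: e_def)
  ultimately show ?thesis using that[of e "2 * \<nu>"] c by simp
qed

definition ener :: "real \<Rightarrow> real \<Rightarrow> real \<Rightarrow> st15 \<Rightarrow> real \<Rightarrow> real" where
  "ener e \<nu> a x t = e * (x \<bullet> x) * exp (- \<nu> * (t - a))"

lemma ener_vd: "(ener e \<nu> a x has_vector_derivative - \<nu> * ener e \<nu> a x t) (at t within S)"
  unfolding ener_def
  by (auto intro!: derivative_eq_intros simp flip: has_real_derivative_iff_has_vector_derivative)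

lemma ener_nonneg: "0 \<le> e \<Longrightarrow> 0 \<le> ener e \<nu> a x t"
  by (simp add: ener_def)

lemma exp_decay_tendsto: "0 < r \<Longrightarrow> ((\<lambda>t. exp (- r * (t - a))) \<longlongrightarrow> 0) at_top" for r a :: real
  by real_asymp

lemma ener_tendsto: "0 < \<nu> \<Longrightarrow> (ener e \<nu> a x \<longlongrightarrow> 0) at_top"
proof -
  assume "0 < \<nu>"
  from tendsto_mult_left[OF exp_decay_tendsto[OF this], of "e * (x \<bullet> x)"]
  show ?thesis by (simp add: ener_def[abs_def])
qed

definition erate :: "real \<Rightarrow> real \<Rightarrow> bool" where
  "erate e \<nu> \<longleftrightarrow> 0 < e \<and> 0 < \<nu> \<and> (\<forall>a b t x. 0 \<le> a \<longrightarrow> a \<le> t \<longrightarrow> t \<le> b \<longrightarrow> xsol a b x \<longrightarrow>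
      (inp t (x t) \<bullet> inp t (x t)) / kR \<le> \<nu> * ener e \<nu> a (x a) t)"

lemma erate_exists: obtains e \<nu> where "erate e \<nu>"
  using energy_decay_rate unfolding erate_def ener_def by metis

lemma erateD:
  assumes "erate e \<nu>"
  shows "0 < e" "0 < \<nu>"
    and "0 \<le> a \<Longrightarrow> a \<le> t \<Longrightarrow> t \<le> b \<Longrightarrow> xsol a b x \<Longrightarrow>
      (inp t (x t) \<bullet> inp t (x t)) / kR \<le> \<nu> * ener e \<nu> a (x a) t"
  using assms unfolding erate_def by blast+

lemma solution_energy_vd:
  assumes e: "erate e \<nu>" and z: "is_solution fld t0 z" and t: "t0 \<le> t" "S \<subseteq> {t0..}"
  obtains d where "((\<lambda>t. pot \<rho> (fst (z t)) + ener e \<nu> t0 (snd (z t0)) t) has_vector_derivative d) (at t within S)"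
    "d \<le> - kR * (ang \<rho> (fst (z t)) \<bullet> ang \<rho> (fst (z t)))"
proof -
  define u where "u = inp t (snd (z t))"
  define A where "A = ang \<rho> (fst (z t))"
  have "(u \<bullet> u) / kR \<le> \<nu> * ener e \<nu> t0 (snd (z t0)) t"
    unfolding u_def
    by (rule erateD(3)[OF e solution_nonneg[OF z] t(1) order_refl solution_xsol[OF z order_refl]])
  moreover have "((\<lambda>t. pot \<rho> (fst (z t)) + ener e \<nu> t0 (snd (z t0)) t) has_vector_derivative
      ((- 2 * kR * (A \<bullet> A) - 2 * (A \<bullet> u)) + (- \<nu> * ener e \<nu> t0 (snd (z t0)) t))) (at t within S)"
    unfolding A_def u_def
    by (intro has_vector_derivative_add pot_vd ener_vd solution_components(1)[OF z t])
  moreover have "- 2 * (A \<bullet> u) \<le> kR * (A \<bullet> A) + (u \<bullet> u) / kR" using young[of A u] by (simp add: abs_if split: if_splits)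
  ultimately show ?thesis using that unfolding A_def by auto
qed

lemma solution_limits:
  assumes e: "erate e \<nu>" and z: "is_solution fld t0 z"
  shows "((\<lambda>t. ang \<rho> (fst (z t)) \<bullet> ang \<rho> (fst (z t))) \<longlongrightarrow> 0) at_top"
    and "((\<lambda>t. snd (z t)) \<longlongrightarrow> 0) at_top"
    and "\<exists>l. ((\<lambda>t. pot \<rho> (fst (z t))) \<longlongrightarrow> l) at_top \<and> (\<forall>t\<ge>t0. l \<le> pot \<rho> (fst (z t)) + ener e \<nu> t0 (snd (z t0)) t)"
proof -
  define R x where "R = (\<lambda>t. fst (z t))" and "x = (\<lambda>t. snd (z t))"
  have t0: "0 \<le> t0" by (rule solution_nonneg[OF z])
  define W where "W = (\<lambda>t. pot \<rho> (R t) + ener e \<nu> t0 (x t0) t)"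
  have RS: "R t \<in> SO3" if "t0 \<le> t" for t unfolding R_def by (rule solution_SO3[OF z that])
  have W0: "0 \<le> W t" if "t0 \<le> t" for t
    unfolding W_def using pot_nonneg[OF RS[OF that]] e by (auto simp: erate_def intro!: add_nonneg_nonneg ener_nonneg)
  have "\<exists>d. (W has_vector_derivative d) (at t within {t0..}) \<and> d \<le> - kR * (ang \<rho> (R t) \<bullet> ang \<rho> (R t))"
    if "t0 \<le> t" for t
    using solution_energy_vd[OF e z that order_refl] unfolding W_def R_def x_def by blast
  then obtain W' where W': "\<And>t. t0 \<le> t \<Longrightarrow> (W has_vector_derivative W' t) (at t within {t0..})"
    "\<And>t. t0 \<le> t \<Longrightarrow> W' t \<le> - kR * (ang \<rho> (R t) \<bullet> ang \<rho> (R t))" by metis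
  have dW: "(W has_vector_derivative W' t) (at t within {a..b})" if "t0 \<le> a" "a \<le> t" "t \<le> b" for a b t
    using that by (intro has_vector_derivative_within_subset[OF W'(1)]) auto
  obtain c \<kappa> where c: "0 < c" "0 < \<kappa>"
    "\<And>a b x. 0 \<le> a \<Longrightarrow> a \<le> b \<Longrightarrow> xsol a b x \<Longrightarrow> norm (x b) \<le> c * exp (- \<kappa> * (b - a)) * norm (x a)"
    by (rule xsol_decay) blast
  have xb: "norm (x t) \<le> c * exp (- \<kappa> * (t - t0)) * norm (x t0)" if "t0 \<le> t" for t
    unfolding x_def by (rule c(3)[OF t0 that solution_xsol[OF z order_refl]])
  show "((\<lambda>t. snd (z t)) \<longlongrightarrow> 0) at_top"
  proof (rule Lim_null_comparison)
    show "\<forall>\<^sub>F t in at_top. norm (snd (z t)) \<le> c * exp (- \<kappa> * (t - t0)) * norm (x t0)"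
      using eventually_ge_at_top[of t0] by eventually_elim (use xb x_def in auto)
    have "((\<lambda>t. c * exp (- \<kappa> * (t - t0)) * norm (x t0)) \<longlongrightarrow> c * 0 * norm (x t0)) at_top"
      by (intro tendsto_mult tendsto_const exp_decay_tendsto c)
    then show "((\<lambda>t. c * exp (- \<kappa> * (t - t0)) * norm (x t0)) \<longlongrightarrow> 0) at_top" by simp
  qed
  define \<phi> where "\<phi> = (\<lambda>t. kR * (ang \<rho> (R t) \<bullet> ang \<rho> (R t)))"
  define m where "m = norm (diag3 \<rho>)"
  have ang_le: "norm (ang \<rho> X) \<le> m * norm X" for X
    unfolding ang_def m_def by (rule order_trans[OF norm_psi_a_le norm_matrix_mult_le])
  have bl: "bounded_linear (ang \<rho>)"
    unfolding ang_def by (rule bounded_linear_compose[OF bounded_linear_psi_a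
        bounded_bilinear.bounded_linear_right[OF bounded_bilinear_matrix_matrix]])
  obtain \<gamma> where \<gamma>: "0 < \<gamma>" "\<And>t x. 0 \<le> t \<Longrightarrow> norm (inp t x) \<le> \<gamma> * norm x" by (rule inp_bound) blast
  define w where "w = kR * (m * 2) + \<gamma> * (c * norm (x t0))"
  define K where "K = 2 * kR * ((m * 2) * (m * (2 * (2 * w))))"
  have "(\<phi> \<longlongrightarrow> 0) at_top"
  proof (rule barbalat[OF dW])
    show "W' t \<le> - \<phi> t" "0 \<le> \<phi> t" "0 \<le> W t" if "t0 \<le> t" for t
      using W'(2)[OF that] W0[OF that] kR_pos by (auto simp: \<phi>_def)
    fix s t assume st: "t0 \<le> s" "s \<le> t"
    have "- \<phi> t - K * t \<le> - \<phi> s - K * s"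
    proof (rule vd_nonincreasing[OF st(2)])
      fix r assume r: "s \<le> r" "r \<le> t"
      define R' where "R' = att kR \<rho> (inp r (x r)) (R r)"
      have dR: "(R has_vector_derivative R') (at r within {s..t})"
        unfolding R_def R'_def x_def using r st by (intro solution_components(1)[OF z]) auto
      have dA: "((\<lambda>t. ang \<rho> (R t)) has_vector_derivative ang \<rho> R') (at r within {s..t})"
        by (rule bounded_linear.has_vector_derivative[OF bl dR])
      show "((\<lambda>t. - \<phi> t - K * t) has_vector_derivative
          (- (kR * (ang \<rho> (R r) \<bullet> ang \<rho> R' + ang \<rho> R' \<bullet> ang \<rho> (R r))) - K)) (at r within {s..t})"
        unfolding \<phi>_def
        by (intro has_vector_derivative_diff has_vector_derivative_minus has_vector_derivative_mult_right has_vd_inner dA)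
          (auto intro!: derivative_eq_intros)
      have Rr: "norm (R r) \<le> 2" using RS[of r] r st by (simp add: SO3_norm_le)
      have xr: "norm (x r) \<le> c * norm (x t0)"
      proof -
        have "c * exp (- \<kappa> * (r - t0)) * norm (x t0) \<le> c * 1 * norm (x t0)"
          using c r st by (intro mult_right_mono mult_left_mono) auto
        then show ?thesis using xb[of r] r st by simp
      qed
      have m0: "0 \<le> m" by (simp add: m_def)
      have w: "norm (- kR *\<^sub>R ang \<rho> (R r) - inp r (x r)) \<le> w"
      proof -
        have "norm (- kR *\<^sub>R ang \<rho> (R r) - inp r (x r)) \<le> kR * norm (ang \<rho> (R r)) + norm (inp r (x r))"
          using norm_triangle_ineq4[of "- kR *\<^sub>R ang \<rho> (R r)" "inp r (x r)"] kR_pos by simp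
        also have "\<dots> \<le> kR * (m * norm (R r)) + \<gamma> * norm (x r)"
          using kR_pos r st t0 by (intro add_mono mult_left_mono ang_le \<gamma>) auto
        also have "\<dots> \<le> w"
          unfolding w_def using kR_pos \<gamma> m0 Rr xr by (intro add_mono mult_left_mono) auto
        finally show ?thesis .
      qed
      have "norm R' \<le> norm (R r) * (2 * norm (- kR *\<^sub>R ang \<rho> (R r) - inp r (x r)))"
        unfolding R'_def att_def by (intro order_trans[OF norm_matrix_mult_le] mult_left_mono norm_hat_le) auto
      also have "\<dots> \<le> 2 * (2 * w)" using Rr w by (intro mult_mono) auto
      finally have R': "norm R' \<le> 2 * (2 * w)" .
      have "\<bar>ang \<rho> (R r) \<bullet> ang \<rho> R'\<bar> \<le> norm (ang \<rho> (R r)) * norm (ang \<rho> R')" by (rule Cauchy_Schwarz_ineq2)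
      also have "\<dots> \<le> (m * norm (R r)) * (m * norm R')" by (intro mult_mono ang_le) (auto simp: m0)
      also have "\<dots> \<le> (m * 2) * (m * (2 * (2 * w)))"
        using Rr R' m0 by (intro mult_mono) auto
      finally have "kR * \<bar>ang \<rho> (R r) \<bullet> ang \<rho> R'\<bar> \<le> kR * ((m * 2) * (m * (2 * (2 * w))))"
        using kR_pos by (intro mult_left_mono) auto
      moreover have "- (kR * (ang \<rho> (R r) \<bullet> ang \<rho> R')) \<le> kR * \<bar>ang \<rho> (R r) \<bullet> ang \<rho> R'\<bar>"
        using abs_ge_minus_self[of "kR * (ang \<rho> (R r) \<bullet> ang \<rho> R')"] kR_pos by (simp add: abs_mult)
      ultimately show "- (kR * (ang \<rho> (R r) \<bullet> ang \<rho> R' + ang \<rho> R' \<bullet> ang \<rho> (R r))) - K \<le> 0"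
        unfolding K_def inner_commute[of "ang \<rho> R'"] distrib_left by linarith
    qed
    then show "\<phi> s - \<phi> t \<le> K * (t - s)" by (simp add: algebra_simps)
  qed
  from tendsto_mult_left[OF this, of "1 / kR"]
  show "((\<lambda>t. ang \<rho> (fst (z t)) \<bullet> ang \<rho> (fst (z t))) \<longlongrightarrow> 0) at_top"
    using kR_pos by (simp add: \<phi>_def R_def)
  have dec: "W t \<le> W s" if "t0 \<le> s" "s \<le> t" for s t
  proof (rule vd_nonincreasing[OF that(2) dW[OF that(1)]])
    show "W' r \<le> 0" if "s \<le> r" for r
    proof -
      have "0 \<le> kR * (ang \<rho> (R r) \<bullet> ang \<rho> (R r))" using kR_pos by simp
      then show ?thesis using W'(2)[of r] that \<open>t0 \<le> s\<close> by simp
    qed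
  qed
  obtain l where l: "(W \<longlongrightarrow> l) at_top" "\<And>t. t0 \<le> t \<Longrightarrow> l \<le> W t"
    using nonincreasing_tendsto[of t0 W 0] dec W0 by blast
  have "((\<lambda>t. W t - ener e \<nu> t0 (x t0) t) \<longlongrightarrow> l - 0) at_top"
    using e by (intro tendsto_diff l ener_tendsto) (simp add: erate_def)
  then show "\<exists>l. ((\<lambda>t. pot \<rho> (fst (z t))) \<longlongrightarrow> l) at_top \<and> (\<forall>t\<ge>t0. l \<le> pot \<rho> (fst (z t)) + ener e \<nu> t0 (snd (z t0)) t)"
    using l(2) by (auto simp: W_def R_def x_def)
qed

lemma convergence:
  assumes z: "is_solution fld t0 z"
  shows "((\<lambda>t. infdist (z t) ({(mat 1, 0)} \<union> Psi_M (diag3 \<rho>))) \<longlongrightarrow> 0) at_top"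
proof -
  obtain e \<nu> where e: "erate e \<nu>" by (rule erate_exists)
  note lim = solution_limits[OF e z]
  show ?thesis
  proof (rule infdist_tendsto_zero[where K = "SO3 \<times> cball 0 1" and f = "\<lambda>w. ang \<rho> (fst w) \<bullet> ang \<rho> (fst w) + norm (snd w)"])
    show "compact (SO3 \<times> cball 0 1 :: clstate set)" by (intro compact_Times compact_SO3) auto
    show "continuous_on (SO3 \<times> cball 0 1) (\<lambda>w::clstate. ang \<rho> (fst w) \<bullet> ang \<rho> (fst w) + norm (snd w))"
      by (intro continuous_intros)
    have "\<forall>\<^sub>F t in at_top. norm (snd (z t)) < 1" using tendstoD[OF lim(2), of 1] by simp
    then show "\<forall>\<^sub>F t in at_top. z t \<in> SO3 \<times> cball 0 1"
      using eventually_ge_at_top[of t0]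
      by eventually_elim (auto simp: mem_Times_iff solution_SO3[OF z])
    show "((\<lambda>t. ang \<rho> (fst (z t)) \<bullet> ang \<rho> (fst (z t)) + norm (snd (z t))) \<longlongrightarrow> 0) at_top"
      using tendsto_add[OF lim(1) tendsto_norm[OF lim(2)]] by simp
  next
    fix w :: clstate
    assume w: "w \<in> SO3 \<times> cball 0 1" "ang \<rho> (fst w) \<bullet> ang \<rho> (fst w) + norm (snd w) = 0"
    have "ang \<rho> (fst w) \<bullet> ang \<rho> (fst w) = 0" "norm (snd w) = 0"
      using w(2) inner_ge_zero[of "ang \<rho> (fst w)"] norm_ge_zero[of "snd w"] by linarith+
    then have "ang \<rho> (fst w) = 0" "snd w = 0" by auto
    moreover have "fst w = mat 1 \<or> (\<exists>v\<in>unit_eigvecs (diag3 \<rho>). fst w = rot_axis pi v)"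
      using w(1) \<rho>_pos \<rho>_dist \<open>ang \<rho> (fst w) = 0\<close> by (intro ang_zero) auto
    ultimately show "w \<in> {(mat 1, 0)} \<union> Psi_M (diag3 \<rho>)"
      by (cases w) (auto simp: Psi_M_def)
  qed simp
qed

lemma local_exponential_stability: "loc_exp_stable fld (mat 1, 0)"
proof -
  obtain p1 p2 \<nu> where p: "0 < p1" "0 < p2" "0 < \<nu>"
    "\<And>t x. 0 \<le> t \<Longrightarrow> p1 * (x \<bullet> x) \<le> L t x" "\<And>t x. 0 \<le> t \<Longrightarrow> L t x \<le> p2 * (x \<bullet> x)"
    and dL: "\<And>t S x. t \<in> S \<Longrightarrow> S \<subseteq> {0..} \<Longrightarrow>
      (x has_vector_derivative rhs t (x t)) (at t within S) \<Longrightarrow>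
      \<exists>d. ((\<lambda>t. L t (x t)) has_vector_derivative d) (at t within S) \<and> d \<le> - \<nu> * L t (x t)"
    unfolding rhs_def by (rule L_estimates) blast
  obtain \<gamma> where \<gamma>: "0 < \<gamma>" "\<And>t x. 0 \<le> t \<Longrightarrow> norm (inp t x) \<le> \<gamma> * norm x" by (rule inp_bound) blast
  obtain r s where rs: "0 < r" "r \<le> s" "\<And>i. r \<le> \<rho>$i" "\<And>i. \<rho>$i \<le> s" by (rule \<rho>_bounds) blast
  have s: "0 < s" using rs by simp
  define \<beta> where "\<beta> = 2 * (\<gamma>\<^sup>2 / (kR * p1)) / \<nu>"
  have \<beta>: "0 < \<beta>" using \<gamma> kR_pos p by (simp add: \<beta>_def)
  define e1 where "e1 = min 1 (r\<^sup>2 / s\<^sup>2)"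
  have e1: "0 < e1" "e1 \<le> 1" "s\<^sup>2 * e1 \<le> r\<^sup>2"
  proof -
    have "s\<^sup>2 * e1 \<le> s\<^sup>2 * (r\<^sup>2 / s\<^sup>2)" by (intro mult_left_mono) (auto simp: e1_def)
    then show "s\<^sup>2 * e1 \<le> r\<^sup>2" using s by simp
  qed (use rs s in \<open>auto simp: e1_def\<close>)
  define Cw cw where "Cw = s + \<beta> * p2" and "cw = min (r / 2) (\<beta> * p1)"
  have Cw: "0 < Cw" "0 < cw" using s \<beta> p rs by (auto simp: Cw_def cw_def add_pos_pos)
  define \<kappa> where "\<kappa> = min (kR * r\<^sup>2 / (8 * s)) (\<nu> / 2)"
  have \<kappa>: "0 < \<kappa>" using kR_pos rs s p by (auto simp: \<kappa>_def)
  define W where "W = (\<lambda>t z. pot \<rho> (fst z) + \<beta> * L t (snd z))"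
  have dist2: "(dist z (mat 1, 0))\<^sup>2 = 2 * (3 - trace (fst z)) + snd z \<bullet> snd z" if "fst z \<in> SO3" for z :: clstate
  proof -
    have "(dist z (mat 1, 0))\<^sup>2 = (norm (fst z - mat 1))\<^sup>2 + (norm (snd z))\<^sup>2"
      by (simp add: dist_prod_def dist_norm)
    then show ?thesis by (simp only: norm_SO3_minus_id[OF that] power2_norm_eq_inner[of "snd z"])
  qed
  have W_up: "W t z \<le> Cw * (dist z (mat 1, 0))\<^sup>2" if "0 \<le> t" "fst z \<in> SO3" for t z
  proof -
    have "0 \<le> 3 - trace (fst z)" using norm_SO3_minus_id[OF that(2)] by (metis mult_2 zero_le_power2 zero_le_double_add_iff_zero_le_single_add)
    then have "s * (3 - trace (fst z)) \<le> (2 * Cw) * (3 - trace (fst z))"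
      using s \<beta> p by (intro mult_right_mono) (auto simp: Cw_def)
    then have "pot \<rho> (fst z) \<le> Cw * (2 * (3 - trace (fst z)))"
      using pot_bounds(2)[OF that(2) rs(3,4)] by linarith
    moreover have "\<beta> * L t (snd z) \<le> Cw * (snd z \<bullet> snd z)"
    proof -
      have "\<beta> * L t (snd z) \<le> \<beta> * (p2 * (snd z \<bullet> snd z))" using p(5)[OF that(1)] \<beta> by (intro mult_left_mono) auto
      also have "\<dots> \<le> Cw * (snd z \<bullet> snd z)"
        unfolding mult.assoc[symmetric] using s by (intro mult_right_mono) (auto simp: Cw_def)
      finally show ?thesis .
    qed
    ultimately show ?thesis by (simp add: W_def dist2[OF that(2)] distrib_left)
  qed
  have W_low: "cw * (dist z (mat 1, 0))\<^sup>2 \<le> W t z" if "0 \<le> t" "fst z \<in> SO3" for t z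
  proof -
    have "0 \<le> 3 - trace (fst z)" using norm_SO3_minus_id[OF that(2)] by (metis mult_2 zero_le_power2 zero_le_double_add_iff_zero_le_single_add)
    then have "(2 * cw) * (3 - trace (fst z)) \<le> r * (3 - trace (fst z))"
      by (intro mult_right_mono) (auto simp: cw_def)
    then have "cw * (2 * (3 - trace (fst z))) \<le> r * (3 - trace (fst z))" by linarith
    also have "\<dots> \<le> pot \<rho> (fst z)" by (rule pot_bounds(1)[OF that(2) rs(3,4)])
    finally have "cw * (2 * (3 - trace (fst z))) \<le> pot \<rho> (fst z)" .
    moreover have "cw * (snd z \<bullet> snd z) \<le> \<beta> * L t (snd z)"
    proof -
      have "cw * (snd z \<bullet> snd z) \<le> (\<beta> * p1) * (snd z \<bullet> snd z)" by (intro mult_right_mono) (auto simp: cw_def)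
      also have "\<dots> \<le> \<beta> * L t (snd z)"
        unfolding mult.assoc using p(4)[OF that(1)] \<beta> by (intro mult_left_mono) auto
      finally show ?thesis .
    qed
    ultimately show ?thesis by (simp add: W_def dist2[OF that(2)] distrib_left)
  qed
  define \<delta> where "\<delta> = sqrt (r * e1 / Cw)"
  have \<delta>: "0 < \<delta>" "Cw * \<delta>\<^sup>2 = r * e1" using Cw rs e1 by (auto simp: \<delta>_def)
  have "dist (z t) (mat 1, 0) \<le> sqrt (Cw / cw) * exp (- (\<kappa> / 2) * (t - t0)) * dist (z t0) (mat 1, 0)"
    if z: "is_solution fld t0 z" and small: "dist (z t0) (mat 1, 0) < \<delta>" and t: "t0 \<le> t" for t0 t z
  proof -
    have t0: "0 \<le> t0" by (rule solution_nonneg[OF z])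
    have SO: "fst (z \<tau>) \<in> SO3" if "t0 \<le> \<tau>" for \<tau> by (rule solution_SO3[OF z that])
    define A where "A = (\<lambda>\<tau>. ang \<rho> (fst (z \<tau>)))"
    have "\<exists>d. ((\<lambda>\<tau>. W \<tau> (z \<tau>)) has_vector_derivative d) (at \<tau> within {t0..}) \<and>
        d \<le> - kR * (A \<tau> \<bullet> A \<tau>) - (\<nu> / 2) * (\<beta> * L \<tau> (snd (z \<tau>)))" if \<tau>: "t0 \<le> \<tau>" for \<tau>
    proof -
      define u where "u = inp \<tau> (snd (z \<tau>))"
      obtain d where d: "((\<lambda>t. L t (snd (z t))) has_vector_derivative d) (at \<tau> within {t0..})" "d \<le> - \<nu> * L \<tau> (snd (z \<tau>))"
        using dL[of \<tau> "{t0..}" "\<lambda>t. snd (z t)"] solution_components(2)[OF z \<tau> order_refl] \<tau> t0 by auto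
      have "((\<lambda>\<tau>. W \<tau> (z \<tau>)) has_vector_derivative ((- 2 * kR * (A \<tau> \<bullet> A \<tau>) - 2 * (A \<tau> \<bullet> u)) + \<beta> * d))
          (at \<tau> within {t0..})"
        unfolding W_def A_def u_def
        by (intro has_vector_derivative_add pot_vd has_vector_derivative_mult_right d solution_components(1)[OF z \<tau> order_refl])
      moreover have "- 2 * (A \<tau> \<bullet> u) \<le> kR * (A \<tau> \<bullet> A \<tau>) + (u \<bullet> u) / kR"
        using young[of "A \<tau>" u] by (simp add: abs_if split: if_splits)
      moreover have "(u \<bullet> u) / kR \<le> (\<nu> / 2) * (\<beta> * L \<tau> (snd (z \<tau>)))"
      proof -
        have "u \<bullet> u \<le> (\<gamma> * norm (snd (z \<tau>)))\<^sup>2"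
          unfolding u_def power2_norm_eq_inner[symmetric] using \<gamma>(2)[of \<tau>] \<tau> t0 by (intro power_mono) auto
        also have "\<dots> = \<gamma>\<^sup>2 / p1 * (p1 * (snd (z \<tau>) \<bullet> snd (z \<tau>)))"
          using p by (simp add: power_mult_distrib power2_norm_eq_inner)
        also have "\<dots> \<le> \<gamma>\<^sup>2 / p1 * L \<tau> (snd (z \<tau>))"
          using p \<tau> t0 by (intro mult_left_mono) auto
        finally have "(u \<bullet> u) / kR \<le> \<gamma>\<^sup>2 / p1 * L \<tau> (snd (z \<tau>)) / kR"
          using kR_pos by (intro divide_right_mono) auto
        also have "\<dots> = (\<nu> / 2) * (\<beta> * L \<tau> (snd (z \<tau>)))"
          using p by (simp add: \<beta>_def)
        finally show ?thesis .
      qed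
      moreover have "\<beta> * d \<le> \<beta> * (- \<nu> * L \<tau> (snd (z \<tau>)))" using d(2) \<beta> by (intro mult_left_mono) auto
      moreover have "\<beta> * (- \<nu> * L \<tau> (snd (z \<tau>))) = - 2 * ((\<nu> / 2) * (\<beta> * L \<tau> (snd (z \<tau>))))" by simp
      ultimately show ?thesis by (intro exI conjI) (assumption, linarith)
    qed
    then obtain W' where W': "\<And>\<tau>. t0 \<le> \<tau> \<Longrightarrow> ((\<lambda>\<tau>. W \<tau> (z \<tau>)) has_vector_derivative W' \<tau>) (at \<tau> within {t0..})"
      "\<And>\<tau>. t0 \<le> \<tau> \<Longrightarrow> W' \<tau> \<le> - kR * (A \<tau> \<bullet> A \<tau>) - (\<nu> / 2) * (\<beta> * L \<tau> (snd (z \<tau>)))" by metis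
    have dW: "((\<lambda>\<tau>. W \<tau> (z \<tau>)) has_vector_derivative W' \<tau>) (at \<tau> within {t0..b})" if "t0 \<le> \<tau>" "\<tau> \<le> b" for \<tau> b
      using that by (intro has_vector_derivative_within_subset[OF W'(1)]) auto
    have L0: "0 \<le> \<beta> * L \<tau> (snd (z \<tau>))" if "t0 \<le> \<tau>" for \<tau>
    proof -
      have "0 \<le> p1 * (snd (z \<tau>) \<bullet> snd (z \<tau>))" using p by simp
      then show ?thesis using p(4)[of \<tau> "snd (z \<tau>)"] that t0 \<beta> by simp
    qed
    have kA: "0 \<le> kR * (A \<tau> \<bullet> A \<tau>)" for \<tau> using kR_pos by simp
    have W'0: "W' \<tau> \<le> 0" if "t0 \<le> \<tau>" for \<tau>
      using W'(2)[OF that] kA[of \<tau>] mult_nonneg_nonneg[OF _ L0[OF that], of "\<nu> / 2"] p(3) by simp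
    have "W t0 (z t0) \<le> Cw * (dist (z t0) (mat 1, 0))\<^sup>2" by (rule W_up[OF t0 SO[OF order_refl]])
    also have "\<dots> \<le> Cw * \<delta>\<^sup>2" using small Cw by (intro mult_left_mono power_mono) auto
    finally have Wt0: "W t0 (z t0) \<le> r * e1" using \<delta> by simp
    have rate: "W' \<tau> \<le> - \<kappa> * W \<tau> (z \<tau>)" if \<tau>: "t0 \<le> \<tau>" for \<tau>
    proof -
      have "W \<tau> (z \<tau>) \<le> W t0 (z t0)"
        by (rule vd_nonincreasing[OF \<tau> dW W'0]) auto
      then have "pot \<rho> (fst (z \<tau>)) \<le> r * e1" using Wt0 L0[OF \<tau>] by (simp add: W_def)
      then have "r * (3 - trace (fst (z \<tau>))) \<le> r * e1"
        using pot_bounds(1)[OF SO[OF \<tau>] rs(3,4)] by simp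
      then have e: "3 - trace (fst (z \<tau>)) \<le> e1" using rs(1) by simp
      have "r\<^sup>2 * (3 - trace (fst (z \<tau>))) \<le> 8 * (A \<tau> \<bullet> A \<tau>)"
        unfolding A_def
      proof (rule ang_lower_bound[OF SO[OF \<tau>] rs(1,3,4)])
        show "3 - trace (fst (z \<tau>)) \<le> 1" using e e1 by simp
        show "s\<^sup>2 * (3 - trace (fst (z \<tau>))) \<le> r\<^sup>2"
          using mult_left_mono[OF e, of "s\<^sup>2"] e1 by simp
      qed
      moreover have "pot \<rho> (fst (z \<tau>)) / s \<le> 3 - trace (fst (z \<tau>))"
        using pot_bounds(2)[OF SO[OF \<tau>] rs(3,4)] s by (simp add: field_simps)
      then have "r\<^sup>2 * (pot \<rho> (fst (z \<tau>)) / s) \<le> r\<^sup>2 * (3 - trace (fst (z \<tau>)))" by (intro mult_left_mono) auto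
      ultimately have "kR / 8 * (r\<^sup>2 * (pot \<rho> (fst (z \<tau>)) / s)) \<le> kR / 8 * (8 * (A \<tau> \<bullet> A \<tau>))"
        using kR_pos by (intro mult_left_mono) auto
      then have "kR * r\<^sup>2 / (8 * s) * pot \<rho> (fst (z \<tau>)) \<le> kR * (A \<tau> \<bullet> A \<tau>)" by (simp add: field_simps)
      moreover have "\<kappa> * pot \<rho> (fst (z \<tau>)) \<le> kR * r\<^sup>2 / (8 * s) * pot \<rho> (fst (z \<tau>))"
        using pot_nonneg[OF SO[OF \<tau>]] by (intro mult_right_mono) (auto simp: \<kappa>_def)
      moreover have "\<kappa> * (\<beta> * L \<tau> (snd (z \<tau>))) \<le> (\<nu> / 2) * (\<beta> * L \<tau> (snd (z \<tau>)))"
        using L0[OF \<tau>] by (intro mult_right_mono) (auto simp: \<kappa>_def)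
      moreover have "\<kappa> * W \<tau> (z \<tau>) = \<kappa> * pot \<rho> (fst (z \<tau>)) + \<kappa> * (\<beta> * L \<tau> (snd (z \<tau>)))"
        by (simp add: W_def distrib_left)
      ultimately show ?thesis using W'(2)[OF \<tau>] by linarith
    qed
    have "cw * (dist (z t) (mat 1, 0))\<^sup>2 \<le> W t (z t)" by (rule W_low) (use t t0 SO in auto)
    also have "\<dots> \<le> exp (- \<kappa> * (t - t0)) * W t0 (z t0)"
      by (rule gronwall_decay[OF t dW rate])
    also have "\<dots> \<le> exp (- \<kappa> * (t - t0)) * (Cw * (dist (z t0) (mat 1, 0))\<^sup>2)"
      by (intro mult_left_mono W_up[OF t0 SO]) auto
    finally have "(dist (z t) (mat 1, 0))\<^sup>2 \<le> Cw / cw * exp (- \<kappa> * (t - t0)) * (dist (z t0) (mat 1, 0))\<^sup>2"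
      using Cw by (simp add: field_simps)
    also have "exp (- \<kappa> * (t - t0)) = (exp (- (\<kappa> / 2) * (t - t0)))\<^sup>2" by (simp add: exp_double[symmetric])
    also have "Cw / cw = (sqrt (Cw / cw))\<^sup>2" using Cw by simp
    finally have "(dist (z t) (mat 1, 0))\<^sup>2 \<le> (sqrt (Cw / cw) * exp (- (\<kappa> / 2) * (t - t0)) * dist (z t0) (mat 1, 0))\<^sup>2"
      by (simp only: power_mult_distrib)
    then show ?thesis by (rule power2_le_imp_le) (use Cw in auto)
  qed
  then show ?thesis
    unfolding loc_exp_stable_def
    using \<delta> Cw \<kappa> by (intro exI[of _ \<delta>] conjI exI[of _ "sqrt (Cw / cw)"] exI[of _ "\<kappa> / 2"]) auto
qed

lemma stable: "lyap_stable fld (mat 1, 0)"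
proof -
  obtain \<delta> c r where d: "0 < \<delta>" "0 < c" "0 < r"
    "\<And>t0 z t. is_solution fld t0 z \<Longrightarrow> dist (z t0) (mat 1, 0) < \<delta> \<Longrightarrow> t0 \<le> t \<Longrightarrow>
      dist (z t) (mat 1, 0) \<le> c * exp (- r * (t - t0)) * dist (z t0) (mat 1, 0)"
    using local_exponential_stability unfolding loc_exp_stable_def by metis
  show ?thesis
    unfolding lyap_stable_def
  proof (intro allI impI)
    fix t0 \<epsilon> :: real assume "0 \<le> t0" "0 < \<epsilon>"
    have "dist (z t) (mat 1, 0) < \<epsilon>"
      if z: "is_solution fld t0 z" "dist (z t0) (mat 1, 0) < min \<delta> (\<epsilon> / c)" "t0 \<le> t" for z t
    proof -
      have "dist (z t) (mat 1, 0) \<le> c * exp (- r * (t - t0)) * dist (z t0) (mat 1, 0)" using d(4) z by auto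
      also have "\<dots> \<le> c * 1 * dist (z t0) (mat 1, 0)"
        using d z by (intro mult_right_mono mult_left_mono) auto
      also have "\<dots> < \<epsilon>" using z(2) d(2) by (simp add: field_simps)
      finally show ?thesis .
    qed
    then show "\<exists>\<delta>>0. \<forall>z. is_solution fld t0 z \<and> dist (z t0) (mat 1, 0) < \<delta> \<longrightarrow> (\<forall>t\<ge>t0. dist (z t) (mat 1, 0) < \<epsilon>)"
      using d \<open>0 < \<epsilon>\<close> by (intro exI[of _ "min \<delta> (\<epsilon> / c)"]) auto
  qed
qed

lemma Psi_M_equilibrium:
  assumes "p \<in> Psi_M (diag3 \<rho>)"
  shows "equilibrium fld p"
proof -
  obtain v where v: "v \<in> unit_eigvecs (diag3 \<rho>)" "p = (rot_axis pi v, 0)" using assms by (auto simp: Psi_M_def)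
  obtain c where "diag3 \<rho> *v v = c *\<^sub>R v" using v(1) by (auto simp: unit_eigvecs_def)
  then have "ang \<rho> (rot_axis pi v) = 0" using ang_rot_axis[of \<rho> v c pi] by simp
  then have "fld t p = 0" for t
    by (simp add: fld_eq v(2) att_def inp_def rhs_def hat_explicit zero_prod_def)
      (simp add: mat3_simps)
  then show ?thesis by (simp add: equilibrium_def)
qed

lemma Psi_M_unstable:
  assumes "p \<in> Psi_M (diag3 \<rho>)"
  shows "\<not> lyap_stable fld p"
proof
  assume st: "lyap_stable fld p"
  obtain v where v: "v \<in> unit_eigvecs (diag3 \<rho>)" and p: "p = (rot_axis pi v, 0)" using assms by (auto simp: Psi_M_def)
  have nv: "norm v = 1" using v by (simp add: unit_eigvecs_def)
  obtain b where b: "0 < b" "\<And>\<sigma> t S. ((\<lambda>t. rot_axis (pi - 2 * arctan (\<sigma> * exp (b * t))) v) has_vector_derivative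
      att kR \<rho> 0 (rot_axis (pi - 2 * arctan (\<sigma> * exp (b * t))) v)) (at t within S)"
    using escaping_rotation[OF v _ kR_pos] \<rho>_pos by blast
  define \<epsilon> where "\<epsilon> = dist (rot_axis (pi / 2) v, 0 :: st15) p"
  have "trace (rot_axis \<theta> v) = 1 + 2 * cos \<theta>" for \<theta>
  proof -
    have "v$1 * v$1 + v$2 * v$2 + v$3 * v$3 = 1" using nv by (simp add: norm_eq_1 inner_vec_def sum_3)
    moreover have "trace (rot_axis \<theta> v) = 3 - 2 * (1 - cos \<theta>) * (v$1 * v$1 + v$2 * v$2 + v$3 * v$3)"
      by (simp add: rot_axis_def trace_def mat3_simps algebra_simps)
    ultimately show ?thesis by simp
  qed
  from this[of "pi / 2"] this[of pi] have "rot_axis (pi / 2) v \<noteq> rot_axis pi v" by auto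
  then have "0 < \<epsilon>" by (simp add: \<epsilon>_def p)
  then obtain \<delta> where \<delta>: "0 < \<delta>"
    "\<And>z t. is_solution fld 0 z \<Longrightarrow> dist (z 0) p < \<delta> \<Longrightarrow> 0 \<le> t \<Longrightarrow> dist (z t) p < \<epsilon>"
    using st unfolding lyap_stable_def by (metis order_refl)
  define z where "z = (\<lambda>\<sigma> t. (rot_axis (pi - 2 * arctan (\<sigma> * exp (b * t))) v, 0 :: st15))"
  have sol: "is_solution fld 0 (z \<sigma>)" for \<sigma>
    unfolding is_solution_def
  proof (intro conjI allI impI)
    show "fst (z \<sigma> 0) \<in> SO3" by (simp add: z_def rot_axis_SO3[OF nv])
    fix t :: real
    have "(z \<sigma> has_vector_derivative (att kR \<rho> 0 (fst (z \<sigma> t)), 0)) (at t within {0..})"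
      unfolding z_def using b(2)[of \<sigma> t "{0..}"] by (intro has_vector_derivative_Pair) auto
    then show "(z \<sigma> has_vector_derivative fld t (z \<sigma> t)) (at t within {0..})"
      by (simp add: fld_eq) (simp add: z_def inp_def rhs_def)
  qed simp
  have "((\<lambda>\<sigma>. z \<sigma> 0) \<longlongrightarrow> (rot_axis (pi - 2 * arctan (0 * exp (b * 0))) v, 0)) (at_right 0)"
    unfolding z_def rot_axis_def by (intro tendsto_intros)
  then have "((\<lambda>\<sigma>. z \<sigma> 0) \<longlongrightarrow> p) (at_right 0)" by (simp add: p)
  then have "\<forall>\<^sub>F \<sigma> in at_right 0. dist (z \<sigma> 0) p < \<delta>" by (rule tendstoD[OF _ \<delta>(1)])
  moreover have "\<forall>\<^sub>F \<sigma> in at_right 0. \<sigma> \<in> {0<..<1::real}" by (rule eventually_at_right_real) simp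
  ultimately obtain \<sigma> where \<sigma>: "dist (z \<sigma> 0) p < \<delta>" "0 < \<sigma>" "\<sigma> < 1"
    using eventually_happens[OF eventually_conj] trivial_limit_at_right_real by fastforce
  define t where "t = - ln \<sigma> / b"
  have "0 \<le> t" using \<sigma> b by (simp add: t_def divide_nonpos_pos)
  have "\<sigma> * exp (b * t) = 1" using \<sigma> b by (simp add: t_def exp_minus)
  then have "z \<sigma> t = (rot_axis (pi / 2) v, 0)" by (simp add: z_def arctan_one)
  then have "dist (z \<sigma> t) p = \<epsilon>" by (simp add: \<epsilon>_def)
  with \<delta>(2)[OF sol \<sigma>(1) \<open>0 \<le> t\<close>] show False by simp
qed

section \<open>The exceptional initial conditions\<close>

text \<open>A solution can fail to converge to the identity only if \<open>det (1 + R S\<^sup>T) \<rightarrow> 0\<close> at the initial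
  time, where \<open>S\<close> is the companion on \<open>[a, b]\<close> and \<open>b \<rightarrow> \<infinity>\<close>.\<close>

definition companion :: "real \<Rightarrow> real \<Rightarrow> st15 \<Rightarrow> (real \<Rightarrow> real^3^3) \<Rightarrow> bool" where
  "companion a b x0 S \<longleftrightarrow> S b = mat 1 \<and> (\<exists>x. x a = x0 \<and> xsol a b x \<and>
    (\<forall>t\<in>{a..b}. S t \<in> SO3 \<and> (S has_vector_derivative att (- kR) \<rho> (inp t (x t)) (S t)) (at t within {a..b})))"

lemma companion_exists:
  assumes "0 \<le> a" "a \<le> b"
  shows "\<exists>S. companion a b x0 S"
proof -
  obtain x where x: "x a = x0" "xsol a b x" using xsol_exists[OF assms] by blast
  show ?thesis
    using att_exists_backward[OF assms(2) inp_cont[OF assms(1) xsol_cont[OF x(2)]], of "- kR" \<rho>] x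
    unfolding companion_def by blast
qed

lemma companion_start_continuous:
  assumes ab: "0 \<le> a" "a \<le> b" and S: "\<And>x0. companion a b x0 (S x0)"
  shows "continuous_on UNIV (\<lambda>x0. S x0 a)"
  unfolding continuous_on_eq_continuous_at[OF open_UNIV]
proof
  fix x0 :: st15
  obtain x where x: "x a = x0" "xsol a b x" and S0: "S x0 b = mat 1"
    "\<And>t. t \<in> {a..b} \<Longrightarrow> S x0 t \<in> SO3"
    "\<And>t. t \<in> {a..b} \<Longrightarrow> (S x0 has_vector_derivative att (- kR) \<rho> (inp t (x t)) (S x0 t)) (at t within {a..b})"
    using S[of x0] unfolding companion_def by blast
  obtain c \<nu> where c: "0 < c" "0 < \<nu>"
    "\<And>a b x. 0 \<le> a \<Longrightarrow> a \<le> b \<Longrightarrow> xsol a b x \<Longrightarrow> norm (x b) \<le> c * exp (- \<nu> * (b - a)) * norm (x a)"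
    by (rule xsol_decay) blast
  obtain \<gamma> where \<gamma>: "0 < \<gamma>" "\<And>t x. 0 \<le> t \<Longrightarrow> norm (inp t x) \<le> \<gamma> * norm x" by (rule inp_bound) blast
  have ub: "norm (inp t (y t)) \<le> \<gamma> * c * norm (y a)" if "t \<in> {a..b}" "xsol a b y" for t y
  proof -
    have "norm (inp t (y t)) \<le> \<gamma> * norm (y t)" using \<gamma>(2)[of t] that ab by auto
    also have "norm (y t) \<le> c * exp (- \<nu> * (t - a)) * norm (y a)"
      using that by (intro c(3)[OF ab(1) _ xsol_subset[OF that(2)]]) auto
    also have "\<dots> \<le> c * 1 * norm (y a)" using c that by (intro mult_right_mono mult_left_mono) auto
    finally show ?thesis using \<gamma>(1) by (simp add: mult.assoc mult_left_mono)
  qed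
  define K where "K = 8 * kR * norm (diag3 \<rho>) + 2 * (\<gamma> * c * norm x0)"
  have K: "0 \<le> K" using kR_pos \<gamma>(1) c(1) by (simp add: K_def)
  define G where "G = sqrt (exp ((2 * K + 1) * (b - a)) * (16 * (\<gamma> * c)\<^sup>2 * (b - a)))"
  have G: "0 \<le> G" using ab by (simp add: G_def)
  have "norm (S y0 a - S x0 a) \<le> G * norm (y0 - x0)" for y0
  proof -
    obtain y where y: "y a = y0" "xsol a b y" and S1: "S y0 b = mat 1"
      "\<And>t. t \<in> {a..b} \<Longrightarrow> S y0 t \<in> SO3"
      "\<And>t. t \<in> {a..b} \<Longrightarrow> (S y0 has_vector_derivative att (- kR) \<rho> (inp t (y t)) (S y0 t)) (at t within {a..b})"
      using S[of y0] unfolding companion_def by blast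
    define D D' where "D = (\<lambda>t. S x0 t - S y0 t)"
      and "D' = (\<lambda>t. att (- kR) \<rho> (inp t (x t)) (S x0 t) - att (- kR) \<rho> (inp t (y t)) (S y0 t))"
    define d where "d = \<gamma> * c * norm (x0 - y0)"
    have "D a \<bullet> D a \<le> exp ((2 * K + 1) * (b - a)) * (D b \<bullet> D b + (16 * d\<^sup>2) * (b - a))"
    proof (rule gronwall_backward[OF ab(2), where f' = "\<lambda>t. D t \<bullet> D' t + D' t \<bullet> D t"])
      fix t assume "a \<le> t" "t \<le> b"
      then have t: "t \<in> {a..b}" by simp
      show "((\<lambda>t. D t \<bullet> D t) has_vector_derivative D t \<bullet> D' t + D' t \<bullet> D t) (at t within {a..b})"
        unfolding D_def D'_def by (intro has_vd_inner has_vector_derivative_diff S0 S1 t)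
      have "norm (inp t (x t) - inp t (y t)) \<le> d"
        using ub[OF t xsol_diff[OF x(2) y(2)]] by (simp add: inp_diff d_def x(1) y(1))
      moreover have "norm (D' t) \<le> K * norm (D t) + 4 * norm (inp t (x t) - inp t (y t))"
        unfolding D'_def D_def K_def using ub[OF t x(2)] S0(2)[OF t] S1(2)[OF t] kR_pos
        by (intro att_diff_le SO3_norm_le) (auto simp: x(1))
      ultimately have n: "norm (D' t) \<le> K * norm (D t) + 4 * d" by linarith
      have "- (D t \<bullet> D' t) \<le> norm (D t) * norm (D' t)"
        using norm_cauchy_schwarz[of "- D t" "D' t"] by simp
      also have "\<dots> \<le> norm (D t) * (K * norm (D t) + 4 * d)" by (intro mult_left_mono n) auto
      also have "2 * (norm (D t) * (K * norm (D t) + 4 * d)) \<le> (2 * K + 1) * (norm (D t))\<^sup>2 + 16 * d\<^sup>2"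
        using zero_le_power2[of "norm (D t) - 4 * d"] by (simp add: power2_eq_square algebra_simps)
      finally show "- (D t \<bullet> D' t + D' t \<bullet> D t) \<le> (2 * K + 1) * (D t \<bullet> D t) + 16 * d\<^sup>2"
        by (simp add: power2_norm_eq_inner inner_commute)
    qed (use K in auto)
    also have "D b = 0" by (simp add: D_def S0 S1)
    finally have "(norm (D a))\<^sup>2 \<le> exp ((2 * K + 1) * (b - a)) * (16 * d\<^sup>2 * (b - a))"
      by (simp add: power2_norm_eq_inner)
    also have "\<dots> = G\<^sup>2 * (norm (x0 - y0))\<^sup>2"
      using ab by (simp add: G_def d_def power_mult_distrib mult_ac)
    finally have "(norm (D a))\<^sup>2 \<le> (G * norm (x0 - y0))\<^sup>2" by (simp add: power_mult_distrib)
    then have "norm (D a) \<le> G * norm (x0 - y0)" by (rule power2_le_imp_le) (use G in auto)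
    then show ?thesis by (simp add: D_def norm_minus_commute)
  qed
  then have "\<forall>\<^sub>F y0 in at x0. norm (S y0 a - S x0 a) \<le> G * norm (y0 - x0)"
    by (intro always_eventually allI)
  moreover have "((\<lambda>y0. G * norm (y0 - x0)) \<longlongrightarrow> G * norm (x0 - x0)) (at x0)"
    by (intro tendsto_intros)
  then have "((\<lambda>y0. G * norm (y0 - x0)) \<longlongrightarrow> 0) (at x0)" by simp
  ultimately have "((\<lambda>y0. S y0 a - S x0 a) \<longlongrightarrow> 0) (at x0)"
    by (rule Lim_null_comparison)
  then show "isCont (\<lambda>x0. S x0 a) x0"
    by (simp add: isCont_def LIM_zero_iff)
qed

lemma companion_pot:
  assumes e: "erate e \<nu>" and ab: "0 \<le> a" "a \<le> b" and x: "x a = x0" "xsol a b x"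
    and S: "S b = mat 1" "\<And>t. t \<in> {a..b} \<Longrightarrow>
      (S has_vector_derivative att (- kR) \<rho> (inp t (x t)) (S t)) (at t within {a..b})"
    and t: "t \<in> {a..b}"
  shows "pot \<rho> (S t) \<le> ener e \<nu> a x0 t"
proof -
  have "ener e \<nu> a x0 b - pot \<rho> (S b) \<le> ener e \<nu> a x0 t - pot \<rho> (S t)"
  proof (rule vd_nonincreasing[of t b])
    fix r assume r: "t \<le> r" "r \<le> b"
    define A u where "A = ang \<rho> (S r)" and "u = inp r (x r)"
    have "((\<lambda>r. pot \<rho> (S r)) has_vector_derivative - 2 * (- kR) * (A \<bullet> A) - 2 * (A \<bullet> u)) (at r within {t..b})"
      unfolding A_def u_def
      by (intro pot_vd has_vector_derivative_within_subset[OF S(2)]) (use r t in auto)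
    then show "((\<lambda>r. ener e \<nu> a x0 r - pot \<rho> (S r)) has_vector_derivative
        - \<nu> * ener e \<nu> a x0 r - (- 2 * (- kR) * (A \<bullet> A) - 2 * (A \<bullet> u))) (at r within {t..b})"
      by (intro has_vector_derivative_diff ener_vd)
    have "(u \<bullet> u) / kR \<le> \<nu> * ener e \<nu> a x0 r"
      using erateD(3)[OF e ab(1) _ _ x(2), of r] r t by (simp add: x(1) u_def)
    moreover have "2 * (A \<bullet> u) \<le> kR * (A \<bullet> A) + (u \<bullet> u) / kR" using young[of A u] by (simp add: abs_if split: if_splits)
    moreover have "0 \<le> kR * (A \<bullet> A)" using kR_pos by simp
    ultimately show "- \<nu> * ener e \<nu> a x0 r - (- 2 * (- kR) * (A \<bullet> A) - 2 * (A \<bullet> u)) \<le> 0" by simp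
  qed (use t in auto)
  moreover have "pot \<rho> (S b) = 0" by (simp add: S(1) pot_def mat_def)
  moreover have "0 \<le> ener e \<nu> a x0 b" using erateD(1)[OF e] by (simp add: ener_nonneg)
  ultimately show ?thesis by simp
qed

text \<open>The comparison determinant grows at rate \<open>k (pot R - pot S) / 2\<close>. It is bounded, so if the potential
  of \<open>R\<close> does not decay, the determinant must have been small initially.\<close>

lemma companion_det_bound:
  assumes e: "erate e \<nu>" and z: "is_solution fld t0 z" and b: "t0 \<le> b"
    and l: "\<And>t. t0 \<le> t \<Longrightarrow> l \<le> pot \<rho> (fst (z t)) + ener e \<nu> t0 (snd (z t0)) t"
    and S: "companion t0 b (snd (z t0)) S"
  shows "(det (mat 1 + fst (z t0) ** transpose (S t0)))\<^sup>2
    \<le> 64 * exp (kR / \<nu> * (2 * ener e \<nu> t0 (snd (z t0)) t0)) * exp (- (kR * l * (b - t0)))"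
proof -
  have t0: "0 \<le> t0" by (rule solution_nonneg[OF z])
  have \<nu>: "0 < \<nu>" and e0: "0 < e" using erateD[OF e] by auto
  obtain y where y: "y t0 = snd (z t0)" "xsol t0 b y" and S0: "S b = mat 1"
    "\<And>t. t \<in> {t0..b} \<Longrightarrow> S t \<in> SO3"
    "\<And>t. t \<in> {t0..b} \<Longrightarrow> (S has_vector_derivative att (- kR) \<rho> (inp t (y t)) (S t)) (at t within {t0..b})"
    using S unfolding companion_def by blast
  have yz: "y t = snd (z t)" if "t \<in> {t0..b}" for t
    using xsol_unique[OF t0 y(2) solution_xsol[OF z order_refl, of b] y(1)] that by auto
  define E where "E = ener e \<nu> t0 (snd (z t0))"
  define q where "q = (\<lambda>t. det (mat 1 + fst (z t) ** transpose (S t)))"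
  define h where "h = (\<lambda>t. l * (t - t0) + 2 / \<nu> * E t)"
  define Z where "Z = (\<lambda>t. (q t * q t) * exp (- kR * h t))"
  have "- Z b \<le> - Z t0"
  proof (rule vd_nonincreasing[OF b])
    fix t assume "t0 \<le> t" "t \<le> b"
    then have t: "t \<in> {t0..b}" by simp
    define m where "m = kR / 2 * (pot \<rho> (fst (z t)) - pot \<rho> (S t))"
    have dq: "(q has_vector_derivative m * q t) (at t within {t0..b})"
      unfolding q_def m_def
      using det_comparison_vd[of "\<lambda>t. fst (z t)" kR \<rho> "inp t (snd (z t))" t "{t0..b}" S]
        solution_components(1)[OF z, of t "{t0..b}"] solution_SO3[OF z, of t] S0(2,3)[OF t] yz[OF t] t by auto
    have dh: "(h has_vector_derivative l * 1 + 2 / \<nu> * (- \<nu> * E t)) (at t within {t0..b})"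
      unfolding h_def E_def
      by (intro has_vector_derivative_add has_vector_derivative_mult_right ener_vd)
        (auto intro!: derivative_eq_intros)
    have "((\<lambda>t. exp (- kR * h t)) has_vector_derivative exp (- kR * h t) * (- kR * (l - 2 * E t))) (at t within {t0..b})"
      using dh \<nu> unfolding has_real_derivative_iff_has_vector_derivative[symmetric]
      by (auto intro!: derivative_eq_intros)
    then show "((\<lambda>t. - Z t) has_vector_derivative - ((q t * q t) * (exp (- kR * h t) * (- kR * (l - 2 * E t)))
        + (q t * (m * q t) + (m * q t) * q t) * exp (- kR * h t))) (at t within {t0..b})"
      unfolding Z_def by (intro has_vector_derivative_minus has_vector_derivative_mult dq)
    have "pot \<rho> (S t) \<le> E t"
      unfolding E_def by (rule companion_pot[OF e t0 b y S0(1) S0(3) t])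
    moreover have "l - E t \<le> pot \<rho> (fst (z t))" using l[of t] t by (simp add: E_def)
    ultimately have "kR / 2 * (l - 2 * E t) \<le> m"
      unfolding m_def using kR_pos by (intro mult_left_mono) auto
    then have "0 \<le> 2 * m - kR * (l - 2 * E t)" by simp
    moreover have "0 \<le> (q t * q t) * exp (- kR * h t)" by simp
    ultimately have "0 \<le> (2 * m - kR * (l - 2 * E t)) * ((q t * q t) * exp (- kR * h t))"
      by (rule mult_nonneg_nonneg)
    then show "- ((q t * q t) * (exp (- kR * h t) * (- kR * (l - 2 * E t)))
        + (q t * (m * q t) + (m * q t) * q t) * exp (- kR * h t)) \<le> 0"
      by (simp add: algebra_simps)
  qed
  then have "(q t0)\<^sup>2 * exp (- kR * h t0) \<le> (q b)\<^sup>2 * exp (- kR * h b)"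
    by (simp add: Z_def power2_eq_square)
  also have "\<dots> \<le> 64 * exp (- (kR * l * (b - t0)))"
  proof (intro mult_mono)
    have T: "fst (z b) ** transpose (S b) \<in> SO3"
      using solution_SO3[OF z b] S0(2)[of b] b by (intro SO3_mult SO3_transpose) auto
    have "\<bar>q b\<bar> \<le> 8"
      unfolding q_def det_id_plus_SO3[OF T]
      using SO3_trace_ge[OF T] SO3_diag_le[OF T, of 1] SO3_diag_le[OF T, of 2] SO3_diag_le[OF T, of 3]
      by (simp add: trace_def sum_3)
    then show "(q b)\<^sup>2 \<le> 64" using power_mono[of "\<bar>q b\<bar>" 8 2] by simp
    have "0 \<le> kR * (2 / \<nu> * E b)"
      using kR_pos \<nu> e0 by (simp add: E_def ener_nonneg)
    then show "exp (- kR * h b) \<le> exp (- (kR * l * (b - t0)))"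
      by (simp add: h_def distrib_left)
  qed auto
  finally have "exp (kR * h t0) * ((q t0)\<^sup>2 * exp (- kR * h t0)) \<le> exp (kR * h t0) * (64 * exp (- (kR * l * (b - t0))))"
    by (intro mult_left_mono) auto
  moreover have "exp (kR * h t0) * exp (- kR * h t0) = 1" by (simp flip: exp_add)
  then have "exp (kR * h t0) * ((q t0)\<^sup>2 * exp (- kR * h t0)) = (q t0)\<^sup>2" by (metis mult.commute mult.left_commute mult_1)
  ultimately have "(q t0)\<^sup>2 \<le> exp (kR * h t0) * (64 * exp (- (kR * l * (b - t0))))" by (simp only:)
  moreover have "kR * h t0 = kR / \<nu> * (2 * E t0)" by (simp add: h_def)
  ultimately show ?thesis unfolding q_def E_def by (simp only: mult_ac)
qed

lemma exceptional_solution: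
  assumes z: "is_solution fld t0 z" and nt: "\<not> (z \<longlongrightarrow> (mat 1, 0)) at_top"
    and S: "\<And>m. companion t0 (t0 + real m) (snd (z t0)) (S m)"
  shows "(\<lambda>m. det (mat 1 + fst (z t0) ** transpose (S m t0))) \<longlonglongrightarrow> 0"
proof -
  obtain e \<nu> where e: "erate e \<nu>" by (rule erate_exists)
  note lim = solution_limits[OF e z]
  obtain l where l: "((\<lambda>t. pot \<rho> (fst (z t))) \<longlongrightarrow> l) at_top"
    "\<And>t. t0 \<le> t \<Longrightarrow> l \<le> pot \<rho> (fst (z t)) + ener e \<nu> t0 (snd (z t0)) t"
    using lim(3) by blast
  have l0: "0 \<le> l"
    by (rule tendsto_lowerbound[OF l(1)])
      (auto intro!: eventually_mono[OF eventually_ge_at_top[of t0]] pot_nonneg solution_SO3[OF z])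
  have "l \<noteq> 0"
  proof
    assume "l = 0"
    obtain r s where rs: "0 < r" "r \<le> s" "\<And>i. r \<le> \<rho>$i" "\<And>i. \<rho>$i \<le> s" by (rule \<rho>_bounds) blast
    have "((\<lambda>t. sqrt (2 / r * pot \<rho> (fst (z t)))) \<longlongrightarrow> sqrt (2 / r * 0)) at_top"
      using l(1) \<open>l = 0\<close> by (intro tendsto_intros) auto
    then have tend: "((\<lambda>t. sqrt (2 / r * pot \<rho> (fst (z t)))) \<longlongrightarrow> 0) at_top" by simp
    have nb: "norm (fst (z t) - mat 1) \<le> sqrt (2 / r * pot \<rho> (fst (z t)))" if "t0 \<le> t" for t
    proof (rule real_le_rsqrt)
      have "2 / r * (r * (3 - trace (fst (z t)))) \<le> 2 / r * pot \<rho> (fst (z t))"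
        using pot_bounds(1)[OF solution_SO3[OF z that] rs(3,4)] rs(1) by (intro mult_left_mono) auto
      then show "(norm (fst (z t) - mat 1))\<^sup>2 \<le> 2 / r * pot \<rho> (fst (z t))"
        using rs(1) by (simp add: norm_SO3_minus_id[OF solution_SO3[OF z that]])
    qed
    have "\<forall>\<^sub>F t in at_top. norm (fst (z t) - mat 1) \<le> sqrt (2 / r * pot \<rho> (fst (z t)))"
      by (rule eventually_mono[OF eventually_ge_at_top[of t0]]) (rule nb)
    then have "((\<lambda>t. fst (z t) - mat 1) \<longlongrightarrow> 0) at_top"
      by (rule Lim_null_comparison) (rule tend)
    then have "((\<lambda>t. fst (z t)) \<longlongrightarrow> mat 1) at_top" by (simp add: LIM_zero_iff)
    from tendsto_Pair[OF this lim(2)] show False using nt by simp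
  qed
  then have kl: "0 < kR * l" using l0 kR_pos by simp
  define q where "q = (\<lambda>m. det (mat 1 + fst (z t0) ** transpose (S m t0)))"
  define c where "c = 64 * exp (kR / \<nu> * (2 * ener e \<nu> t0 (snd (z t0)) t0))"
  have "(\<lambda>m. (q m)\<^sup>2) \<longlonglongrightarrow> 0"
  proof (rule tendsto_sandwich[of "\<lambda>_. 0" _ _ "\<lambda>m. c * exp (- (kR * l)) ^ m"])
    have "(q m)\<^sup>2 \<le> c * exp (- (kR * l)) ^ m" for m
      using companion_det_bound[OF e z _ l(2) S, of m] by (simp add: q_def c_def exp_of_nat_mult[symmetric] mult_ac)
    then show "\<forall>\<^sub>F m in sequentially. (q m)\<^sup>2 \<le> c * exp (- (kR * l)) ^ m" by simp
    have "(\<lambda>m. exp (- (kR * l)) ^ m) \<longlonglongrightarrow> 0" using kl by (intro LIMSEQ_realpow_zero) auto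
    from tendsto_mult_left[OF this, of c]
    show "(\<lambda>m. c * exp (- (kR * l)) ^ m) \<longlonglongrightarrow> 0" by simp
  qed simp_all
  then have "(\<lambda>m. sqrt ((q m)\<^sup>2)) \<longlonglongrightarrow> sqrt 0" by (rule tendsto_real_sqrt)
  then show ?thesis by (simp add: q_def tendsto_rabs_zero_iff)
qed

end

lemma tendsto_det_3: "(X \<longlongrightarrow> A) F \<Longrightarrow> ((\<lambda>t. det (X t)) \<longlongrightarrow> det A) F" for A :: "real^3^3"
  unfolding det_3 by (intro tendsto_intros)

lemma measurable_expSO3: "expSO3 \<in> borel_measurable borel"
proof -
  have "(\<lambda>w. if w \<in> {0} then mat 1 else expSO3 w) \<in> borel_measurable borel"
    by (intro borel_measurable_continuous_on_if continuous_on_expSO3) auto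
  moreover have "(\<lambda>w. if w \<in> {0} then mat 1 else expSO3 w) = expSO3"
    by (auto simp: expSO3_def rot_axis_0)
  ultimately show ?thesis by simp
qed

text \<open>For fixed \<open>x\<close> every limit point of \<open>S m x\<close> is a rotation, whose exceptional set is negligible;
  Fubini does the rest.\<close>

lemma exceptional_set_null:
  fixes S :: "nat \<Rightarrow> 'a::euclidean_space \<Rightarrow> real^3^3"
  assumes cont: "\<And>m. continuous_on UNIV (S m)" and SO: "\<And>m x. S m x \<in> SO3"
  shows "{(w, x). (\<lambda>m. det (mat 1 + expSO3 w ** transpose (S m x))) \<longlonglongrightarrow> 0} \<in> null_sets lborel" (is "?N \<in> _")
proof -
  define q where "q = (\<lambda>m (z :: (real^3) \<times> 'a). det (mat 1 + expSO3 (fst z) ** transpose (S m (snd z))))"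
  have q_meas [measurable]: "q m \<in> borel_measurable borel" for m
  proof -
    have "(\<lambda>z :: (real^3) \<times> 'a. expSO3 (fst z)) \<in> borel_measurable borel"
      by (rule measurable_compose[OF _ measurable_expSO3]) (intro borel_measurable_continuous_onI continuous_intros)
    moreover have "(\<lambda>z :: (real^3) \<times> 'a. S m (snd z)) \<in> borel_measurable borel"
      by (intro borel_measurable_continuous_onI continuous_on_compose2[OF cont] continuous_intros) auto
    moreover have "continuous_on UNIV (\<lambda>z. det (mat 1 + fst z ** transpose (snd z) :: real^3^3))"
      unfolding det_3 by (intro continuous_intros)
    ultimately show ?thesis 
      unfolding q_def by (rule borel_measurable_continuous_Pair[where H = "\<lambda>A B. det (mat 1 + A ** transpose B)"])
  qed
  have "convergent X \<and> lim X = 0 \<longleftrightarrow> X \<longlonglongrightarrow> 0" for X :: "nat \<Rightarrow> real"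
    using convergent_LIMSEQ_iff[of X] convergentI[of X 0] limI[of X 0] by auto
  then have N: "?N = {z. convergent (\<lambda>m. q m z) \<and> lim (\<lambda>m. q m z) = 0}"
    by (simp add: q_def case_prod_unfold)
  have "{z. convergent (\<lambda>m. q m z)} \<in> sets borel"
    using sets_Collect_Cauchy[of q borel, OF q_meas] by (simp add: Cauchy_convergent_iff)
  moreover have "(\<lambda>z. lim (\<lambda>m. q m z)) \<in> borel_measurable borel"
    by (rule borel_measurable_lim_metric) (rule q_meas)
  then have "(\<lambda>z. lim (\<lambda>m. q m z)) -` {0} \<in> sets borel"
    by (rule measurable_sets_borel) simp
  ultimately have "{z. convergent (\<lambda>m. q m z)} \<inter> (\<lambda>z. lim (\<lambda>m. q m z)) -` {0} \<in> sets borel"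
    by (intro sets.Int) simp_all
  moreover have "{z. convergent (\<lambda>m. q m z)} \<inter> (\<lambda>z. lim (\<lambda>m. q m z)) -` {0} = ?N"
    unfolding N by blast
  ultimately have bor: "?N \<in> sets borel" by (simp only:)
  have slice: "emeasure lborel ((\<lambda>w. (w, x)) -` ?N) = 0" for x
  proof -
    obtain S0 r where S0: "S0 \<in> SO3" "strict_mono r" "(\<lambda>m. S (r m) x) \<longlonglongrightarrow> S0"
      using seq_compactE[OF compact_imp_seq_compact[OF compact_SO3], of "\<lambda>m. S m x"] SO
      by (auto simp: o_def)
    have "(\<lambda>w. (w, x)) -` ?N \<subseteq> {w. det (mat 1 + expSO3 w ** transpose S0) = 0}"
    proof
      fix w assume "w \<in> (\<lambda>w. (w, x)) -` ?N"
      then have "(\<lambda>m. det (mat 1 + expSO3 w ** transpose (S m x))) \<longlonglongrightarrow> 0" by simp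
      from LIMSEQ_subseq_LIMSEQ[OF this S0(2)]
      have 1: "(\<lambda>m. det (mat 1 + expSO3 w ** transpose (S (r m) x))) \<longlonglongrightarrow> 0" by (simp add: o_def)
      have "(\<lambda>m. det (mat 1 + expSO3 w ** transpose (S (r m) x))) \<longlonglongrightarrow> det (mat 1 + expSO3 w ** transpose S0)"
        by (intro tendsto_det_3 tendsto_add tendsto_const tendsto_matrix_matrix tendsto_transpose S0)
      with 1 show "w \<in> {w. det (mat 1 + expSO3 w ** transpose S0) = 0}" using LIMSEQ_unique by blast
    qed
    then have "negligible ((\<lambda>w. (w, x)) -` ?N)"
      by (rule negligible_subset[OF negligible_exp_SO3[OF S0(1)]])
    moreover have "(\<lambda>w. (w, x)) -` ?N \<in> sets lborel"
      using measurable_sets_borel[OF borel_measurable_continuous_onI bor, of "\<lambda>w. (w, x)"]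
      by (simp add: continuous_on_Pair continuous_on_id continuous_on_const)
    ultimately show ?thesis
      by (simp add: negligible_iff_null_sets null_sets_completion_iff null_setsD1)
  qed
  have "emeasure (lborel \<Otimes>\<^sub>M lborel) ?N = (\<integral>\<^sup>+ x. emeasure lborel ((\<lambda>w. (w, x)) -` ?N) \<partial>lborel)"
    by (rule lborel_pair.emeasure_pair_measure_alt2) (simp only: lborel_prod sets_lborel bor)
  also have "\<dots> = 0" by (simp only: slice nn_integral_const mult_zero_left)
  finally show ?thesis using bor by (simp only: null_sets_def lborel_prod sets_lborel mem_Collect_eq)
qed

context closed_loop
begin

lemma almost_global_stability: "almost_glob_asym_stable fld (mat 1, 0)"
  unfolding almost_glob_asym_stable_def
proof (intro conjI stable allI impI)
  fix t0 :: real assume t0: "0 \<le> t0"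
  have "\<exists>S. companion t0 (t0 + real m) x0 S" for m x0
    using t0 by (intro companion_exists) auto
  then obtain S where S: "\<And>m x0. companion t0 (t0 + real m) x0 (S m x0)" by metis
  have SO: "S m x0 t0 \<in> SO3" for m x0
    using S[of m x0] unfolding companion_def by auto
  have cont: "continuous_on UNIV (\<lambda>x0. S m x0 t0)" for m
    using t0 S by (intro companion_start_continuous[of t0 "t0 + real m"]) auto
  define N where "N = {(R, x). R \<in> SO3 \<and> (\<lambda>m. det (mat 1 + R ** transpose (S m x t0))) \<longlonglongrightarrow> 0}"
  have "SO3_R15_null N"
    unfolding SO3_R15_null_def N_def
    using exceptional_set_null[OF cont SO] by (simp add: expSO3_in_SO3)
  moreover have "(z \<longlongrightarrow> (mat 1, 0)) at_top" if z: "is_solution fld t0 z" "z t0 \<notin> N" for z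
  proof (rule ccontr)
    assume "\<not> (z \<longlongrightarrow> (mat 1, 0)) at_top"
    from exceptional_solution[OF z(1) this S] have "z t0 \<in> N"
      using solution_SO3[OF z(1) order_refl] by (cases "z t0") (simp add: N_def)
    with z(2) show False by simp
  qed
  ultimately show "\<exists>S. S \<subseteq> SO3 \<times> UNIV \<and> SO3_R15_null S \<and>
      (\<forall>z. is_solution fld t0 z \<and> z t0 \<notin> S \<longrightarrow> (z \<longlongrightarrow> (mat 1, 0)) at_top)"
    by (intro exI[of _ N]) (auto simp: N_def)
qed

end

theorem theorem1:
  fixes \<omega> :: "real \<Rightarrow> real^3" and g :: "real^3" and Rh :: "real \<Rightarrow> real^3^3"
    and N :: nat and C :: "real \<Rightarrow> real^(blk \<times> 3)^'m"
    and kR :: real and \<rho> :: "real^3"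
    and Q :: "real \<Rightarrow> real^'m^'m" and V :: "real \<Rightarrow> real^(blk \<times> 3)^(blk \<times> 3)"
    and P :: "real \<Rightarrow> real^(blk \<times> 3)^(blk \<times> 3)"
  assumes \<omega>_cont: "continuous_on {0..} \<omega>" and \<omega>_bdd: "bounded (\<omega> ` {0..})"
    and Rh_cont: "continuous_on {0..} Rh" and Rh_SO3: "\<forall>t\<ge>0. Rh t \<in> SO3"
    and N_pos: "N > 0" and m_card: "CARD('m) = 3 * N"
    and C_cont: "continuous_on {0..} C" and C_bdd: "bounded (C ` {0..})"
    and obs: "unif_observable (Amat \<omega> g) C"
    and kR_pos: "kR > 0"
    and \<rho>_pos: "\<forall>i. \<rho>$i > 0" and \<rho>_dist: "\<forall>i j. i \<noteq> j \<longrightarrow> \<rho>$i \<noteq> \<rho>$j"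
    and Q_cont: "continuous_on {0..} Q" and Q_bdd: "bounded (Q ` {0..})" and Q_pd: "unif_pos_def Q"
    and V_cont: "continuous_on {0..} V" and V_bdd: "bounded (V ` {0..})" and V_pd: "unif_pos_def V"
    and P_ric: "\<forall>t\<ge>0. (P has_vector_derivative
        (Amat \<omega> g t ** P t + P t ** transpose (Amat \<omega> g t)
         - P t ** transpose (C t) ** Q t ** C t ** P t + V t)) (at t within {0..})"
    and P0: "pos_def_mat (P 0)"
  shows
    "(\<forall>t0 z. is_solution (cl_field kR \<rho> Rh \<omega> g C Q P) t0 z \<longrightarrow>
        ((\<lambda>t. infdist (z t) ({(mat 1, 0)} \<union> Psi_M (diag3 \<rho>))) \<longlongrightarrow> 0) at_top)
     \<and> loc_exp_stable (cl_field kR \<rho> Rh \<omega> g C Q P) (mat 1, 0)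
     \<and> (\<forall>p \<in> Psi_M (diag3 \<rho>). equilibrium (cl_field kR \<rho> Rh \<omega> g C Q P) p
            \<and> \<not> lyap_stable (cl_field kR \<rho> Rh \<omega> g C Q P) p)
     \<and> almost_glob_asym_stable (cl_field kR \<rho> Rh \<omega> g C Q P) (mat 1, 0)"
proof -
  interpret closed_loop \<omega> g Rh C kR \<rho> Q V P
    using \<omega>_cont \<omega>_bdd Rh_cont Rh_SO3 C_cont C_bdd obs kR_pos \<rho>_pos \<rho>_dist Q_cont Q_bdd Q_pd V_bdd V_pd P_ric P0
    by unfold_locales
  show ?thesis
    using convergence local_exponential_stability Psi_M_equilibrium Psi_M_unstable almost_global_stability
    by blast
qed

end
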